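(* Let $\Psi:\mathbb{X}\to\mathbb{R}$ be convex, lower semicontinuous and Fréchet differentiable, and let $A=D\Psi:\mathbb{X}\to\mathbb{H}^*$ be its derivative. Let $j:\mathbb{H}\to\mathbb{R}\cup\{+\infty\}$ be non-negative, proper (there is at least one $\mathbf{w}\in\mathbb{H}$ with $j(\mathbf{w})<\infty$), convex, positively homogeneous ($j(\alpha\mathbf{z})=\alpha j(\mathbf{z})$ for all $\alpha>0$, $\mathbf{z}\in\mathbb{H}$) and lower semicontinuous. Let moreover $A$ be strongly monotone on $\mathbb{X}_0$, i.e. there exists $m>0$ such that $$\langle A(\mathbf{w}_1)-A(\mathbf{w}_2),\mathbf{w}_1-\mathbf{w}_2\rangle\ \ge\ m\,\|\mathbf{w}_1-\mathbf{w}_2\|_{\mathbb{H}}^2\qquad\text{for all }\mathbf{w}_1,\mathbf{w}_2\in\mathbb{X}_0 .$$ Then, for $N$ fixed and any given $\{\ell_n\}_{n=0}^N$ with $\ell_n\in\mathbb{H}^*$ and $\ell_0=0$, there exists a unique sequence $\{\mathbf{w}_n\}_{n=0}^N$ with $\mathbf{w}_0=\mathbf{0}$ such that $\mathbf{w}_n\in\mathbb{X}_0$, $\Delta\mathbf{w}_n:=\mathbf{w}_n-\mathbf{w}_{n-1}\in\mathbb{H}_0$ and $$\langle A(\mathbf{w}_n),\mathbf{z}-\Delta\mathbf{w}_n\rangle+j(\mathbf{z})-j(\Delta\mathbf{w}_n)\ \ge\ \langle\ell_n,\mathbf{z}-\Delta\mathbf{w}_n\rangle\qquad\text{for all }\mathbf{z}\in\mathbb{H},\quad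 n=1,\dots,N.$$ The set of test functions can be equivalently restricted to $\mathbf{z}\in\mathbb{H}_0$. The solution satisfies, with $\Delta\ell_n:=\ell_n-\ell_{n-1}$, the stability estimate $$\|\Delta\mathbf{w}_n\|_{\mathbb{H}}\ \le\ \frac1m\,\|\Delta\ell_n\|_{\mathbb{H}^*},\qquad n=1,\dots,N.$$
   Context: Let $\Omega\subset\mathbb{R}^d$, $d=2,3$, be a domain (the body), with boundary parts $\Gamma_{fix},\Gamma_{ins}\subset\partial\Omega$ and unit normal $\mathbf{n}$. Define the Hilbert spaces $\mathbb{U}=\{\mathbf{u}\in[H^1(\Omega)]^d:\mathbf{u}=\mathbf{0}\text{ on }\Gamma_{fix}\}$, $\mathbb{D}=\{\mathbf{D}\in H(\operatorname{div},\Omega):\mathbf{D}\cdot\mathbf{n}=0\text{ on }\Gamma_{ins}\}$, $\mathbb{D}_0=\{\mathbf{D}\in\mathbb{D}:\operatorname{div}\mathbf{D}=0\}$, $\mathbb{S}=[L^2(\Omega)]^{d\times d}_{sym}$, $\mathbb{P}=[L^2(\Omega)]^d$, and the product spaces $\mathbb{H}=\mathbb{U}\times\mathbb{D}\times\mathbb{S}\times\mathbb{P}$, $\mathbb{H}_0=\mathbb{U}\times\mathbb{D}_0\times\mathbb{S}\times\mathbb{P}$ (with the norm $\|\cdot\|_{\mathbb{H}}$); $\mathbb{H}^*$ is the dual of $\mathbb{H}$ and $\langle\cdot,\cdot\rangle$ the duality pairing. Elements are written $\mathbf{w}$ (displacement $\mathbf{u}$, which enters through the strain $\frac12(\nabla\mathbf{u}+\nabla\mathbf{u}^T)$,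 dielectric displacement $\mathbf{D}$, remanent strain $\mathbf{S}^i$, remanent polarization $\mathbf{P}^i$) and $\mathbf{z}$ (components $\tilde{\mathbf{u}},\tilde{\mathbf{D}},\tilde{\mathbf{S}}^i,\tilde{\mathbf{P}}^i$). $\Psi$ is the free energy functional, with values in $\mathbb{R}\cup\{+\infty\}$ on $\mathbb{H}$; its effective domain is $\mathbb{X}=\{\mathbf{z}\in\mathbb{H}:\Psi(\mathbf{z})<\infty\}$, and $\mathbb{X}_0=\mathbb{X}\cap\mathbb{H}_0$. The initial state $\mathbf{0}$ belongs to $\mathbb{X}_0$. The operator $A$ is given by $\langle A(\mathbf{w}),\mathbf{z}\rangle=\langle\frac{\partial\Psi}{\partial\mathbf{w}}(\mathbf{w}),\mathbf{z}\rangle$. $j$ is the augmented dissipation function built from a dissipation function $\Phi:\mathbb{H}\to\mathbb{R}$ by $$j(\mathbf{z})=\Phi(\mathbf{z})+\sup_{\phi\in L^2(\Omega)}\int_\Omega\operatorname{div}\tilde{\mathbf{D}}\,\phi\,dx,$$ so $j=\Phi$ on $\mathbb{H}_0$ and $j=+\infty$ on $\mathbb{H}\setminus\mathbb{H}_0$.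
   Formalization: The stability estimate for n=1 is claimed only if the initial state is in equilibrium, i.e. ⟨A(0),z⟩+j(z)≥0 for all z in H; without this it is false (j=0 on H_0, Ψ=½‖w−w*‖², ℓ_n=0). Ψ is taken as lower semicontinuous and Fréchet differentiable as a functional on H. *)

theory Defs
  imports "HOL-Analysis.Analysis" "HOL-Library.Function_Algebras"
begin

section \<open>Pointwise real vector space structure on functions\<close>

instantiation "fun" :: (type, real_vector) real_vector
begin

definition scaleR_fun_def: "c *\<^sub>R f = (\<lambda>x. c *\<^sub>R f x)"

instance
  by standard (simp_all add: scaleR_fun_def plus_fun_def algebra_simps)

end

section \<open>Square integrable functions and weak derivatives\<close>

text \<open>
  Elements of the function spaces are represented by functions on the whole space, of which only
  the values almost everywhere in \<open>\<Omega>\<close> matter.  The functionals called norms below are therefore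
  seminorms on representatives, and equality of elements is almost everywhere equality
  (\<open>state_eq\<close> below).
\<close>

definition L2 :: "(real^'d) set \<Rightarrow> (real^'d \<Rightarrow> 'b::euclidean_space) set" where
  "L2 \<Omega> = {f. f \<in> borel_measurable (lebesgue_on \<Omega>) \<and>
               integrable (lebesgue_on \<Omega>) (\<lambda>x. (norm (f x))\<^sup>2)}"

definition L2_norm :: "(real^'d) set \<Rightarrow> (real^'d \<Rightarrow> 'b::euclidean_space) \<Rightarrow> real" where
  "L2_norm \<Omega> f = sqrt (\<integral>x. (norm (f x))\<^sup>2 \<partial>lebesgue_on \<Omega>)"

primrec Ck :: "nat \<Rightarrow> (real^'d \<Rightarrow> real) \<Rightarrow> bool" where
  "Ck 0 f \<longleftrightarrow> continuous_on UNIV f"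
| "Ck (Suc k) f \<longleftrightarrow>
     (\<exists>g. (\<forall>x. (f has_derivative (\<lambda>h. g x \<bullet> h)) (at x)) \<and> (\<forall>i. Ck k (\<lambda>x. g x $ i)))"

definition grad :: "(real^'d \<Rightarrow> real) \<Rightarrow> real^'d \<Rightarrow> real^'d" where
  "grad f x = (\<chi> i. frechet_derivative f (at x) (axis i 1))"

definition test_functions :: "(real^'d) set \<Rightarrow> (real^'d \<Rightarrow> real) set" where
  "test_functions \<Omega> = {\<phi>. (\<forall>k. Ck k \<phi>) \<and>
     compact (closure {x. \<phi> x \<noteq> 0}) \<and> closure {x. \<phi> x \<noteq> 0} \<subseteq> \<Omega>}"

definition is_weak_grad ::
  "(real^'d) set \<Rightarrow> (real^'d \<Rightarrow> real) \<Rightarrow> (real^'d \<Rightarrow> real^'d) \<Rightarrow> bool" where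
  "is_weak_grad \<Omega> u g \<longleftrightarrow> g \<in> L2 \<Omega> \<and>
     (\<forall>\<phi>\<in>test_functions \<Omega>. \<forall>i.
        (\<integral>x. u x * grad \<phi> x $ i \<partial>lebesgue_on \<Omega>) = - (\<integral>x. g x $ i * \<phi> x \<partial>lebesgue_on \<Omega>))"

definition weak_grad :: "(real^'d) set \<Rightarrow> (real^'d \<Rightarrow> real) \<Rightarrow> real^'d \<Rightarrow> real^'d" where
  "weak_grad \<Omega> u = (SOME g. is_weak_grad \<Omega> u g)"

definition H1 :: "(real^'d) set \<Rightarrow> (real^'d \<Rightarrow> real) set" where
  "H1 \<Omega> = {u \<in> L2 \<Omega>. \<exists>g. is_weak_grad \<Omega> u g}"

definition is_weak_div ::
  "(real^'d) set \<Rightarrow> (real^'d \<Rightarrow> real^'d) \<Rightarrow> (real^'d \<Rightarrow> real) \<Rightarrow> bool" where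
  "is_weak_div \<Omega> D q \<longleftrightarrow> q \<in> L2 \<Omega> \<and>
     (\<forall>\<phi>\<in>test_functions \<Omega>.
        (\<integral>x. D x \<bullet> grad \<phi> x \<partial>lebesgue_on \<Omega>) = - (\<integral>x. q x * \<phi> x \<partial>lebesgue_on \<Omega>))"

definition weak_div :: "(real^'d) set \<Rightarrow> (real^'d \<Rightarrow> real^'d) \<Rightarrow> real^'d \<Rightarrow> real" where
  "weak_div \<Omega> D = (SOME q. is_weak_div \<Omega> D q)"

definition Hdiv :: "(real^'d) set \<Rightarrow> (real^'d \<Rightarrow> real^'d) set" where
  "Hdiv \<Omega> = {D \<in> L2 \<Omega>. \<exists>q. is_weak_div \<Omega> D q}"

section \<open>Surface measure and boundary conditions\<close>

definition hausdorff_pre :: "nat \<Rightarrow> real \<Rightarrow> 'a::metric_space set \<Rightarrow> ennreal" where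
  "hausdorff_pre s \<delta> A =
     (INF C \<in> {C :: nat \<Rightarrow> 'a set. A \<subseteq> (\<Union>i. C i) \<and> (\<forall>i. bounded (C i) \<and> diameter (C i) \<le> \<delta>)}.
        \<Sum>i. ennreal (unit_ball_vol (real s) * (diameter (C i) / 2) ^ s))"

definition hausdorff_outer :: "nat \<Rightarrow> 'a::metric_space set \<Rightarrow> ennreal" where
  "hausdorff_outer s A = (SUP \<delta>\<in>{0<..}. hausdorff_pre s \<delta> A)"

text \<open>
  The Hausdorff measure of codimension one.  For \<open>CARD('d) \<ge> 2\<close>, \<open>hausdorff_outer\<close> is a metric outer
  measure, hence countably additive on the Borel sets, so \<open>measure_of\<close> does not degenerate.
\<close>

definition surface_measure :: "(real^'d) measure" where
  "surface_measure = measure_of UNIV (sets borel) (hausdorff_outer (CARD('d) - 1))"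

text \<open>
  Vanishing trace on \<open>\<Gamma> \<subseteq> \<partial>\<Omega>\<close>: the trace operator on \<open>H\<^sup>1(\<Omega>)\<close> is the continuous extension to
  \<open>L\<^sup>2(\<Gamma>)\<close> of the restriction of smooth functions to \<open>\<Gamma>\<close>, so the trace of \<open>u\<close> on \<open>\<Gamma>\<close> is zero iff
  \<open>u\<close> is a limit in \<open>H\<^sup>1(\<Omega>)\<close> of smooth functions whose restrictions tend to zero in \<open>L\<^sup>2(\<Gamma>)\<close>.
\<close>

definition zero_trace_on ::
  "(real^'d) set \<Rightarrow> (real^'d) set \<Rightarrow> (real^'d \<Rightarrow> real) \<Rightarrow> bool" where
  "zero_trace_on \<Omega> \<Gamma> u \<longleftrightarrow>
     (\<exists>\<phi>. (\<forall>k. \<phi> k \<in> test_functions UNIV) \<and>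
        (\<lambda>k. L2_norm \<Omega> (\<lambda>x. u x - \<phi> k x)) \<longlonglongrightarrow> 0 \<and>
        (\<lambda>k. L2_norm \<Omega> (\<lambda>x. weak_grad \<Omega> u x - grad (\<phi> k) x)) \<longlonglongrightarrow> 0 \<and>
        (\<lambda>k. \<integral>\<^sup>+x\<in>\<Gamma>. ennreal ((\<phi> k x)\<^sup>2) \<partial>surface_measure) \<longlonglongrightarrow> 0)"

text \<open>
  Vanishing normal component on \<open>\<Gamma> \<subseteq> \<partial>\<Omega>\<close>: for \<open>D \<in> H(div, \<Omega>)\<close> the normal component \<open>D \<cdot> n\<close> is the
  functional \<open>v \<mapsto> \<integral>\<^sub>\<Omega> (D \<cdot> \<nabla>v + div D v)\<close> (Green's formula) on traces of \<open>H\<^sup>1\<close> functions; it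
  vanishes on \<open>\<Gamma>\<close> iff it annihilates all \<open>v\<close> whose trace is zero on the rest of the boundary.
\<close>

definition zero_normal_trace_on ::
  "(real^'d) set \<Rightarrow> (real^'d) set \<Rightarrow> (real^'d \<Rightarrow> real^'d) \<Rightarrow> bool" where
  "zero_normal_trace_on \<Omega> \<Gamma> D \<longleftrightarrow>
     (\<forall>v\<in>H1 \<Omega>. zero_trace_on \<Omega> (frontier \<Omega> - \<Gamma>) v \<longrightarrow>
        (\<integral>x. D x \<bullet> weak_grad \<Omega> v x + weak_div \<Omega> D x * v x \<partial>lebesgue_on \<Omega>) = 0)"

section \<open>The state space\<close>

type_synonym 'd state =
  "(real^'d \<Rightarrow> real^'d) \<times> (real^'d \<Rightarrow> real^'d) \<times> (real^'d \<Rightarrow> real^'d^'d) \<times> (real^'d \<Rightarrow> real^'d)"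

definition U_space :: "(real^'d) set \<Rightarrow> (real^'d) set \<Rightarrow> (real^'d \<Rightarrow> real^'d) set" where
  "U_space \<Omega> \<Gamma>fix =
     {u. \<forall>k. (\<lambda>x. u x $ k) \<in> H1 \<Omega> \<and> zero_trace_on \<Omega> \<Gamma>fix (\<lambda>x. u x $ k)}"

definition D_space :: "(real^'d) set \<Rightarrow> (real^'d) set \<Rightarrow> (real^'d \<Rightarrow> real^'d) set" where
  "D_space \<Omega> \<Gamma>ins = {D \<in> Hdiv \<Omega>. zero_normal_trace_on \<Omega> \<Gamma>ins D}"

definition D0_space :: "(real^'d) set \<Rightarrow> (real^'d) set \<Rightarrow> (real^'d \<Rightarrow> real^'d) set" where
  "D0_space \<Omega> \<Gamma>ins = {D \<in> D_space \<Omega> \<Gamma>ins. AE x in lebesgue_on \<Omega>. weak_div \<Omega> D x = 0}"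

definition S_space :: "(real^'d) set \<Rightarrow> (real^'d \<Rightarrow> real^'d^'d) set" where
  "S_space \<Omega> = {S \<in> L2 \<Omega>. AE x in lebesgue_on \<Omega>. transpose (S x) = S x}"

definition P_space :: "(real^'d) set \<Rightarrow> (real^'d \<Rightarrow> real^'d) set" where
  "P_space \<Omega> = L2 \<Omega>"

definition H_space :: "(real^'d) set \<Rightarrow> (real^'d) set \<Rightarrow> (real^'d) set \<Rightarrow> 'd state set" where
  "H_space \<Omega> \<Gamma>fix \<Gamma>ins = U_space \<Omega> \<Gamma>fix \<times> D_space \<Omega> \<Gamma>ins \<times> S_space \<Omega> \<times> P_space \<Omega>"

definition H0_space :: "(real^'d) set \<Rightarrow> (real^'d) set \<Rightarrow> (real^'d) set \<Rightarrow> 'd state set" where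
  "H0_space \<Omega> \<Gamma>fix \<Gamma>ins = U_space \<Omega> \<Gamma>fix \<times> D0_space \<Omega> \<Gamma>ins \<times> S_space \<Omega> \<times> P_space \<Omega>"

definition H_norm :: "(real^'d) set \<Rightarrow> 'd state \<Rightarrow> real" where
  "H_norm \<Omega> = (\<lambda>(u, D, S, P). sqrt (
     (\<Sum>k\<in>UNIV. (L2_norm \<Omega> (\<lambda>x. u x $ k))\<^sup>2 + (L2_norm \<Omega> (weak_grad \<Omega> (\<lambda>x. u x $ k)))\<^sup>2) +
     ((L2_norm \<Omega> D)\<^sup>2 + (L2_norm \<Omega> (weak_div \<Omega> D))\<^sup>2) +
     (L2_norm \<Omega> S)\<^sup>2 + (L2_norm \<Omega> P)\<^sup>2))"

definition state_eq :: "(real^'d) set \<Rightarrow> 'd state \<Rightarrow> 'd state \<Rightarrow> bool" where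
  "state_eq \<Omega> = (\<lambda>(u, D, S, P) (u', D', S', P').
     AE x in lebesgue_on \<Omega>. u x = u' x \<and> D x = D' x \<and> S x = S' x \<and> P x = P' x)"

section \<open>Functionals on a linear space with a (semi)norm\<close>

text \<open>
  Here \<open>V\<close> is the carrier, a linear subspace of the ambient type, and \<open>nrm\<close> a seminorm on it;
  functionals are only meaningful on \<open>V\<close>.
\<close>

definition dual_space :: "'a::real_vector set \<Rightarrow> ('a \<Rightarrow> real) \<Rightarrow> ('a \<Rightarrow> real) set" where
  "dual_space V nrm = {f.
     (\<forall>x\<in>V. \<forall>y\<in>V. f (x + y) = f x + f y) \<and>
     (\<forall>c. \<forall>x\<in>V. f (c *\<^sub>R x) = c * f x) \<and>
     (\<exists>C. \<forall>x\<in>V. \<bar>f x\<bar> \<le> C * nrm x)}"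

definition dual_norm :: "'a::real_vector set \<Rightarrow> ('a \<Rightarrow> real) \<Rightarrow> ('a \<Rightarrow> real) \<Rightarrow> real" where
  "dual_norm V nrm f = (SUP x\<in>{x\<in>V. nrm x \<le> 1}. \<bar>f x\<bar>)"

definition lsc_fun :: "'a::real_vector set \<Rightarrow> ('a \<Rightarrow> real) \<Rightarrow> ('a \<Rightarrow> ereal) \<Rightarrow> bool" where
  "lsc_fun V nrm f \<longleftrightarrow>
     (\<forall>x\<in>V. \<forall>c < f x. \<exists>\<delta>>0. \<forall>y\<in>V. nrm (y - x) < \<delta> \<longrightarrow> c < f y)"

definition convex_fun :: "'a::real_vector set \<Rightarrow> ('a \<Rightarrow> ereal) \<Rightarrow> bool" where
  "convex_fun V f \<longleftrightarrow>
     (\<forall>x\<in>V. \<forall>y\<in>V. \<forall>t::real. 0 < t \<and> t < 1 \<longrightarrow>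
        f ((1 - t) *\<^sub>R x + t *\<^sub>R y) \<le> ereal (1 - t) * f x + ereal t * f y)"

text \<open>
  Frechet derivative \<open>L\<close> at a point \<open>w\<close> where \<open>f w\<close> is finite. The inequality forces \<open>f\<close> to be
  finite near \<open>w\<close>, i.e. \<open>w\<close> is an interior point of the effective domain.
\<close>

definition has_frechet_deriv ::
  "'a::real_vector set \<Rightarrow> ('a \<Rightarrow> real) \<Rightarrow> ('a \<Rightarrow> ereal) \<Rightarrow> ('a \<Rightarrow> real) \<Rightarrow> 'a \<Rightarrow> bool" where
  "has_frechet_deriv V nrm f L w \<longleftrightarrow> L \<in> dual_space V nrm \<and>
     (\<forall>\<epsilon>>0. \<exists>\<delta>>0. \<forall>z\<in>V. nrm (z - w) < \<delta> \<longrightarrow>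
        \<bar>f z - f w - ereal (L (z - w))\<bar> \<le> ereal (\<epsilon> * nrm (z - w)))"

section \<open>Dissipation and the incremental variational inequality\<close>

definition augmented_dissipation ::
  "(real^'d) set \<Rightarrow> ('d state \<Rightarrow> real) \<Rightarrow> 'd state \<Rightarrow> ereal" where
  "augmented_dissipation \<Omega> \<Phi> = (\<lambda>(u, D, S, P). ereal (\<Phi> (u, D, S, P)) +
     (SUP \<phi>\<in>L2 \<Omega>. ereal (\<integral>x. weak_div \<Omega> D x * \<phi> x \<partial>lebesgue_on \<Omega>)))"

text \<open>\<open>T\<close> is the set of test functions.\<close>

definition incremental_solution ::
  "'a::real_vector set \<Rightarrow> 'a set \<Rightarrow> 'a set \<Rightarrow> ('a \<Rightarrow> 'a \<Rightarrow> real) \<Rightarrow> ('a \<Rightarrow> ereal) \<Rightarrow>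
     (nat \<Rightarrow> 'a \<Rightarrow> real) \<Rightarrow> nat \<Rightarrow> (nat \<Rightarrow> 'a) \<Rightarrow> bool" where
  "incremental_solution T H0 X0 A j l N w \<longleftrightarrow> w 0 = 0 \<and>
     (\<forall>n\<in>{1..N}. w n \<in> X0 \<and> w n - w (n - 1) \<in> H0 \<and>
        (\<forall>z\<in>T. ereal (A (w n) (z - (w n - w (n - 1)))) + j z - j (w n - w (n - 1))
                  \<ge> ereal (l n (z - (w n - w (n - 1))))))"

end

theory Submission
  imports Defs
begin

text \<open>
  On \<open>H\<^sub>0\<close> the dissipation is finite, off \<open>H\<^sub>0\<close> it is \<open>\<infinity>\<close>, so \<open>w\<^sub>n\<close> solves the variational inequality
  iff it minimizes \<open>\<Psi> w + j (w - w\<^sub>n\<^sub>-\<^sub>1) - l\<^sub>n w\<close> over \<open>H\<^sub>0\<close>.  Integrating the strong monotonicity of \<open>A\<close>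
  along segments makes \<open>\<Psi>\<close> strongly convex on \<open>X\<^sub>0\<close>; hence minimizing sequences are Cauchy, and since
  \<open>H\<^sub>0\<close> is complete they converge to a minimizer by lower semicontinuity.  Testing two solutions
  against each other gives uniqueness.  By homogeneity of \<open>j\<close> the inequality says
  \<open>A w\<^sub>n \<Delta>w\<^sub>n + j \<Delta>w\<^sub>n = l\<^sub>n \<Delta>w\<^sub>n\<close> and \<open>A w\<^sub>n z + j z \<ge> l\<^sub>n z\<close>; subtracting the second at step \<open>n - 1\<close>, tested
  with \<open>\<Delta>w\<^sub>n\<close>, from the first at step \<open>n\<close> gives the stability estimate.

  \<open>H\<^sub>0\<close> is complete because \<open>L\<^sup>2\<close> is and weak derivatives and vanishing traces are preserved under \<open>L\<^sup>2\<close>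
  limits of the functions and their weak derivatives.  As \<open>weak_grad\<close> and \<open>weak_div\<close> are chosen by
  \<open>SOME\<close>, even their additivity needs the fundamental lemma of the calculus of variations.
\<close>

section \<open>Functionals on a seminormed space\<close>

text \<open>States are representatives, so \<open>H_norm\<close> may vanish on nonzero states. The
  abstract part therefore works with a seminorm: \<open>dual_null\<close> and
  \<open>lsc_fun_null_perturbation\<close> show that loads and dissipation do not see null
  differences, and uniqueness first means seminorm zero, which
  \<open>state_eq_if_H_norm_diff_eq_0\<close> turns into equality almost everywhere. The inequality
  is tested with all of \<open>H0\<close>, while minimality only compares states of
  \<open>X0\<close>. The two fit together because a Frechet derivative at a point forces \<Psi> to
  be finite near it: small variations along any direction of \<open>H0\<close> stay in
  \<open>X0\<close>. The stability argument subtracts two consecutive steps. The state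
  \<open>w 0 = 0\<close> is prescribed and solves no inequality, so for \<open>n = 1\<close> the
  comparison needs \<open>A 0 z + j z \<ge> 0\<close>, which says that \<open>0\<close> is in
  equilibrium under zero load. Otherwise the first step may move the state although the load stays
  zero, and the estimate fails. This is why the estimate carries that condition as an alternative to
  \<open>n \<ge> 2\<close>.\<close>

locale seminormed_subspace =
  fixes V :: "'a::real_vector set" and nrm :: "'a \<Rightarrow> real"
  assumes subspace_V: "subspace V"
    and nrm_nonneg: "x \<in> V \<Longrightarrow> 0 \<le> nrm x"
    and nrm_triangle: "x \<in> V \<Longrightarrow> y \<in> V \<Longrightarrow> nrm (x + y) \<le> nrm x + nrm y"
    and nrm_scaleR: "x \<in> V \<Longrightarrow> nrm (c *\<^sub>R x) = \<bar>c\<bar> * nrm x"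
begin

lemma nrm_zero: "nrm 0 = 0"
  using nrm_scaleR[of 0 0] subspace_0[OF subspace_V] by simp

lemma nrm_minus_commute:
  assumes "x \<in> V" "y \<in> V" shows "nrm (x - y) = nrm (y - x)"
  using nrm_scaleR[of "x - y" "-1"] subspace_diff[OF subspace_V assms] by simp

lemma dual_add: "f \<in> dual_space V nrm \<Longrightarrow> x \<in> V \<Longrightarrow> y \<in> V \<Longrightarrow> f (x + y) = f x + f y"
  by (simp add: dual_space_def)

lemma dual_scaleR: "f \<in> dual_space V nrm \<Longrightarrow> x \<in> V \<Longrightarrow> f (c *\<^sub>R x) = c * f x"
  by (simp add: dual_space_def)

lemma dual_zero: "f \<in> dual_space V nrm \<Longrightarrow> f 0 = 0"
  using dual_scaleR[of f 0 0] subspace_0[OF subspace_V] by simp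

lemma dual_minus: "f \<in> dual_space V nrm \<Longrightarrow> x \<in> V \<Longrightarrow> f (- x) = - f x"
  using dual_scaleR[of f x "-1"] by simp

lemma dual_diff:
  assumes "f \<in> dual_space V nrm" "x \<in> V" "y \<in> V" shows "f (x - y) = f x - f y"
  using dual_add[of f x "-y"] dual_minus[of f y] assms subspace_neg[OF subspace_V] by simp

lemma dual_bound:
  assumes "f \<in> dual_space V nrm"
  obtains C where "C \<ge> 0" "\<And>x. x \<in> V \<Longrightarrow> \<bar>f x\<bar> \<le> C * nrm x"
proof -
  obtain C where "\<forall>x\<in>V. \<bar>f x\<bar> \<le> C * nrm x"
    using assms by (auto simp: dual_space_def)
  then have C: "\<bar>f x\<bar> \<le> C * nrm x" if "x \<in> V" for x using that by blast
  \<comment> \<open>The constant provided by \<open>dual_space\<close> may be negative if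
    \<open>nrm\<close> vanishes on \<open>V\<close>; the later estimates multiply by it and need its
    sign.\<close>
  have "\<bar>f x\<bar> \<le> max C 0 * nrm x" if "x \<in> V" for x
    using C[OF that] mult_right_mono[of C "max C 0" "nrm x"] nrm_nonneg[OF that] by linarith
  then show thesis using that[of "max C 0"] by simp
qed

lemma dual_null: "f \<in> dual_space V nrm \<Longrightarrow> x \<in> V \<Longrightarrow> nrm x = 0 \<Longrightarrow> f x = 0"
  by (metis dual_bound abs_le_zero_iff mult_zero_right)

lemma dual_space_diff:
  assumes f: "f \<in> dual_space V nrm" and g: "g \<in> dual_space V nrm"
  shows "(\<lambda>z. f z - g z) \<in> dual_space V nrm"
proof -
  obtain C where C: "\<And>x. x \<in> V \<Longrightarrow> \<bar>f x\<bar> \<le> C * nrm x" using dual_bound[OF f] by metis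
  obtain D where D: "\<And>x. x \<in> V \<Longrightarrow> \<bar>g x\<bar> \<le> D * nrm x" using dual_bound[OF g] by metis
  have "\<bar>f x - g x\<bar> \<le> (C + D) * nrm x" if "x \<in> V" for x
    using C[OF that] D[OF that] by (simp add: distrib_right)
  then have "\<exists>C. \<forall>x\<in>V. \<bar>f x - g x\<bar> \<le> C * nrm x" by blast
  then show ?thesis
    using f g by (simp add: dual_space_def algebra_simps)
qed

lemma dual_norm_bound:
  assumes f: "f \<in> dual_space V nrm" and x: "x \<in> V"
  shows "\<bar>f x\<bar> \<le> dual_norm V nrm f * nrm x"
proof (cases "nrm x = 0")
  case True then show ?thesis using dual_null[OF f x] by simp
next
  case False
  then have pos: "nrm x > 0" using nrm_nonneg[OF x] by simp
  obtain C where C: "C \<ge> 0" "\<And>x. x \<in> V \<Longrightarrow> \<bar>f x\<bar> \<le> C * nrm x" using dual_bound[OF f] by metis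
  \<comment> \<open>A real supremum dominates the members of a set only if the set is bounded above,
    so continuity of \<open>f\<close> has to be used before normalizing \<open>x\<close>.\<close>
  have "\<bar>f y\<bar> \<le> C" if "y \<in> V" "nrm y \<le> 1" for y
    using C(2)[OF that(1)] mult_left_mono[OF that(2) C(1)] by simp
  then have bdd: "bdd_above ((\<lambda>x. \<bar>f x\<bar>) ` {x \<in> V. nrm x \<le> 1})" by (intro bdd_aboveI[of _ C]) auto
  define y where "y = (1 / nrm x) *\<^sub>R x"
  have y: "y \<in> V" "nrm y \<le> 1"
    using x subspace_scale[OF subspace_V] nrm_scaleR[OF x] pos by (auto simp: y_def)
  have "\<bar>f y\<bar> \<le> dual_norm V nrm f"
    unfolding dual_norm_def by (rule cSUP_upper[OF _ bdd]) (use y in auto)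
  moreover have "\<bar>f y\<bar> = \<bar>f x\<bar> / nrm x"
    using dual_scaleR[OF f x] pos by (simp add: y_def abs_mult)
  ultimately show ?thesis using pos by (simp add: field_simps)
qed

text \<open>A point at distance zero lies in every neighbourhood, so each \<open>c < f x\<close> is
  also below \<open>f y\<close>, and conversely. This makes the dissipation independent of the
  representative of a state.\<close>

lemma lsc_fun_null_perturbation:
  assumes lsc: "lsc_fun V nrm f" and x: "x \<in> V" "y \<in> V" "nrm (x - y) = 0"
  shows "f x = f y"
proof -
  have le: "f a \<le> f b" if "a \<in> V" "b \<in> V" "nrm (b - a) = 0" for a b
  proof (rule dense_le)
    show "c \<le> f b" if "c < f a" for c
      using lsc \<open>a \<in> V\<close> \<open>b \<in> V\<close> \<open>nrm (b - a) = 0\<close> that unfolding lsc_fun_def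
      by (metis less_imp_le)
  qed
  show ?thesis using le[of x y] le[of y x] x nrm_minus_commute[of x y] by (simp add: antisym)
qed

end

section \<open>The incremental variational inequality\<close>

text \<open>The interface to the state space. Beyond the seminormed linear structure, weak
  derivatives, traces and the supremum in the dissipation survive only as completeness of
  \<open>H0\<close> and the alternative that \<open>j\<close> is finite on \<open>H0\<close> and
  infinite off it.\<close>

locale incremental_problem = seminormed_subspace H nrm
  for H :: "'a::real_vector set" and nrm :: "'a \<Rightarrow> real" +
  fixes H0 X X0 :: "'a set" and \<Psi> j :: "'a \<Rightarrow> ereal" and A :: "'a \<Rightarrow> 'a \<Rightarrow> real" and m :: real
  assumes subspace_H0: "subspace H0" and H0_subset: "H0 \<subseteq> H"
    and complete_H0: "(\<And>n. s n \<in> H0) \<Longrightarrow>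
      (\<And>\<epsilon>. \<epsilon> > 0 \<Longrightarrow> \<exists>M. \<forall>k\<ge>M. \<forall>n\<ge>M. nrm (s k - s n) < \<epsilon>) \<Longrightarrow>
      \<exists>w\<in>H0. (\<lambda>n. nrm (s n - w)) \<longlonglongrightarrow> 0"
    and \<Psi>_not_MInf: "z \<in> H \<Longrightarrow> \<Psi> z \<noteq> -\<infinity>"
    and X_def: "X = {z\<in>H. \<Psi> z < \<infinity>}" and X0_def: "X0 = X \<inter> H0" and zero_X0: "0 \<in> X0"
    and \<Psi>_convex: "convex_fun H \<Psi>" and \<Psi>_lsc: "lsc_fun H nrm \<Psi>"
    and \<Psi>_deriv: "w \<in> X \<Longrightarrow> has_frechet_deriv H nrm \<Psi> (A w) w"
    and j_finite: "z \<in> H0 \<Longrightarrow> j z < \<infinity>" and j_infinite: "z \<in> H - H0 \<Longrightarrow> j z = \<infinity>"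
    and j_nonneg: "z \<in> H \<Longrightarrow> j z \<ge> 0"
    and j_convex: "convex_fun H j"
    and j_hom: "\<alpha> > 0 \<Longrightarrow> z \<in> H \<Longrightarrow> j (\<alpha> *\<^sub>R z) = ereal \<alpha> * j z"
    and j_lsc: "lsc_fun H nrm j"
    and m_pos: "m > 0"
    and strongly_monotone: "w1 \<in> X0 \<Longrightarrow> w2 \<in> X0 \<Longrightarrow>
      A w1 (w1 - w2) - A w2 (w1 - w2) \<ge> m * (nrm (w1 - w2))\<^sup>2"
begin

section \<open>Real-valued energy and dissipation on their domains\<close>

definition psi :: "'a \<Rightarrow> real" where "psi z = real_of_ereal (\<Psi> z)"
definition jr :: "'a \<Rightarrow> real" where "jr z = real_of_ereal (j z)"

lemma X_in_H: "w \<in> X \<Longrightarrow> w \<in> H"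
  by (simp add: X_def)

lemma X0_in_X: "w \<in> X0 \<Longrightarrow> w \<in> X" and X0_in_H0: "w \<in> X0 \<Longrightarrow> w \<in> H0" and X0_in_H: "w \<in> X0 \<Longrightarrow> w \<in> H"
  using X_in_H by (auto simp: X0_def)

lemma H0_in_H: "w \<in> H0 \<Longrightarrow> w \<in> H"
  using H0_subset by auto

lemma \<Psi>_eq: "w \<in> X \<Longrightarrow> \<Psi> w = ereal (psi w)"
  using \<Psi>_not_MInf[of w] by (cases "\<Psi> w") (auto simp: X_def psi_def)

lemma j_eq: "z \<in> H0 \<Longrightarrow> j z = ereal (jr z)"
  using j_finite[of z] j_nonneg[OF H0_in_H, of z] by (cases "j z") (auto simp: jr_def)

lemma jr_nonneg: "z \<in> H0 \<Longrightarrow> jr z \<ge> 0"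
  using j_nonneg[OF H0_in_H, of z] j_eq[of z] by simp

lemma jr_scaleR: "\<alpha> > 0 \<Longrightarrow> z \<in> H0 \<Longrightarrow> jr (\<alpha> *\<^sub>R z) = \<alpha> * jr z"
  using j_hom[of \<alpha> z] j_eq[of z] j_eq[of "\<alpha> *\<^sub>R z"] subspace_scale[OF subspace_H0, of z \<alpha>]
  by (simp add: H0_in_H)

text \<open>Homogeneity holds for positive factors only, so the value at \<open>0\<close> comes from
  \<open>2 *\<^sub>R 0 = 0\<close>: a real number equal to its double is zero.\<close>

lemma jr_zero: "jr 0 = 0"
  using jr_scaleR[of 2 0] subspace_0[OF subspace_H0] by simp

lemma jr_convex:
  assumes "x \<in> H0" "y \<in> H0" "0 < t" "t < 1"
  shows "jr ((1 - t) *\<^sub>R x + t *\<^sub>R y) \<le> (1 - t) * jr x + t * jr y"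
proof -
  have "j ((1 - t) *\<^sub>R x + t *\<^sub>R y) \<le> ereal (1 - t) * j x + ereal t * j y"
    using j_convex[unfolded convex_fun_def, rule_format, of x y t] assms H0_in_H by simp
  moreover have "(1 - t) *\<^sub>R x + t *\<^sub>R y \<in> H0"
    using assms subspace_H0 by (simp add: subspace_add subspace_scale)
  ultimately show ?thesis using assms by (simp add: j_eq)
qed

lemma jr_null_perturbation: "x \<in> H0 \<Longrightarrow> y \<in> H0 \<Longrightarrow> nrm (x - y) = 0 \<Longrightarrow> jr x = jr y"
  using lsc_fun_null_perturbation[OF j_lsc, of x y] by (simp add: jr_def H0_in_H)

text \<open>Keeps the segments along which strong monotonicity is integrated inside the set where
  \<open>A\<close> is the derivative.\<close>

lemma X0_convex:
  assumes "x \<in> X0" "y \<in> X0" "0 \<le> t" "t \<le> 1"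
  shows "x + t *\<^sub>R (y - x) \<in> X0"
proof -
  consider "t = 0" | "t = 1" | "0 < t" "t < 1" using assms by linarith
  then show ?thesis
  proof cases
    case 3
    have eq: "x + t *\<^sub>R (y - x) = (1 - t) *\<^sub>R x + t *\<^sub>R y" by (simp add: algebra_simps)
    have "\<Psi> ((1 - t) *\<^sub>R x + t *\<^sub>R y) \<le> ereal (1 - t) * \<Psi> x + ereal t * \<Psi> y"
      using \<Psi>_convex[unfolded convex_fun_def, rule_format, of x y t] assms 3 X0_in_H by simp
    also have "\<dots> = ereal ((1 - t) * psi x + t * psi y)"
      using assms X0_in_X by (simp add: \<Psi>_eq)
    finally have "\<Psi> (x + t *\<^sub>R (y - x)) < \<infinity>" unfolding eq using le_less_trans by fastforce
    moreover have "x + t *\<^sub>R (y - x) \<in> H0"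
      using assms subspace_H0 X0_in_H0 by (simp add: subspace_add subspace_scale subspace_diff)
    ultimately show ?thesis using H0_in_H by (auto simp: X0_def X_def)
  qed (use assms in auto)
qed

section \<open>Derivative and strong convexity of the energy\<close>

lemma A_dual: "w \<in> X \<Longrightarrow> A w \<in> dual_space H nrm"
  using \<Psi>_deriv by (simp add: has_frechet_deriv_def)

lemma psi_directional_derivative:
  assumes w: "w \<in> X" and v: "v \<in> H"
  shows "((\<lambda>t. psi (w + t *\<^sub>R v)) has_real_derivative A w v) (at 0)"
  unfolding DERIV_def
proof (rule LIM_I)
  fix r :: real assume r: "r > 0"
  \<comment> \<open>The \<open>+ 1\<close> guards against \<open>nrm v = 0\<close> and makes the
    final estimate by \<open>r\<close> strict.\<close>
  define e where "e = r / (nrm v + 1)"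
  have nv: "nrm v \<ge> 0" using nrm_nonneg[OF v] .
  have e: "e > 0" using r nv by (simp add: e_def)
  obtain d where d: "d > 0" and dd: "\<And>z. z \<in> H \<Longrightarrow> nrm (z - w) < d \<Longrightarrow>
      \<bar>\<Psi> z - \<Psi> w - ereal (A w (z - w))\<bar> \<le> ereal (e * nrm (z - w))"
    using \<Psi>_deriv[OF w, unfolded has_frechet_deriv_def, THEN conjunct2, rule_format, OF e] by auto
  show "\<exists>s>0. \<forall>h. h \<noteq> 0 \<and> norm (h - 0) < s \<longrightarrow>
          norm ((psi (w + (0 + h) *\<^sub>R v) - psi (w + 0 *\<^sub>R v)) / h - A w v) < r"
  proof (intro exI[of _ "d / (nrm v + 1)"] conjI allI impI)
    show "d / (nrm v + 1) > 0" using d nv by simp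
    fix h :: real assume h: "h \<noteq> 0 \<and> norm (h - 0) < d / (nrm v + 1)"
    have n: "nrm (w + h *\<^sub>R v - w) = \<bar>h\<bar> * nrm v" using nrm_scaleR[OF v] by simp
    have "\<bar>h\<bar> * nrm v \<le> \<bar>h\<bar> * (nrm v + 1)" by (simp add: algebra_simps)
    also have "\<dots> < d" using h nv by (simp add: field_simps)
    finally have lt: "nrm (w + h *\<^sub>R v - w) < d" using n by simp
    have zH: "w + h *\<^sub>R v \<in> H"
      using X_in_H[OF w] v subspace_V by (simp add: subspace_add subspace_scale)
    have "\<bar>\<Psi> (w + h *\<^sub>R v) - ereal (psi w) - ereal (h * A w v)\<bar> \<le> ereal (e * (\<bar>h\<bar> * nrm v))"
      using dd[OF zH lt] dual_scaleR[OF A_dual[OF w] v] n \<Psi>_eq[OF w] by simp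
    \<comment> \<open>An infinite \<Psi> at the varied point would make the left side infinite; the
      bound excludes it, so passing to \<open>psi\<close> is harmless.\<close>
    then have "\<bar>psi (w + h *\<^sub>R v) - psi w - h * A w v\<bar> \<le> e * (\<bar>h\<bar> * nrm v)"
      by (cases "\<Psi> (w + h *\<^sub>R v)") (auto simp: psi_def)
    then have "\<bar>psi (w + h *\<^sub>R v) - psi w - h * A w v\<bar> / \<bar>h\<bar> \<le> e * nrm v"
      using h by (simp add: field_simps)
    moreover have "e * nrm v < r"
      using r nv by (simp add: e_def field_simps)
    moreover have "(psi (w + h *\<^sub>R v) - psi w) / h - A w v = (psi (w + h *\<^sub>R v) - psi w - h * A w v) / h"
      using h by (simp add: field_simps)
    ultimately show "norm ((psi (w + (0 + h) *\<^sub>R v) - psi (w + 0 *\<^sub>R v)) / h - A w v) < r"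
      by simp
  qed
qed

text \<open>Subtract the tangent and the parabola with coefficient \<open>m / 2\<close> from the
  energy along the segment. The derivative of the remainder \<open>g\<close> at \<open>t\<close> is,
  up to the factor \<open>t\<close>, the slack of strong monotonicity between the points at
  parameters \<open>t\<close> and \<open>0\<close>, whose difference is
  \<open>t *\<^sub>R d\<close>; at \<open>t = 0\<close> it vanishes. Hence \<open>g\<close> is
  nondecreasing, and \<open>g 0 \<le> g 1\<close> is the claim.\<close>

lemma psi_strongly_convex:
  assumes x: "x \<in> X0" and y: "y \<in> X0"
  shows "psi y \<ge> psi x + A x (y - x) + m / 2 * (nrm (y - x))\<^sup>2"
proof -
  define d where "d = y - x"
  define g where "g t = psi (x + t *\<^sub>R d) - t * A x d - m * t\<^sup>2 / 2 * (nrm d)\<^sup>2" for t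
  have dH: "d \<in> H" using x y X0_in_H subspace_V by (simp add: d_def subspace_diff)
  have "\<exists>D. (g has_real_derivative D) (at t) \<and> D \<ge> 0" if t: "0 \<le> t" "t \<le> 1" for t
  proof -
    let ?w = "x + t *\<^sub>R d"
    have w: "?w \<in> X0" using X0_convex[OF x y t] by (simp add: d_def)
    have "((\<lambda>s. psi (?w + s *\<^sub>R d)) has_real_derivative A ?w d) (at 0)"
      by (rule psi_directional_derivative[OF X0_in_X[OF w] dH])
    then have "((\<lambda>s. psi (x + (s + t) *\<^sub>R d)) has_real_derivative A ?w d) (at 0)"
      by (simp add: algebra_simps)
    then have "((\<lambda>s. psi (x + s *\<^sub>R d)) has_real_derivative A ?w d) (at t)"
      using DERIV_at_within_shift[of "\<lambda>s. psi (x + s *\<^sub>R d)" "A ?w d" t 0 UNIV]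
      by (simp add: add.commute)
    then have D: "(g has_real_derivative A ?w d - A x d - m * t * (nrm d)\<^sup>2) (at t)"
      unfolding g_def by (auto intro!: derivative_eq_intros)
    have "A ?w d - A x d - m * t * (nrm d)\<^sup>2 \<ge> 0"
    proof (cases "t = 0")
      case False
      then have tp: "t > 0" using t by simp
      have "m * (nrm (t *\<^sub>R d))\<^sup>2 \<le> A ?w (t *\<^sub>R d) - A x (t *\<^sub>R d)"
        using strongly_monotone[OF w x] by simp
      then have "t * (m * t * (nrm d)\<^sup>2) \<le> t * (A ?w d - A x d)"
        using dual_scaleR[OF A_dual[OF X0_in_X[OF w]] dH] dual_scaleR[OF A_dual[OF X0_in_X[OF x]] dH]
          nrm_scaleR[OF dH] by (simp add: power2_eq_square algebra_simps)
      then show ?thesis using tp by simp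
    qed simp
    then show ?thesis using D by blast
  qed
  then have "g 0 \<le> g 1" by (intro DERIV_nonneg_imp_nondecreasing[of 0 1 g]) auto
  then show ?thesis by (simp add: g_def d_def)
qed

section \<open>Existence of a minimizer by the direct method\<close>

lemma nrm_Cauchy_if_power2_diff_le:
  assumes "K > 0" and s: "\<And>n k. K * (nrm (s n - s k))\<^sup>2 \<le> 1 / real (Suc n) + 1 / real (Suc k)"
    and sH: "\<And>n. s n \<in> H" and "\<epsilon> > 0"
  shows "\<exists>M. \<forall>k\<ge>M. \<forall>n\<ge>M. nrm (s k - s n) < \<epsilon>"
proof -
  have "K * \<epsilon>\<^sup>2 / 2 > 0" using assms by simp
  then obtain M where M: "inverse (real (Suc M)) < K * \<epsilon>\<^sup>2 / 2" using reals_Archimedean by blast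
  have "nrm (s k - s n) < \<epsilon>" if "k \<ge> M" "n \<ge> M" for k n
  proof -
    have "1 / real (Suc k) \<le> inverse (real (Suc M))" "1 / real (Suc n) \<le> inverse (real (Suc M))"
      using that by (simp_all add: field_simps)
    then have "K * (nrm (s k - s n))\<^sup>2 < K * \<epsilon>\<^sup>2" using s[of k n] M by linarith
    then have "(nrm (s k - s n))\<^sup>2 < \<epsilon>\<^sup>2" using \<open>K > 0\<close> by simp
    then show ?thesis using \<open>\<epsilon> > 0\<close> by (simp add: power2_less_imp_less)
  qed
  then show ?thesis by blast
qed

text \<open>By strong convexity every minimizing sequence is a Cauchy sequence, so weak compactness is
  not needed.\<close>

lemma ex_minimizer:
  assumes f: "f \<in> dual_space H nrm" and p: "p \<in> H0"
  shows "\<exists>w\<in>X0. \<forall>z\<in>X0. psi w + jr (w - p) - f w \<le> psi z + jr (z - p) - f z"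
proof -
  define J where "J z = psi z + jr (z - p) - f z" for z
  have diffH0: "x - y \<in> H0" if "x \<in> H0" "y \<in> H0" for x y
    using that subspace_H0 by (simp add: subspace_diff)
  \<comment> \<open>Strong convexity at the midpoint \<open>c\<close> towards both ends: the linear
    terms cancel, and two contributions \<open>m / 2\<close> at half the distance add up to
    \<open>m / 4\<close>. The load is linear and the dissipation convex, so neither spoils the
    gain.\<close>
  have mid: "J x + J y \<ge> 2 * J (x + (1/2) *\<^sub>R (y - x)) + m / 4 * (nrm (x - y))\<^sup>2"
    and midX: "x + (1/2) *\<^sub>R (y - x) \<in> X0" if xy: "x \<in> X0" "y \<in> X0" for x y
  proof -
    define c where "c = x + (1/2) *\<^sub>R (y - x)"
    show c0: "x + (1/2) *\<^sub>R (y - x) \<in> X0" using X0_convex[OF xy, of "1/2"] by simp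
    then have c: "c \<in> X0" by (simp add: c_def)
    define v where "v = (1/2) *\<^sub>R (x - y)"
    have v: "v \<in> H" "x - c = v" "y - c = - v" "nrm v = nrm (x - y) / 2" "nrm (- v) = nrm v"
      using xy X0_in_H subspace_V nrm_scaleR[of v "-1"] nrm_scaleR[of "x - y" "1/2"]
      by (auto simp: v_def c_def subspace_diff subspace_scale algebra_simps simp flip: scaleR_left_distrib)
    have "psi x \<ge> psi c + A c v + m / 2 * (nrm v)\<^sup>2"
      using psi_strongly_convex[OF c xy(1)] v(2) by simp
    moreover have "psi y \<ge> psi c - A c v + m / 2 * (nrm v)\<^sup>2"
      using psi_strongly_convex[OF c xy(2)] v(3,5) dual_minus[OF A_dual[OF X0_in_X[OF c]] v(1)] by simp
    ultimately have 1: "psi x + psi y \<ge> 2 * psi c + m / 4 * (nrm (x - y))\<^sup>2"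
      using v by (simp add: power2_eq_square)
    have "f x = f c + f v" "f y = f c - f v"
      using dual_add[OF f, of c v] dual_diff[OF f, of c v] v c X0_in_H by (auto simp: algebra_simps)
    moreover have "jr (c - p) \<le> (1/2) * jr (x - p) + (1/2) * jr (y - p)"
    proof -
      have "c - p = (1 - 1/2) *\<^sub>R (x - p) + (1/2) *\<^sub>R (y - p)"
        by (simp add: c_def algebra_simps) (simp flip: scaleR_left_distrib)
      then show ?thesis using jr_convex[of "x - p" "y - p" "1/2"] xy X0_in_H0 p diffH0 by simp
    qed
    ultimately show "J x + J y \<ge> 2 * J (x + (1/2) *\<^sub>R (y - x)) + m / 4 * (nrm (x - y))\<^sup>2"
      using 1 by (simp add: J_def c_def)
  qed
  have f0: "(\<lambda>z. f z - A 0 z) \<in> dual_space H nrm"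
    by (rule dual_space_diff[OF f A_dual[OF X0_in_X[OF zero_X0]]])
  then obtain C where C: "\<And>x. x \<in> H \<Longrightarrow> \<bar>f x - A 0 x\<bar> \<le> C * nrm x" using dual_bound[OF f0] by metis
  \<comment> \<open>Coercivity. Strong convexity at \<open>0\<close> contributes
    \<open>m / 2\<close> times the squared seminorm, the dissipation is nonnegative, and the
    remaining linear part \<open>f - A 0\<close> is absorbed by Young's inequality at the price
    \<open>C\<^sup>2 / (2 * m)\<close>.\<close>
  have lower: "J z \<ge> psi 0 - C\<^sup>2 / (2 * m)" if z: "z \<in> X0" for z
  proof -
    have "psi z \<ge> psi 0 + A 0 z + m / 2 * (nrm z)\<^sup>2"
      using psi_strongly_convex[OF zero_X0 z] by simp
    moreover have "jr (z - p) \<ge> 0" using jr_nonneg[OF diffH0] X0_in_H0[OF z] p by simp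
    moreover have "f z \<le> A 0 z + C * nrm z" using C[OF X0_in_H[OF z]] by linarith
    moreover have "C * nrm z \<le> m / 2 * (nrm z)\<^sup>2 + C\<^sup>2 / (2 * m)"
    proof -
      have "0 \<le> (m * nrm z - C)\<^sup>2 / (2 * m)" using m_pos by simp
      also have "\<dots> = m / 2 * (nrm z)\<^sup>2 + C\<^sup>2 / (2 * m) - C * nrm z"
        using m_pos by (simp add: power2_eq_square field_simps)
      finally show ?thesis by simp
    qed
    ultimately show ?thesis by (simp add: J_def)
  qed
  define I where "I = Inf (J ` X0)"
  have bdd: "bdd_below (J ` X0)"
    using lower by (intro bdd_belowI[of _ "psi 0 - C\<^sup>2 / (2 * m)"]) auto
  have I_le: "I \<le> J z" if "z \<in> X0" for z unfolding I_def using cINF_lower[OF bdd that] .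
  have "\<exists>z\<in>X0. J z < I + 1 / real (Suc n)" for n
  proof -
    have "Inf (J ` X0) < I + 1 / real (Suc n)" by (simp add: I_def)
    then show ?thesis using cInf_less_iff[of "J ` X0"] bdd zero_X0 by blast
  qed
  then obtain s where sX: "\<And>n. s n \<in> X0" and sJ: "\<And>n. J (s n) < I + 1 / real (Suc n)" by metis
  \<comment> \<open>Both energies lie within their tolerance of \<open>I\<close>, and the midpoint
    is again in \<open>X0\<close>, where \<open>J\<close> is at least \<open>I\<close>;
    \<open>mid\<close> leaves only the two tolerances.\<close>
  have "m / 4 * (nrm (s n - s k))\<^sup>2 \<le> 1 / real (Suc n) + 1 / real (Suc k)" for n k
    using mid[OF sX sX, of n k] I_le[OF midX[OF sX sX], of n k] sJ[of n] sJ[of k] by linarith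
  from nrm_Cauchy_if_power2_diff_le[of "m/4" s, OF _ this] complete_H0[of s]
  obtain w where w: "w \<in> H0" and lim: "(\<lambda>n. nrm (s n - w)) \<longlonglongrightarrow> 0"
    using m_pos sX X0_in_H X0_in_H0 by (metis divide_pos_pos zero_less_numeral)
  have flim: "(\<lambda>n. f (s n)) \<longlonglongrightarrow> f w"
  proof -
    obtain K where K: "\<And>x. x \<in> H \<Longrightarrow> \<bar>f x\<bar> \<le> K * nrm x" using dual_bound[OF f] by metis
    have "\<forall>n. norm (f (s n) - f w) \<le> K * nrm (s n - w)"
      using K[of "s _ - w"] dual_diff[OF f, of "s _" w] X0_in_H[OF sX] H0_in_H[OF w] subspace_V
      by (simp add: subspace_diff)
    from Lim_null_comparison[OF always_eventually[OF this] tendsto_mult_right_zero[OF lim]]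
    have "(\<lambda>n. f (s n) - f w) \<longlonglongrightarrow> 0" .
    then show ?thesis by (simp add: LIM_zero_iff)
  qed
  \<comment> \<open>Semicontinuity is passed to the limit through real bounds \<open>c1\<close> and
    \<open>c2\<close>, because at this stage \<Psi> may still be infinite at
    \<open>w\<close>.\<close>
  have lsc_lim: "c1 + c2 - f w \<le> I" if c1: "ereal c1 < \<Psi> w" and c2: "ereal c2 < j (w - p)" for c1 c2
  proof (rule LIMSEQ_le)
    show "(\<lambda>n. c1 + c2 - f (s n)) \<longlonglongrightarrow> c1 + c2 - f w" using flim by (intro tendsto_intros)
    have "(\<lambda>n. I + inverse (real (Suc n))) \<longlonglongrightarrow> I + 0"
      by (intro tendsto_intros LIMSEQ_inverse_real_of_nat)
    then show "(\<lambda>n. I + 1 / real (Suc n)) \<longlonglongrightarrow> I" by (simp add: inverse_eq_divide)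
    obtain d1 where d1: "d1 > 0" "\<And>y. y \<in> H \<Longrightarrow> nrm (y - w) < d1 \<Longrightarrow> ereal c1 < \<Psi> y"
      using \<Psi>_lsc[unfolded lsc_fun_def, rule_format, OF H0_in_H[OF w] c1] by blast
    have wp: "w - p \<in> H" using H0_in_H[OF diffH0[OF w p]] .
    obtain d2 where d2: "d2 > 0" "\<And>y. y \<in> H \<Longrightarrow> nrm (y - (w - p)) < d2 \<Longrightarrow> ereal c2 < j y"
      using j_lsc[unfolded lsc_fun_def, rule_format, OF wp c2] by blast
    obtain M where M: "\<And>n. n \<ge> M \<Longrightarrow> \<bar>nrm (s n - w)\<bar> < min d1 d2"
      using LIMSEQ_D[OF lim, of "min d1 d2"] d1(1) d2(1) by auto
    have "c1 + c2 - f (s n) \<le> I + 1 / real (Suc n)" if "n \<ge> M" for n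
    proof -
      have M1: "nrm (s n - w) < d1" and M2: "nrm (s n - p - (w - p)) < d2"
        using M[OF that] by (simp_all add: abs_less_iff)
      have "c1 < psi (s n)"
        using d1(2)[OF X0_in_H[OF sX[of n]] M1] \<Psi>_eq[OF X0_in_X[OF sX[of n]]] by simp
      moreover have "c2 < jr (s n - p)"
        using d2(2)[OF H0_in_H[OF diffH0[OF X0_in_H0[OF sX[of n]] p]] M2]
          j_eq[OF diffH0[OF X0_in_H0[OF sX[of n]] p]] by simp
      ultimately show ?thesis using sJ[of n] by (simp add: J_def)
    qed
    then show "\<exists>N. \<forall>n\<ge>N. c1 + c2 - f (s n) \<le> I + 1 / real (Suc n)" by blast
  qed
  have wX: "w \<in> X0"
  proof (rule ccontr)
    assume "w \<notin> X0"
    then have "\<Psi> w = \<infinity>" using w H0_in_H by (auto simp: X0_def X_def)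
    \<comment> \<open>If \<Psi> is infinite at \<open>w\<close>, every real \<open>c1\<close> is
      admissible, and \<open>c2 = -1\<close> lies below the nonnegative dissipation. The choice
      \<open>c1 = I + f w + 2\<close> yields \<open>I + 1 \<le> I\<close>.\<close>
    then have "I + f w + 2 + (-1) - f w \<le> I"
      using j_eq[OF diffH0[OF w p]] jr_nonneg[OF diffH0[OF w p]]
      by (intro lsc_lim) auto
    then show False by simp
  qed
  have "J w \<le> I + e" if "e > 0" for e
    using lsc_lim[of "psi w - e / 2" "jr (w - p) - e / 2"] that
      \<Psi>_eq[OF X0_in_X[OF wX]] j_eq[OF diffH0[OF w p]]
    by (simp add: J_def)
  then have "J w \<le> I" by (rule field_le_epsilon)
  then show ?thesis using wX I_le unfolding J_def by (meson order_trans)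
qed

section \<open>One time step with previous state \<open>p\<close> and load \<open>f\<close>:
  existence, estimates, uniqueness\<close>

definition vi :: "('a \<Rightarrow> real) \<Rightarrow> 'a \<Rightarrow> 'a \<Rightarrow> bool" where
  "vi f p w \<longleftrightarrow> w \<in> X0 \<and> w - p \<in> H0 \<and>
     (\<forall>z\<in>H0. A w (z - (w - p)) + jr z - jr (w - p) \<ge> f (z - (w - p)))"

text \<open>First-order optimality of the minimizer. Moving from \<open>w\<close> along
  \<open>d = z - (w - p)\<close> turns the increment into the convex combination of
  \<open>w - p\<close> and \<open>z\<close> with weight \<open>t\<close>, so convexity bounds the
  change of dissipation by \<open>t * (jr z - jr (w - p))\<close>. Minimality, divided by
  \<open>t\<close>, gives the inequality as \<open>t\<close> tends to \<open>0\<close>. The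
  dissipation itself is never differentiated.\<close>

lemma ex_vi:
  assumes f: "f \<in> dual_space H nrm" and p: "p \<in> H0"
  shows "\<exists>w. vi f p w"
proof -
  obtain w where w: "w \<in> X0"
    and min: "\<And>z. z \<in> X0 \<Longrightarrow> psi w + jr (w - p) - f w \<le> psi z + jr (z - p) - f z"
    using ex_minimizer[OF f p] by blast
  have wp: "w - p \<in> H0" using X0_in_H0[OF w] p subspace_H0 by (simp add: subspace_diff)
  have "A w (z - (w - p)) + jr z - jr (w - p) \<ge> f (z - (w - p))" if z: "z \<in> H0" for z
  proof -
    define d where "d = z - (w - p)"
    have dH0: "d \<in> H0" using z wp subspace_H0 by (simp add: d_def subspace_diff)
    have dH: "d \<in> H" using H0_in_H[OF dH0] .
    have der: "((\<lambda>t. psi (w + t *\<^sub>R d)) has_real_derivative A w d) (at 0)"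
      by (rule psi_directional_derivative[OF X0_in_X[OF w] dH])
    have "((\<lambda>t. (psi (w + t *\<^sub>R d) - psi w) / t) \<longlongrightarrow> A w d) (at 0)"
      using der unfolding DERIV_def by simp
    \<comment> \<open>The convexity bound holds only for \<open>t\<close> between \<open>0\<close>
      and \<open>1\<close>, so the limit is taken from the right.\<close>
    then have lim: "((\<lambda>t. (psi (w + t *\<^sub>R d) - psi w) / t) \<longlongrightarrow> A w d) (at_right 0)"
      by (rule filterlim_mono) (auto simp: at_within_le_at)
    \<comment> \<open>Tolerance \<open>1\<close> in the derivative suffices here, since only
      finiteness of \<Psi> is extracted from it.\<close>
    have ev1: "eventually (\<lambda>t. w + t *\<^sub>R d \<in> X0) (at_right 0)"
    proof -
      obtain \<delta> where \<delta>: "\<delta> > 0" "\<And>y. y \<in> H \<Longrightarrow> nrm (y - w) < \<delta> \<Longrightarrow>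
          \<bar>\<Psi> y - \<Psi> w - ereal (A w (y - w))\<bar> \<le> ereal (1 * nrm (y - w))"
        using \<Psi>_deriv[OF X0_in_X[OF w], unfolded has_frechet_deriv_def, THEN conjunct2, rule_format, of 1]
        by auto
      have nd: "nrm d \<ge> 0" using nrm_nonneg[OF dH] .
      have "w + t *\<^sub>R d \<in> X0" if t: "t > 0" "t < \<delta> / (nrm d + 1)" for t
      proof -
        have y: "w + t *\<^sub>R d \<in> H0"
          using X0_in_H0[OF w] dH0 subspace_H0 by (simp add: subspace_add subspace_scale)
        have "t * nrm d \<le> t * (nrm d + 1)" using t by simp
        also have "\<dots> < \<delta>" using t nd by (simp add: field_simps)
        finally have "nrm (w + t *\<^sub>R d - w) < \<delta>" using nrm_scaleR[OF dH] t by simp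
        from \<delta>(2)[OF H0_in_H[OF y] this] have "\<Psi> (w + t *\<^sub>R d) < \<infinity>"
          using \<Psi>_eq[OF X0_in_X[OF w]] by (cases "\<Psi> (w + t *\<^sub>R d)") auto
        then show ?thesis using y H0_in_H by (auto simp: X0_def X_def)
      qed
      then show ?thesis unfolding eventually_at_right_field
        using \<delta>(1) nd by (intro exI[of _ "\<delta> / (nrm d + 1)"]) auto
    qed
    have ev2: "eventually (\<lambda>t::real. 0 < t \<and> t < 1) (at_right 0)"
      unfolding eventually_at_right_field by (intro exI[of _ 1]) auto
    have "eventually (\<lambda>t. f d + jr (w - p) - jr z \<le> (psi (w + t *\<^sub>R d) - psi w) / t) (at_right 0)"
      using ev1 ev2
    proof eventually_elim
      case (elim t)
      have "jr (w + t *\<^sub>R d - p) \<le> (1 - t) * jr (w - p) + t * jr z"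
      proof -
        have "w + t *\<^sub>R d - p = (1 - t) *\<^sub>R (w - p) + t *\<^sub>R z" by (simp add: d_def algebra_simps)
        then show ?thesis using jr_convex[OF wp z] elim by simp
      qed
      moreover have "f (w + t *\<^sub>R d) = f w + t * f d"
        using dual_add[OF f X0_in_H[OF w], of "t *\<^sub>R d"] dual_scaleR[OF f dH] dH subspace_V
        by (simp add: subspace_scale)
      ultimately have "t * (f d + jr (w - p) - jr z) \<le> psi (w + t *\<^sub>R d) - psi w"
        using min[of "w + t *\<^sub>R d"] elim by (simp add: algebra_simps)
      then show ?case using elim by (simp add: field_simps)
    qed
    then have "f d + jr (w - p) - jr z \<le> A w d"
      by (intro tendsto_lowerbound[OF lim]) auto
    then show ?thesis by (simp add: d_def)
  qed
  then show ?thesis using w wp unfolding vi_def by blast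
qed

text \<open>Testing with \<open>0\<close> and with twice the increment gives opposite inequalities,
  because the dissipation doubles with its argument. The resulting equality is then removed from the
  inequality for general \<open>z\<close>.\<close>

lemma vi_homogeneous:
  assumes f: "f \<in> dual_space H nrm" and vi: "vi f p w"
  shows "A w (w - p) + jr (w - p) = f (w - p)"
    and "z \<in> H0 \<Longrightarrow> A w z + jr z \<ge> f z"
proof -
  let ?d = "w - p"
  have w: "w \<in> X0" and d: "?d \<in> H0" and dH: "?d \<in> H" and A: "A w \<in> dual_space H nrm"
    using vi A_dual X0_in_X H0_in_H by (auto simp: vi_def)
  have v: "A w (z - ?d) + jr z - jr ?d \<ge> f (z - ?d)" if "z \<in> H0" for z
    using vi that by (simp add: vi_def)
  have v': "A w z - A w ?d + jr z - jr ?d \<ge> f z - f ?d" if "z \<in> H0" for z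
    using v[OF that] dual_diff[OF A H0_in_H[OF that] dH] dual_diff[OF f H0_in_H[OF that] dH] by simp
  have "A w 0 = 0" "f 0 = 0" using dual_zero A f by auto
  then have "A w ?d + jr ?d \<le> f ?d"
    using v'[of 0] subspace_0[OF subspace_H0] jr_zero by simp
  moreover have "A w ?d + jr ?d \<ge> f ?d"
    using v'[of "2 *\<^sub>R ?d"] subspace_scale[OF subspace_H0 d, of 2] jr_scaleR[of 2, OF _ d]
      dual_scaleR[OF A dH, of 2] dual_scaleR[OF f dH, of 2] by linarith
  ultimately show eq: "A w ?d + jr ?d = f ?d" by simp
  show "A w z + jr z \<ge> f z" if "z \<in> H0"
    using v'[OF that] eq by linarith
qed

text \<open>The predecessor enters through the inequality \<open>prev\<close> rather than through
  \<open>vi\<close>, so that the prescribed initial state is covered too.\<close>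

lemma vi_stability:
  assumes f: "f \<in> dual_space H nrm" and g: "g \<in> dual_space H nrm"
    and vi: "vi f p w" and p: "p \<in> X0" and prev: "\<And>z. z \<in> H0 \<Longrightarrow> A p z + jr z \<ge> g z"
  shows "nrm (w - p) \<le> 1 / m * dual_norm H nrm (\<lambda>z. f z - g z)"
proof -
  let ?d = "w - p"
  have w: "w \<in> X0" and d: "?d \<in> H0" and dH: "?d \<in> H" using vi H0_in_H by (auto simp: vi_def)
  have "m * (nrm ?d)\<^sup>2 \<le> A w ?d - A p ?d" using strongly_monotone[OF w p] .
  also have "\<dots> \<le> f ?d - g ?d" using vi_homogeneous(1)[OF f vi] prev[OF d] by linarith
  also have "\<dots> \<le> dual_norm H nrm (\<lambda>z. f z - g z) * nrm ?d"
    using dual_norm_bound[OF dual_space_diff[OF f g] dH] by linarith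
  finally have le: "nrm ?d * (m * nrm ?d) \<le> nrm ?d * dual_norm H nrm (\<lambda>z. f z - g z)"
    by (simp add: power2_eq_square algebra_simps)
  \<comment> \<open>The estimate arises by cancelling one factor \<open>nrm ?d\<close>. If that
    factor is zero, the claim reduces to nonnegativity of the dual norm.\<close>
  have "dual_norm H nrm (\<lambda>z. f z - g z) \<ge> 0"
  proof -
    obtain C where C: "C \<ge> 0" "\<And>x. x \<in> H \<Longrightarrow> \<bar>f x - g x\<bar> \<le> C * nrm x"
      using dual_bound[OF dual_space_diff[OF f g]] by metis
    have "\<bar>f y - g y\<bar> \<le> C" if "y \<in> H" "nrm y \<le> 1" for y
      using C(2)[OF that(1)] mult_left_mono[OF that(2) C(1)] by simp
    then have bdd: "bdd_above ((\<lambda>x. \<bar>f x - g x\<bar>) ` {x \<in> H. nrm x \<le> 1})"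
      by (intro bdd_aboveI[of _ C]) auto
    have "\<bar>f 0 - g 0\<bar> \<le> dual_norm H nrm (\<lambda>z. f z - g z)"
      unfolding dual_norm_def
      by (rule cSUP_upper[OF _ bdd]) (use nrm_zero subspace_0[OF subspace_V] in auto)
    then show ?thesis by linarith
  qed
  then show ?thesis
    using le nrm_nonneg[OF dH] m_pos by (cases "nrm ?d = 0") (auto simp: field_simps)
qed

text \<open>The predecessors may differ by a null element, because induction over the steps provides
  no more. Each inequality is tested with the other state minus its own predecessor. Replacing
  \<open>p\<close> by \<open>p'\<close> does not change the dissipations, so they cancel in the sum,
  and strong monotonicity remains.\<close>

lemma vi_unique:
  assumes f: "f \<in> dual_space H nrm"
    and vi: "vi f p w" and vi': "vi f p' w'" and p: "nrm (p - p') = 0" "p \<in> H0" "p' \<in> H0"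
  shows "nrm (w - w') = 0"
proof -
  have w: "w \<in> X0" and w': "w' \<in> X0" using vi vi' by (auto simp: vi_def)
  have H0: "w' - p \<in> H0" "w - p' \<in> H0" "w - p \<in> H0" "w' - p' \<in> H0" "w - w' \<in> H0" "w' - w \<in> H0"
    using X0_in_H0[OF w] X0_in_H0[OF w'] p subspace_H0 by (auto simp: subspace_diff)
  have nn: "nrm (p' - p) = 0" using p nrm_minus_commute H0_in_H by metis
  have "A w (w' - p - (w - p)) + jr (w' - p) - jr (w - p) \<ge> f (w' - p - (w - p))"
    using vi H0(1) unfolding vi_def by blast
  then have 1: "A w (w' - w) + jr (w' - p) - jr (w - p) \<ge> f (w' - w)" by (simp add: algebra_simps)
  have "A w' (w - p' - (w' - p')) + jr (w - p') - jr (w' - p') \<ge> f (w - p' - (w' - p'))"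
    using vi' H0(2) unfolding vi_def by blast
  then have 2: "A w' (w - w') + jr (w - p') - jr (w' - p') \<ge> f (w - w')" by (simp add: algebra_simps)
  have "jr (w' - p) = jr (w' - p')" "jr (w - p') = jr (w - p)"
    using jr_null_perturbation[of "w' - p" "w' - p'"] jr_null_perturbation[of "w - p'" "w - p"] H0 p nn
    by (auto simp: algebra_simps)
  moreover have "A w (w' - w) = - A w (w - w')" "f (w' - w) = - f (w - w')"
    using dual_minus[OF A_dual[OF X0_in_X[OF w]], of "w - w'"] dual_minus[OF f, of "w - w'"]
      H0 H0_in_H by auto
  ultimately have "A w (w - w') - A w' (w - w') \<le> 0" using 1 2 by linarith
  then have "m * (nrm (w - w'))\<^sup>2 \<le> 0" using strongly_monotone[OF w w'] by linarith
  then show ?thesis using m_pos by (simp add: mult_le_0_iff)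
qed

text \<open>For a test function outside \<open>H0\<close> the left side is infinite, since the
  dissipation of the increment is finite, so testing there is vacuous. This gives at once the
  real-valued form of the problem and the equivalence of the two sets of test functions.\<close>

lemma incremental_solution_iff_vi:
  assumes T: "T = H \<or> T = H0"
  shows "incremental_solution T H0 X0 A j l N w \<longleftrightarrow>
    w 0 = 0 \<and> (\<forall>n\<in>{1..N}. vi (l n) (w (n - 1)) (w n))"
proof -
  have "(\<forall>z\<in>T. ereal (A v (z - d)) + j z - j d \<ge> ereal (f (z - d))) \<longleftrightarrow>
      (\<forall>z\<in>H0. A v (z - d) + jr z - jr d \<ge> f (z - d))" if d: "d \<in> H0" for v d f
  proof -
    have "ereal (A v (z - d)) + j z - j d \<ge> ereal (f (z - d)) \<longleftrightarrow>
        A v (z - d) + jr z - jr d \<ge> f (z - d)" if "z \<in> H0" for z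
      using j_eq[OF that] j_eq[OF d] by simp
    moreover have "ereal (A v (z - d)) + j z - j d \<ge> ereal (f (z - d))" if "z \<in> H - H0" for z
      using j_infinite[OF that] j_eq[OF d] by simp
    ultimately show ?thesis using T H0_in_H by (metis DiffI)
  qed
  then show ?thesis unfolding incremental_solution_def vi_def by blast
qed

lemma ex_incremental_solution:
  assumes l: "\<And>n. n \<le> N \<Longrightarrow> l n \<in> dual_space H nrm"
  shows "\<exists>w. incremental_solution H H0 X0 A j l N w"
proof -
  have "\<exists>w. \<forall>n. w n \<in> X0 \<and> (n = 0 \<longrightarrow> w n = 0) \<and> (n \<le> N \<longrightarrow> n \<ge> 1 \<longrightarrow> vi (l n) (w (n - 1)) (w n))"
  proof -
    \<comment> \<open>Steps are indexed from \<open>n\<close> to \<open>Suc n\<close> as dependent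
      choice requires. Loads are constrained only up to \<open>N\<close>; past it the sequence
      continues with any member of \<open>X0\<close>.\<close>
    have "\<exists>w. \<forall>n. (w n \<in> X0 \<and> (n = 0 \<longrightarrow> w n = 0)) \<and> (Suc n \<le> N \<longrightarrow> vi (l (Suc n)) (w n) (w (Suc n)))"
    proof (rule dependent_nat_choice)
      show "\<exists>x. x \<in> X0 \<and> ((0::nat) = 0 \<longrightarrow> x = 0)" using zero_X0 by blast
      fix x and n :: nat assume x: "x \<in> X0 \<and> (n = 0 \<longrightarrow> x = 0)"
      show "\<exists>y. (y \<in> X0 \<and> (Suc n = 0 \<longrightarrow> y = 0)) \<and> (Suc n \<le> N \<longrightarrow> vi (l (Suc n)) x y)"
      proof (cases "Suc n \<le> N")
        case True
        then obtain y where "vi (l (Suc n)) x y" using ex_vi[OF l] x X0_in_H0 by blast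
        then show ?thesis unfolding vi_def by blast
      next
        case False then show ?thesis using x by auto
      qed
    qed
    then show ?thesis
      by (metis One_nat_def Suc_le_D diff_Suc_1)
  qed
  then show ?thesis by (subst incremental_solution_iff_vi) auto
qed

lemma incremental_solution_mem_X0:
  assumes "incremental_solution H H0 X0 A j l N w" "n \<le> N"
  shows "w n \<in> X0"
  using assms zero_X0 by (cases n) (auto simp: incremental_solution_def)

lemma incremental_solution_unique:
  assumes l: "\<And>n. n \<le> N \<Longrightarrow> l n \<in> dual_space H nrm"
    and w: "incremental_solution H H0 X0 A j l N w" and w': "incremental_solution H H0 X0 A j l N w'"
  shows "n \<le> N \<Longrightarrow> nrm (w n - w' n) = 0"
proof (induction n)
  case 0
  then show ?case using w w' nrm_zero by (simp add: incremental_solution_def)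
next
  case (Suc n)
  have "vi (l (Suc n)) (w n) (w (Suc n))" "vi (l (Suc n)) (w' n) (w' (Suc n))"
    using w w' Suc.prems by (auto simp: incremental_solution_iff_vi dest!: bspec[of _ _ "Suc n"])
  then show ?case
    using vi_unique[OF l[OF Suc.prems]] Suc X0_in_H0 incremental_solution_mem_X0 w w' by simp
qed

text \<open>For \<open>n \<ge> 2\<close> the comparison inequality at the predecessor comes from
  \<open>vi_homogeneous\<close>. For \<open>n = 1\<close> the predecessor is \<open>0\<close> with
  load \<open>l 0 = 0\<close>, and \<open>init\<close> supplies it.\<close>

lemma incremental_solution_stability:
  assumes l: "\<And>n. n \<le> N \<Longrightarrow> l n \<in> dual_space H nrm" and l0: "\<And>z. z \<in> H \<Longrightarrow> l 0 z = 0"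
    and w: "incremental_solution H H0 X0 A j l N w" and n: "1 \<le> n" "n \<le> N"
    and init: "n \<ge> 2 \<or> (\<forall>z\<in>H. ereal (A 0 z) + j z \<ge> 0)"
  shows "nrm (w n - w (n - 1)) \<le> 1 / m * dual_norm H nrm (\<lambda>z. l n z - l (n - 1) z)"
proof (rule vi_stability)
  have vi: "vi (l k) (w (k - 1)) (w k)" if "1 \<le> k" "k \<le> N" for k
    using w that by (simp add: incremental_solution_iff_vi)
  show "l n \<in> dual_space H nrm" "l (n - 1) \<in> dual_space H nrm" using l n by auto
  show "vi (l n) (w (n - 1)) (w n)" using vi n by simp
  show "w (n - 1) \<in> X0" using incremental_solution_mem_X0[OF w] n by simp
  fix z assume z: "z \<in> H0"
  show "A (w (n - 1)) z + jr z \<ge> l (n - 1) z"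
  proof (cases "n \<ge> 2")
    case True
    then show ?thesis using vi_homogeneous(2)[OF l vi z, of "n - 1"] n by simp
  next
    case False
    then have "n = 1" using n by simp
    moreover have "w 0 = 0" using w by (simp add: incremental_solution_def)
    ultimately show ?thesis using init z l0[OF H0_in_H[OF z]] j_eq[OF z] H0_in_H[OF z] by auto
  qed
qed

end

section \<open>Test functions\<close>

text \<open>Introduction and elimination forms of the recursion step; its equation is taken from the
  simplifier below so that orders are unfolded only on purpose.\<close>

lemma Ck_SucI:
  assumes "\<And>x. (f has_derivative (\<lambda>h. g x \<bullet> h)) (at x)" "\<And>i. Ck k (\<lambda>x. g x $ i)"
  shows "Ck (Suc k) f"
  using assms by auto

lemma Ck_SucD:
  "Ck (Suc k) f \<Longrightarrow> \<exists>g. (\<forall>x. (f has_derivative (\<lambda>h. g x \<bullet> h)) (at x)) \<and> (\<forall>i. Ck k (\<lambda>x. g x $ i))"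
  by simp

declare Ck.simps(2) [simp del]

lemma Ck_Suc_imp: "Ck (Suc k) f \<Longrightarrow> Ck k f"
proof (induction k arbitrary: f)
  case 0
  from Ck_SucD[OF 0] obtain g where "\<forall>x. (f has_derivative (\<lambda>h. g x \<bullet> h)) (at x)"
    by (elim exE conjE) (rule that)
  then show ?case by (auto intro: continuous_at_imp_continuous_on has_derivative_continuous)
next
  case (Suc k)
  from Ck_SucD[OF Suc.prems] obtain g where g_Ck: "\<forall>x. (f has_derivative (\<lambda>h. g x \<bullet> h)) (at x)" "\<forall>i. Ck (Suc k) (\<lambda>x. g x $ i)"
    by (elim exE conjE) (rule that)
  note g = g_Ck[rule_format]
  show ?case by (rule Ck_SucI[where g = g, OF g(1) Suc.IH[OF g(2)]])
qed

lemma Ck_const: "Ck k (\<lambda>x. c)"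
proof (induction k arbitrary: c)
  case (Suc k)
  show ?case by (rule Ck_SucI[where g = "\<lambda>x. 0"]) (use Suc in auto)
qed simp

lemma Ck_add: "Ck k f \<Longrightarrow> Ck k g \<Longrightarrow> Ck k (\<lambda>x. f x + g x)"
proof (induction k arbitrary: f g)
  case 0 then show ?case by (auto intro: continuous_on_add)
next
  case (Suc k)
  from Ck_SucD[OF Suc.prems(1)] obtain f' where f'_Ck: "\<forall>x. (f has_derivative (\<lambda>h. f' x \<bullet> h)) (at x)" "\<forall>i. Ck k (\<lambda>x. f' x $ i)"
    by (elim exE conjE) (rule that)
  note f' = f'_Ck[rule_format]
  from Ck_SucD[OF Suc.prems(2)] obtain g' where g'_Ck: "\<forall>x. (g has_derivative (\<lambda>h. g' x \<bullet> h)) (at x)" "\<forall>i. Ck k (\<lambda>x. g' x $ i)"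
    by (elim exE conjE) (rule that)
  note g' = g'_Ck[rule_format]
  show ?case
  proof (rule Ck_SucI[where g = "\<lambda>x. f' x + g' x"])
    show "((\<lambda>x. f x + g x) has_derivative (\<lambda>h. (f' x + g' x) \<bullet> h)) (at x)" for x
      using has_derivative_add[OF f'(1) g'(1)] by (simp add: inner_add_left)
    show "Ck k (\<lambda>x. (f' x + g' x) $ i)" for i using Suc.IH[OF f'(2) g'(2)] by simp
  qed
qed

lemma Ck_mult: "Ck k f \<Longrightarrow> Ck k g \<Longrightarrow> Ck k (\<lambda>x. f x * g x)"
proof (induction k arbitrary: f g)
  case 0 then show ?case by (auto intro: continuous_on_mult)
next
  case (Suc k)
  from Ck_SucD[OF Suc.prems(1)] obtain f' where f'_Ck: "\<forall>x. (f has_derivative (\<lambda>h. f' x \<bullet> h)) (at x)" "\<forall>i. Ck k (\<lambda>x. f' x $ i)"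
    by (elim exE conjE) (rule that)
  note f' = f'_Ck[rule_format]
  from Ck_SucD[OF Suc.prems(2)] obtain g' where g'_Ck: "\<forall>x. (g has_derivative (\<lambda>h. g' x \<bullet> h)) (at x)" "\<forall>i. Ck k (\<lambda>x. g' x $ i)"
    by (elim exE conjE) (rule that)
  note g' = g'_Ck[rule_format]
  show ?case
  proof (rule Ck_SucI[where g = "\<lambda>x. f x *\<^sub>R g' x + g x *\<^sub>R f' x"])
    fix x
    show "((\<lambda>x. f x * g x) has_derivative (\<lambda>h. (f x *\<^sub>R g' x + g x *\<^sub>R f' x) \<bullet> h)) (at x)"
      using has_derivative_mult[OF f'(1)[of x] g'(1)[of x]] by (simp add: inner_add_left mult.commute)
    \<comment> \<open>In the product rule an undifferentiated factor of order \<open>Suc k\<close>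
      meets a gradient of order \<open>k\<close>; lowering the former makes the induction hypothesis
      applicable.\<close>
    show "Ck k (\<lambda>x. (f x *\<^sub>R g' x + g x *\<^sub>R f' x) $ i)" for i
      using Suc.IH[OF Ck_Suc_imp[OF Suc.prems(1)] g'(2)] Suc.IH[OF Ck_Suc_imp[OF Suc.prems(2)] f'(2)]
      by (simp add: Ck_add)
  qed
qed

lemma Ck_cmult: "Ck k f \<Longrightarrow> Ck k (\<lambda>x. c * f x)"
  by (intro Ck_mult Ck_const)

lemma Ck_prod: "finite I \<Longrightarrow> (\<And>i. i \<in> I \<Longrightarrow> Ck k (f i)) \<Longrightarrow> Ck k (\<lambda>x. \<Prod>i\<in>I. f i x)"
  by (induction rule: finite_induct) (auto intro: Ck_mult Ck_const)

text \<open>The family is closed under differentiation up to linear combinations, see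
  \<open>has_real_derivative_bump_ker\<close>.\<close>

definition bump_ker :: "nat \<Rightarrow> real \<Rightarrow> real \<Rightarrow> real" where
  "bump_ker n c t = (if t > 0 then inverse t ^ n * exp (- c / t) else 0)"

section \<open>Smooth bump functions on boxes\<close>

lemma bump_ker_bounded:
  assumes "c > 0"
  shows "\<exists>B\<ge>0. \<forall>t. bump_ker n c t \<le> B"
proof -
  \<comment> \<open>The exponential beats every power: \<open>y = c / t / K\<close> satisfies
    \<open>(1 + y) ^ Suc n \<le> exp (c / t)\<close>. The exponent \<open>Suc n\<close> instead of
    \<open>n\<close> covers \<open>n = 0\<close>, and the \<open>+ 1\<close> in the base of
    \<open>B\<close> makes \<open>(K / c + 1) * (1 + y)\<close> at least \<open>1\<close>, so
    raising the power from \<open>n\<close> to \<open>Suc n\<close> only enlarges it.\<close>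
  define K where "K = real (Suc n)"
  define B where "B = (K / c + 1) ^ Suc n"
  have K: "K > 0" by (simp add: K_def)
  have B: "B \<ge> 0" unfolding B_def using K assms by (intro zero_le_power add_nonneg_nonneg) auto
  have "bump_ker n c t \<le> B" for t
  proof (cases "t > 0")
    case True
    define y where "y = c / t / K"
    have y: "y > 0" using assms True K by (simp add: y_def)
    have "c / t \<ge> 0" using assms True by simp
    then have "c / t \<ge> - real (Suc n)" using of_nat_0_le_iff[of "Suc n", where 'a = real] by linarith
    then have e: "(1 + y) ^ Suc n \<le> exp (c / t)"
      unfolding y_def K_def by (intro exp_ge_one_plus_x_over_n_power_n) auto
    have it: "inverse t \<le> (K / c + 1) * (1 + y)"
    proof -
      have "inverse t = K / c * y" using assms K True by (simp add: y_def field_simps)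
      also have "\<dots> \<le> (K / c + 1) * (1 + y)"
        using assms K y by (intro mult_mono) auto
      finally show ?thesis .
    qed
    have one: "1 * 1 \<le> (K / c + 1) * (1 + y)" using assms K y by (intro mult_mono) auto
    have "inverse t ^ n \<le> ((K / c + 1) * (1 + y)) ^ n" using it True by (intro power_mono) auto
    also have "\<dots> \<le> ((K / c + 1) * (1 + y)) ^ Suc n"
      using one by (intro power_increasing) auto
    also have "\<dots> = B * (1 + y) ^ Suc n" by (simp only: B_def power_mult_distrib)
    also have "\<dots> \<le> B * exp (c / t)" by (rule mult_left_mono[OF e B])
    finally have "inverse t ^ n * exp (- (c / t)) \<le> B * exp (c / t) * exp (- (c / t))"
      by (intro mult_right_mono) auto
    also have "\<dots> = B" by (simp only: mult.assoc exp_minus_inverse mult_1_right)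
    finally show ?thesis using True by (simp add: bump_ker_def)
  qed (use B in \<open>simp add: bump_ker_def\<close>)
  then show ?thesis using B by blast
qed

lemma bump_ker_nonneg: "bump_ker n c t \<ge> 0"
  by (simp add: bump_ker_def)

text \<open>The critical point is \<open>0\<close>: there the difference quotient at
  \<open>h > 0\<close> equals \<open>h * bump_ker (n + 2) c h\<close>, a bounded function times
  \<open>h\<close>. The same formula then covers both sides, as the kernels vanish for nonpositive
  arguments.\<close>

lemma has_real_derivative_bump_ker:
  assumes c: "c > 0"
  shows "(bump_ker n c has_real_derivative
    c * bump_ker (n + 2) c t - real n * bump_ker (n + 1) c t) (at t)"
proof -
  consider "t > 0" | "t < 0" | "t = 0" by linarith
  then show ?thesis
  proof cases
    case 1
    have "((\<lambda>t. inverse t ^ n * exp (- c / t)) has_real_derivative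
        c * bump_ker (n + 2) c t - real n * bump_ker (n + 1) c t) (at t)"
    proof -
      have "(inverse has_real_derivative - (inverse t ^ 2)) (at t)"
        using DERIV_inverse[of t UNIV] 1 by (simp add: numeral_2_eq_2)
      from DERIV_power[OF this, of n]
      have p: "((\<lambda>t. inverse t ^ n) has_real_derivative - real n * inverse t ^ (n + 1)) (at t)"
        by (cases n) (simp_all add: power2_eq_square algebra_simps)
      have "((\<lambda>t. exp (- c / t)) has_real_derivative exp (- c / t) * (c * inverse t ^ 2)) (at t)"
        using 1 by (auto intro!: derivative_eq_intros simp: field_simps power2_eq_square)
      from DERIV_mult[OF p this] show ?thesis
        using 1 by (simp add: bump_ker_def power2_eq_square algebra_simps)
    qed
    then show ?thesis
      by (rule has_field_derivative_transform_within_open[of _ _ _ "{0<..}"])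
        (use 1 in \<open>auto simp: bump_ker_def\<close>)
  next
    case 2
    have "((\<lambda>t. 0) has_real_derivative c * bump_ker (n + 2) c t - real n * bump_ker (n + 1) c t) (at t)"
      using 2 by (simp add: bump_ker_def)
    then show ?thesis
      by (rule has_field_derivative_transform_within_open[of _ _ _ "{..<0}"])
        (use 2 in \<open>auto simp: bump_ker_def\<close>)
  next
    case 3
    obtain B where "B \<ge> 0" and B': "\<forall>t. bump_ker (n + 2) c t \<le> B" using bump_ker_bounded[OF c] by blast
    note B = \<open>B \<ge> 0\<close> B'[rule_format]
    have le: "\<bar>bump_ker n c h / h\<bar> \<le> B * \<bar>h\<bar>" for h
    proof (cases "h > 0")
      case True
      have "bump_ker n c h = h^2 * bump_ker (n + 2) c h" using True by (simp add: bump_ker_def power2_eq_square field_simps)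
      then have "\<bar>bump_ker n c h / h\<bar> = h * bump_ker (n + 2) c h"
        using True bump_ker_nonneg[of "n + 2" c h] by (simp add: power2_eq_square abs_mult)
      then show ?thesis using True B(2)[of h] by (simp add: mult.commute mult_left_mono)
    next
      case False
      then have "bump_ker n c h = 0" by (simp add: bump_ker_def)
      then show ?thesis using B(1) by simp
    qed
    have "((\<lambda>h. B * \<bar>h\<bar>) \<longlongrightarrow> B * \<bar>0\<bar>) (at 0)" by (intro tendsto_intros)
    then have "((\<lambda>h. B * \<bar>h\<bar>) \<longlongrightarrow> 0) (at 0)" by simp
    moreover have "\<forall>\<^sub>F h in at 0. norm (bump_ker n c h / h) \<le> B * \<bar>h\<bar>" using le by simp
    ultimately have "((\<lambda>h. bump_ker n c h / h) \<longlongrightarrow> 0) (at 0)" by (rule Lim_null_comparison[rotated])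
    then show ?thesis using 3 by (simp add: DERIV_def bump_ker_def)
  qed
qed

text \<open>The affine argument serves both faces of a box, with \<open>s = 1\<close> for the lower
  and \<open>s = -1\<close> for the upper one. Differentiation raises the index \<open>n\<close>,
  hence the induction is uniform in it.\<close>

lemma Ck_bump_ker:
  fixes i :: "'d::finite"
  assumes c: "c > 0"
  shows "Ck k (\<lambda>x. bump_ker n c (s * x $ i + a))"
proof (induction k arbitrary: n)
  case 0
  have "continuous_on UNIV (bump_ker n c)"
    using has_real_derivative_bump_ker[OF c] DERIV_isCont by (blast intro: continuous_at_imp_continuous_on)
  then show ?case
    by (auto intro!: continuous_on_compose2[of UNIV "bump_ker n c"] continuous_intros)
next
  case (Suc k)
  define D where "D x = s * (c * bump_ker (n + 2) c (s * x $ i + a) - real n * bump_ker (n + 1) c (s * x $ i + a))"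
    for x :: "real^'d"
  show ?case
  proof (rule Ck_SucI[where g = "\<lambda>x. D x *\<^sub>R axis i 1"])
    fix x :: "real^'d"
    have 1: "((\<lambda>x. s * x $ i + a) has_derivative (\<lambda>h. s * h $ i)) (at x)"
      by (auto intro!: derivative_eq_intros bounded_linear.has_derivative[OF bounded_linear_vec_nth])
    have "(bump_ker n c has_derivative
        (\<lambda>h. h * (c * bump_ker (n + 2) c (s * x $ i + a) - real n * bump_ker (n + 1) c (s * x $ i + a))))
        (at (s * x $ i + a))"
      using has_real_derivative_bump_ker[OF c] by (simp add: has_field_derivative_def mult_commute_abs)
    from has_derivative_compose[OF 1 this]
    show "((\<lambda>x. bump_ker n c (s * x $ i + a)) has_derivative (\<lambda>h. (D x *\<^sub>R axis i 1) \<bullet> h)) (at x)"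
      by (simp add: D_def inner_axis' algebra_simps)
    have "Ck k (\<lambda>x. (s * c) * bump_ker (n + 2) c (s * x $ i + a) + (- s * real n) * bump_ker (n + 1) c (s * x $ i + a))"
      by (intro Ck_add Ck_cmult Suc.IH)
    then have "Ck k D" by (simp add: D_def [abs_def] algebra_simps)
    then have "Ck k (\<lambda>x. axis i 1 $ l * D x)" for l by (rule Ck_cmult)
    then show "Ck k (\<lambda>x. (D x *\<^sub>R axis i 1) $ l)" for l by (simp add: mult.commute)
  qed
qed

text \<open>With index \<open>0\<close> each factor is an exponential \<open>exp (- c / t)\<close>,
  cut off at \<open>0\<close>, which stays below \<open>1\<close> and tends to \<open>1\<close> as
  \<open>c\<close> tends to \<open>0\<close>. The product is positive exactly on the open box and
  approximates its indicator from below.\<close>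

definition box_bump :: "real^'d \<Rightarrow> real^'d \<Rightarrow> real \<Rightarrow> real^'d \<Rightarrow> real" where
  "box_bump a b c x = (\<Prod>i\<in>UNIV. bump_ker 0 c (x $ i - a $ i) * bump_ker 0 c (b $ i - x $ i))"

lemma box_bump_nonzero_iff: "box_bump a b c x \<noteq> 0 \<longleftrightarrow> x \<in> box a b"
  by (auto simp: box_bump_def bump_ker_def mem_box_cart)

lemma box_bump_test_function:
  assumes "c > 0" "cbox a b \<subseteq> \<Omega>"
  shows "box_bump a b c \<in> test_functions \<Omega>"
proof -
  have eq: "{x. box_bump a b c x \<noteq> 0} = box a b" using box_bump_nonzero_iff by blast
  have sub: "closure (box a b) \<subseteq> cbox a b" by (intro closure_minimal box_subset_cbox closed_cbox)
  have "Ck k (box_bump a b c)" for k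
  proof -
    have "Ck k (\<lambda>x. \<Prod>i\<in>UNIV. bump_ker 0 c (1 * x $ i + (- a $ i)) * bump_ker 0 c ((-1) * x $ i + b $ i))"
      using assms(1) by (intro Ck_prod Ck_mult Ck_bump_ker) auto
    then show ?thesis by (simp add: box_bump_def [abs_def] algebra_simps)
  qed
  moreover have "compact (closure (box a b))"
    using bounded_box compact_closure by blast
  ultimately show ?thesis using sub assms unfolding test_functions_def mem_Collect_eq eq by blast
qed

lemma bump_ker_0_bounds: "c > 0 \<Longrightarrow> bump_ker 0 c t \<le> 1"
  by (simp add: bump_ker_def)

lemma box_bump_bounds:
  assumes "c > 0" shows "0 \<le> box_bump a b c x" "box_bump a b c x \<le> 1"
  unfolding box_bump_def using bump_ker_0_bounds[OF assms]
  by (auto intro!: prod_nonneg prod_le_1 mult_nonneg_nonneg mult_le_one bump_ker_nonneg)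

lemma box_bump_tendsto_indicator:
  "(\<lambda>n. box_bump a b (1 / real (Suc n)) x) \<longlonglongrightarrow> indicator (box a b) x"
proof (cases "x \<in> box a b")
  case True
  have lim: "(\<lambda>n. bump_ker 0 (1 / real (Suc n)) t) \<longlonglongrightarrow> 1" if "t > 0" for t
  proof -
    have "(\<lambda>n. exp (- inverse (real (Suc n)) / t)) \<longlonglongrightarrow> exp (- 0 / t)"
      using that by (intro tendsto_intros LIMSEQ_inverse_real_of_nat) auto
    then show ?thesis using that by (simp add: bump_ker_def inverse_eq_divide)
  qed
  have "(\<lambda>n. box_bump a b (1 / real (Suc n)) x) \<longlonglongrightarrow> (\<Prod>i\<in>(UNIV::'a set). 1 * 1)"
    unfolding box_bump_def using True by (intro tendsto_intros lim) (auto simp: mem_box_cart)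
  then show ?thesis using True by simp
next
  case False
  then have "box_bump a b c x = 0" for c using box_bump_nonzero_iff by blast
  then show ?thesis using False by simp
qed

section \<open>The space of square integrable functions\<close>

lemma L2D:
  assumes "f \<in> L2 \<Omega>"
  shows "f \<in> borel_measurable (lebesgue_on \<Omega>)" "integrable (lebesgue_on \<Omega>) (\<lambda>x. (norm (f x))\<^sup>2)"
  using assms by (auto simp: L2_def)

lemma L2_norm_nonneg: "L2_norm \<Omega> f \<ge> 0"
  by (simp add: L2_norm_def)

lemma L2_norm_power2: "(L2_norm \<Omega> f)\<^sup>2 = (\<integral>x. (norm (f x))\<^sup>2 \<partial>lebesgue_on \<Omega>)"
  by (simp add: L2_norm_def)

lemma L2_mono:
  fixes f :: "real^'d \<Rightarrow> 'b::euclidean_space" and g :: "real^'d \<Rightarrow> 'c::euclidean_space"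
  assumes "f \<in> borel_measurable (lebesgue_on \<Omega>)" "g \<in> L2 \<Omega>"
    and le: "\<And>x. x \<in> \<Omega> \<Longrightarrow> norm (f x) \<le> norm (g x)"
  shows "f \<in> L2 \<Omega>" "L2_norm \<Omega> f \<le> L2_norm \<Omega> g"
proof -
  have i: "integrable (lebesgue_on \<Omega>) (\<lambda>x. (norm (f x))\<^sup>2)"
    by (rule Bochner_Integration.integrable_bound[OF L2D(2)[OF assms(2)]])
      (use assms in \<open>auto intro!: power_mono\<close>)
  then show "f \<in> L2 \<Omega>" using assms by (simp add: L2_def)
  show "L2_norm \<Omega> f \<le> L2_norm \<Omega> g"
    unfolding L2_norm_def
    by (intro real_sqrt_le_mono integral_mono[OF i L2D(2)[OF assms(2)]] power_mono le) auto
qed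

lemma L2_scaleR: "f \<in> L2 \<Omega> \<Longrightarrow> (\<lambda>x. c *\<^sub>R f x) \<in> L2 \<Omega>"
  by (auto simp: L2_def power_mult_distrib)

lemma L2_zero: "(\<lambda>x. 0) \<in> L2 \<Omega>"
  by (simp add: L2_def)

lemma L2_add:
  assumes "f \<in> L2 \<Omega>" "g \<in> L2 \<Omega>"
  shows "(\<lambda>x. f x + g x) \<in> L2 \<Omega>"
proof -
  have "integrable (lebesgue_on \<Omega>) (\<lambda>x. 2 * (norm (f x))\<^sup>2 + 2 * (norm (g x))\<^sup>2)"
    using L2D[OF assms(1)] L2D[OF assms(2)] by auto
  then have "integrable (lebesgue_on \<Omega>) (\<lambda>x. (norm (f x + g x))\<^sup>2)"
  proof (rule Bochner_Integration.integrable_bound)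
    show "(\<lambda>x. (norm (f x + g x))\<^sup>2) \<in> borel_measurable (lebesgue_on \<Omega>)"
      using L2D[OF assms(1)] L2D[OF assms(2)] by auto
    have "(norm (f x + g x))\<^sup>2 \<le> 2 * (norm (f x))\<^sup>2 + 2 * (norm (g x))\<^sup>2" for x
    proof -
      have "(norm (f x + g x))\<^sup>2 \<le> (norm (f x) + norm (g x))\<^sup>2"
        by (intro power_mono norm_triangle_ineq) auto
      also have "\<dots> \<le> 2 * (norm (f x))\<^sup>2 + 2 * (norm (g x))\<^sup>2"
        using sum_squares_bound[of "norm (f x)" "norm (g x)"] by (simp add: power2_sum)
      finally show ?thesis .
    qed
    then show "AE x in lebesgue_on \<Omega>. norm ((norm (f x + g x))\<^sup>2) \<le> norm (2 * (norm (f x))\<^sup>2 + 2 * (norm (g x))\<^sup>2)"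
      by simp
  qed
  then show ?thesis using assms by (auto simp: L2_def)
qed

lemma L2_diff: "f \<in> L2 \<Omega> \<Longrightarrow> g \<in> L2 \<Omega> \<Longrightarrow> (\<lambda>x. f x - g x) \<in> L2 \<Omega>"
  using L2_add[of f \<Omega> "\<lambda>x. -1 *\<^sub>R g x"] L2_scaleR[of g \<Omega> "-1"] by simp

lemma L2_linear_image:
  assumes T: "bounded_linear T" and f: "f \<in> L2 \<Omega>"
  shows "(\<lambda>x. T (f x)) \<in> L2 \<Omega>"
proof -
  obtain K where K: "\<And>y. norm (T y) \<le> norm y * K" using bounded_linear.bounded[OF T] by blast
  have m: "(\<lambda>x. T (f x)) \<in> borel_measurable (lebesgue_on \<Omega>)"
    using L2D(1)[OF f] bounded_linear.linear[OF T]
    by (intro borel_measurable_continuous_on[OF linear_continuous_on[OF T]])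
  show ?thesis
  proof (rule L2_mono(1)[OF m L2_scaleR[OF f, of "max K 0"]])
    show "norm (T (f x)) \<le> norm (max K 0 *\<^sub>R f x)" for x
      using K[of "f x"] mult_right_mono[of K "max K 0" "norm (f x)"] by (simp add: mult.commute)
  qed
qed

section \<open>Inner product and seminorm properties\<close>

lemma L2_integrable_inner:
  assumes "f \<in> L2 \<Omega>" "g \<in> L2 \<Omega>"
  shows "integrable (lebesgue_on \<Omega>) (\<lambda>x. f x \<bullet> g x)"
proof (rule Bochner_Integration.integrable_bound)
  show "integrable (lebesgue_on \<Omega>) (\<lambda>x. (norm (f x))\<^sup>2 + (norm (g x))\<^sup>2)"
    using L2D[OF assms(1)] L2D[OF assms(2)] by auto
  show "(\<lambda>x. f x \<bullet> g x) \<in> borel_measurable (lebesgue_on \<Omega>)"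
    using L2D[OF assms(1)] L2D[OF assms(2)] by auto
  have "\<bar>f x \<bullet> g x\<bar> \<le> (norm (f x))\<^sup>2 + (norm (g x))\<^sup>2" for x
  proof -
    have "\<bar>f x \<bullet> g x\<bar> \<le> norm (f x) * norm (g x)" by (rule Cauchy_Schwarz_ineq2)
    moreover have "2 * norm (f x) * norm (g x) \<le> (norm (f x))\<^sup>2 + (norm (g x))\<^sup>2"
      by (rule sum_squares_bound)
    moreover have "0 \<le> norm (f x) * norm (g x)" by simp
    ultimately show ?thesis by linarith
  qed
  then show "AE x in lebesgue_on \<Omega>. norm (f x \<bullet> g x) \<le> norm ((norm (f x))\<^sup>2 + (norm (g x))\<^sup>2)"
    by simp
qed

lemma L2_norm_add_power2:
  assumes "f \<in> L2 \<Omega>" "g \<in> L2 \<Omega>"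
  shows "(L2_norm \<Omega> (\<lambda>x. f x + t *\<^sub>R g x))\<^sup>2 =
    (L2_norm \<Omega> f)\<^sup>2 + 2 * t * (\<integral>x. f x \<bullet> g x \<partial>lebesgue_on \<Omega>) + t\<^sup>2 * (L2_norm \<Omega> g)\<^sup>2"
proof -
  have "(norm (f x + t *\<^sub>R g x))\<^sup>2 = (norm (f x))\<^sup>2 + 2 * t * (f x \<bullet> g x) + t\<^sup>2 * (norm (g x))\<^sup>2" for x
    by (simp add: power2_norm_eq_inner inner_add_left inner_add_right inner_commute[of "g x" "f x"]
        power2_eq_square[of t] algebra_simps)
  then show ?thesis
    unfolding L2_norm_power2
    using L2D(2)[OF assms(1)] L2D(2)[OF assms(2)] L2_integrable_inner[OF assms] by simp
qed

lemma L2_Cauchy_Schwarz: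
  assumes "f \<in> L2 \<Omega>" "g \<in> L2 \<Omega>"
  shows "\<bar>\<integral>x. f x \<bullet> g x \<partial>lebesgue_on \<Omega>\<bar> \<le> L2_norm \<Omega> f * L2_norm \<Omega> g"
proof -
  let ?a = "L2_norm \<Omega> f" and ?b = "L2_norm \<Omega> g" and ?c = "\<integral>x. f x \<bullet> g x \<partial>lebesgue_on \<Omega>"
  have q: "0 \<le> ?a\<^sup>2 + 2 * t * ?c + t\<^sup>2 * ?b\<^sup>2" for t
    using L2_norm_add_power2[OF assms, of t] by (metis zero_le_power2)
  have "?c\<^sup>2 \<le> (?a * ?b)\<^sup>2"
  proof (cases "?b = 0")
    case True
    have "?c = 0"
    proof (rule ccontr)
      assume "?c \<noteq> 0"
      \<comment> \<open>With \<open>?b = 0\<close> the quadratic is affine in \<open>t\<close> with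
        slope \<open>2 * ?c\<close>; the chosen \<open>t\<close> gives it the value
        \<open>-1\<close>.\<close>
      then show False using q[of "- (?a\<^sup>2 + 1) / (2 * ?c)"] True by (simp add: field_simps)
    qed
    then show ?thesis by simp
  next
    case False
    \<comment> \<open>Evaluation at the minimizer \<open>t = - ?c / ?b\<^sup>2\<close>, cleared of
      its denominator.\<close>
    have "0 \<le> ?b\<^sup>2 * (?a\<^sup>2 + 2 * (- ?c / ?b\<^sup>2) * ?c + (- ?c / ?b\<^sup>2)\<^sup>2 * ?b\<^sup>2)"
      by (rule mult_nonneg_nonneg[OF zero_le_power2 q])
    also have "\<dots> = (?a * ?b)\<^sup>2 - ?c\<^sup>2" using False by (simp add: field_simps power2_eq_square)
    finally show ?thesis by simp
  qed
  then show ?thesis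
    using abs_le_square_iff[of ?c "?a * ?b"] L2_norm_nonneg[of \<Omega> f] L2_norm_nonneg[of \<Omega> g] by simp
qed

lemma L2_norm_triangle:
  assumes "f \<in> L2 \<Omega>" "g \<in> L2 \<Omega>"
  shows "L2_norm \<Omega> (\<lambda>x. f x + g x) \<le> L2_norm \<Omega> f + L2_norm \<Omega> g"
proof (rule power2_le_imp_le)
  show "(L2_norm \<Omega> (\<lambda>x. f x + g x))\<^sup>2 \<le> (L2_norm \<Omega> f + L2_norm \<Omega> g)\<^sup>2"
    using L2_norm_add_power2[OF assms, of 1] L2_Cauchy_Schwarz[OF assms] by (simp add: power2_sum)
  show "0 \<le> L2_norm \<Omega> f + L2_norm \<Omega> g" by (simp add: L2_norm_nonneg)
qed

lemma L2_norm_scaleR: "L2_norm \<Omega> (\<lambda>x. c *\<^sub>R f x) = \<bar>c\<bar> * L2_norm \<Omega> f"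
  by (simp add: L2_norm_def power_mult_distrib real_sqrt_mult)

lemma L2_norm_minus_commute: "L2_norm \<Omega> (\<lambda>x. f x - g x) = L2_norm \<Omega> (\<lambda>x. g x - f x)"
  by (simp add: L2_norm_def norm_minus_commute)

lemma L2_norm_cong_AE:
  assumes "f \<in> borel_measurable (lebesgue_on \<Omega>)" "g \<in> borel_measurable (lebesgue_on \<Omega>)"
    and "AE x in lebesgue_on \<Omega>. f x = g x"
  shows "L2_norm \<Omega> f = L2_norm \<Omega> g"
  unfolding L2_norm_def using assms by (intro arg_cong[where f = sqrt] integral_cong_AE) auto

lemma L2_norm_eq_0_iff:
  assumes "f \<in> L2 \<Omega>"
  shows "L2_norm \<Omega> f = 0 \<longleftrightarrow> (AE x in lebesgue_on \<Omega>. f x = 0)"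
  using integral_nonneg_eq_0_iff_AE[OF L2D(2)[OF assms]] by (simp add: L2_norm_def)

lemma L2_norm_Pair_power2:
  assumes "f \<in> L2 \<Omega>" "g \<in> L2 \<Omega>"
  shows "(L2_norm \<Omega> (\<lambda>x. (f x, g x)))\<^sup>2 = (L2_norm \<Omega> f)\<^sup>2 + (L2_norm \<Omega> g)\<^sup>2"
  unfolding L2_norm_power2 using L2D(2)[OF assms(1)] L2D(2)[OF assms(2)] by (simp add: norm_Pair)

lemma L2_Pair:
  assumes "f \<in> L2 \<Omega>" "g \<in> L2 \<Omega>"
  shows "(\<lambda>x. (f x, g x)) \<in> L2 \<Omega>"
  using L2D[OF assms(1)] L2D[OF assms(2)] by (simp add: L2_def norm_Pair)

lemma norm_vec_power2: "(norm (x :: 'a::real_normed_vector^'n))\<^sup>2 = (\<Sum>i\<in>UNIV. (norm (x $ i))\<^sup>2)"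
  by (simp add: norm_vec_def L2_set_def sum_nonneg)

lemma L2_norm_vec_power2:
  fixes f :: "real^'d \<Rightarrow> 'b::euclidean_space^'n"
  assumes "\<And>i. (\<lambda>x. f x $ i) \<in> L2 \<Omega>"
  shows "(L2_norm \<Omega> f)\<^sup>2 = (\<Sum>i\<in>UNIV. (L2_norm \<Omega> (\<lambda>x. f x $ i))\<^sup>2)"
  unfolding L2_norm_power2 norm_vec_power2
  using L2D(2)[OF assms] by (simp add: Bochner_Integration.integral_sum)

lemma L2_vec:
  fixes f :: "real^'d \<Rightarrow> 'b::euclidean_space^'n"
  assumes "\<And>i. (\<lambda>x. f x $ i) \<in> L2 \<Omega>"
  shows "f \<in> L2 \<Omega>"
proof -
  have "f \<in> borel_measurable (lebesgue_on \<Omega>)"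
    using L2D(1)[OF assms]
    by (subst borel_measurable_euclidean_space) (auto simp: Basis_vec_def inner_axis)
  moreover have "integrable (lebesgue_on \<Omega>) (\<lambda>x. (norm (f x))\<^sup>2)"
    unfolding norm_vec_power2 using L2D(2)[OF assms] by simp
  ultimately show ?thesis by (simp add: L2_def)
qed

section \<open>Convergence and completeness\<close>

lemma L2_integral_inner_tendsto:
  assumes f: "\<And>n. f n \<in> L2 \<Omega>" "f' \<in> L2 \<Omega>" and g: "g \<in> L2 \<Omega>"
    and lim: "(\<lambda>n. L2_norm \<Omega> (\<lambda>x. f n x - f' x)) \<longlonglongrightarrow> 0"
  shows "(\<lambda>n. \<integral>x. f n x \<bullet> g x \<partial>lebesgue_on \<Omega>) \<longlonglongrightarrow> (\<integral>x. f' x \<bullet> g x \<partial>lebesgue_on \<Omega>)"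
proof -
  have "(\<integral>x. f n x \<bullet> g x \<partial>lebesgue_on \<Omega>) - (\<integral>x. f' x \<bullet> g x \<partial>lebesgue_on \<Omega>) =
      (\<integral>x. (f n x - f' x) \<bullet> g x \<partial>lebesgue_on \<Omega>)" for n
    using L2_integrable_inner[OF f(1) g] L2_integrable_inner[OF f(2) g] by (simp add: inner_diff_left)
  then have "norm ((\<integral>x. f n x \<bullet> g x \<partial>lebesgue_on \<Omega>) - (\<integral>x. f' x \<bullet> g x \<partial>lebesgue_on \<Omega>)) \<le>
      L2_norm \<Omega> (\<lambda>x. f n x - f' x) * L2_norm \<Omega> g" for n
    using L2_Cauchy_Schwarz[OF L2_diff[OF f] g] by simp
  moreover have "(\<lambda>n. L2_norm \<Omega> (\<lambda>x. f n x - f' x) * L2_norm \<Omega> g) \<longlonglongrightarrow> 0"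
    using tendsto_mult_left_zero[OF lim] by simp
  ultimately have "(\<lambda>n. (\<integral>x. f n x \<bullet> g x \<partial>lebesgue_on \<Omega>) - (\<integral>x. f' x \<bullet> g x \<partial>lebesgue_on \<Omega>)) \<longlonglongrightarrow> 0"
    by (rule Lim_null_comparison[OF always_eventually[OF allI]])
  then show ?thesis by (simp add: LIM_zero_iff)
qed

lemma L2_nn_integral:
  assumes "f \<in> L2 \<Omega>"
  shows "(\<integral>\<^sup>+x. ennreal ((norm (f x))\<^sup>2) \<partial>lebesgue_on \<Omega>) = ennreal ((L2_norm \<Omega> f)\<^sup>2)"
  unfolding L2_norm_power2 by (rule nn_integral_eq_integral[OF L2D(2)[OF assms]]) auto

text \<open>Riesz-Fischer: a rapidly converging subsequence converges almost everywhere, and Fatou's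
  lemma shows that its pointwise limit is also the limit in the norm.\<close>

lemma L2_complete:
  fixes f :: "nat \<Rightarrow> real^'d \<Rightarrow> 'b::euclidean_space"
  assumes f: "\<And>n. f n \<in> L2 \<Omega>"
    and Cauchy: "\<And>\<epsilon>. \<epsilon> > 0 \<Longrightarrow> \<exists>M. \<forall>m\<ge>M. \<forall>n\<ge>M. L2_norm \<Omega> (\<lambda>x. f m x - f n x) < \<epsilon>"
  shows "\<exists>g\<in>L2 \<Omega>. (\<lambda>n. L2_norm \<Omega> (\<lambda>x. f n x - g x)) \<longlonglongrightarrow> 0"
proof -
  let ?M = "lebesgue_on \<Omega>"
  note [measurable] = L2D(1)[OF f]
  have "\<exists>R. \<forall>m\<ge>R. \<forall>n\<ge>R. L2_norm \<Omega> (\<lambda>x. f m x - f n x) < (1/2)^k" for k :: nat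
    by (rule Cauchy) simp
  then obtain R where R: "\<And>k m n. m \<ge> R k \<Longrightarrow> n \<ge> R k \<Longrightarrow> L2_norm \<Omega> (\<lambda>x. f m x - f n x) < (1/2)^k"
    by metis
  \<comment> \<open>Adding \<open>k\<close> and all earlier thresholds makes the index
    nondecreasing, at least \<open>R k\<close>, and unbounded.\<close>
  define r where "r k = k + (\<Sum>i\<le>k. R i)" for k
  have rR: "r k \<ge> R k" for k
    unfolding r_def using member_le_sum[of k "{..k}" R] by simp
  have rSuc: "r (Suc k) \<ge> r k" for k by (simp add: r_def)
  have rk: "r k \<ge> k" for k by (simp add: r_def)
  define d where "d k x = f (r (Suc k)) x - f (r k) x" for k x
  have dL2: "d k \<in> L2 \<Omega>" for k unfolding d_def [abs_def] using L2_diff[OF f f] by simp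
  note [measurable] = L2D(1)[OF dL2]
  have d_norm: "(L2_norm \<Omega> (d k))\<^sup>2 \<le> (1/4)^k" for k
  proof -
    have "L2_norm \<Omega> (d k) \<le> (1/2)^k"
      unfolding d_def [abs_def] using R[of k "r (Suc k)" "r k"] rR[of k] rSuc[of k] by simp
    then have "(L2_norm \<Omega> (d k))\<^sup>2 \<le> ((1/2)^k)\<^sup>2" by (intro power_mono L2_norm_nonneg)
    also have "\<dots> = (1/4)^k" by (simp add: power_mult[symmetric] mult.commute power2_eq_square power_mult_distrib[symmetric])
    finally show ?thesis .
  qed
  \<comment> \<open>The weights \<open>2^k\<close> still leave a convergent geometric series, since
    the squared norms decay like \<open>(1/4)^k\<close>. They allow recovering summability of the
    differences themselves from that of the weighted squares.\<close>
  have "(\<integral>\<^sup>+x. (\<Sum>k. ennreal (2^k * (norm (d k x))\<^sup>2)) \<partial>?M) = (\<Sum>k. \<integral>\<^sup>+x. ennreal (2^k * (norm (d k x))\<^sup>2) \<partial>?M)"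
    by (rule nn_integral_suminf) measurable
  also have "\<dots> = (\<Sum>k. ennreal (2^k * (L2_norm \<Omega> (d k))\<^sup>2))"
    using L2_nn_integral[OF dL2] by (simp add: ennreal_mult nn_integral_cmult)
  also have "\<dots> \<le> (\<Sum>k. ennreal ((1/2)^k))"
  proof (intro suminf_le summableI ennreal_leI)
    fix k
    have "2^k * (L2_norm \<Omega> (d k))\<^sup>2 \<le> 2^k * (1/4)^k" using d_norm[of k] by simp
    also have "\<dots> = (1/2)^k" by (simp add: power_mult_distrib[symmetric])
    finally show "2^k * (L2_norm \<Omega> (d k))\<^sup>2 \<le> (1/2)^k" .
  qed
  also have "\<dots> = ennreal (\<Sum>k. (1/2)^k)"
    by (rule suminf_ennreal2) (auto intro: summable_geometric)
  also have "\<dots> < \<infinity>" by (rule ennreal_less_top[folded infinity_ennreal_def])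
  finally have "AE x in ?M. (\<Sum>k. ennreal (2^k * (norm (d k x))\<^sup>2)) \<noteq> \<infinity>"
    by (intro nn_integral_noteq_infinite) auto
  then have conv: "AE x in ?M. convergent (\<lambda>n. f (r n) x)"
  proof eventually_elim
    case (elim x)
    have s: "summable (\<lambda>k. 2^k * (norm (d k x))\<^sup>2)"
      using elim by (intro summable_suminf_not_top) auto
    have "summable (\<lambda>k. (1/2)^k + 2^k * (norm (d k x))\<^sup>2 :: real)"
      by (intro summable_add s) (simp add: summable_geometric)
    then have "summable (\<lambda>k. norm (d k x))"
    proof (rule summable_comparison_test')
      fix k :: nat
      let ?q = "2^k :: real"
      \<comment> \<open>Arithmetic-geometric mean inequality, from the square of
        \<open>?q * norm (d k x) - 1\<close>.\<close>
      have "norm (d k x) \<le> 1 / ?q + ?q * (norm (d k x))\<^sup>2"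
      proof -
        have "0 \<le> (?q * norm (d k x) - 1)\<^sup>2 / ?q" by simp
        also have "\<dots> = ?q * (norm (d k x))\<^sup>2 - 2 * norm (d k x) + 1 / ?q"
          by (simp add: power2_eq_square field_simps)
        finally show ?thesis using norm_ge_zero[of "d k x"] by linarith
      qed
      then show "norm (norm (d k x)) \<le> (1/2)^k + 2^k * (norm (d k x))\<^sup>2"
        by (simp add: power_one_over)
    qed
    then have "summable (\<lambda>k. d k x)" by (rule summable_norm_cancel)
    then have "convergent (\<lambda>n. \<Sum>k<n. d k x)" by (simp add: summable_iff_convergent)
    moreover have "(\<Sum>k<n. d k x) = f (r n) x - f (r 0) x" for n
      unfolding d_def by (rule sum_lessThan_telescope)
    ultimately have "convergent (\<lambda>n. f (r n) x - f (r 0) x)" by simp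
    then show ?case by (simp add: convergent_diff_const_right_iff)
  qed
  \<comment> \<open>Off the set of convergence \<open>lim\<close> has an unspecified value; that set
    is null, and \<open>g\<close> is measurable all the same.\<close>
  define g where "g x = lim (\<lambda>n. f (r n) x)" for x
  have g_meas [measurable]: "g \<in> borel_measurable ?M" unfolding g_def [abs_def] by measurable
  have g_lim: "AE x in ?M. (\<lambda>n. f (r n) x) \<longlonglongrightarrow> g x"
    using conv unfolding g_def by eventually_elim (simp add: convergent_LIMSEQ_iff)
  \<comment> \<open>Fatou's lemma along the subsequence. It is used twice: with \<epsilon> equal to
    \<open>1\<close> to place \<open>g\<close> in \<open>L2\<close>, then with arbitrary \<epsilon>
    to obtain convergence.\<close>
  have bound: "(\<lambda>x. g x - f n x) \<in> L2 \<Omega> \<and> L2_norm \<Omega> (\<lambda>x. g x - f n x) \<le> \<epsilon>"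
    if e: "\<epsilon> > 0" and N: "\<And>m. m \<ge> N \<Longrightarrow> L2_norm \<Omega> (\<lambda>x. f m x - f n x) < \<epsilon>" for \<epsilon> N n
  proof -
    have "(\<integral>\<^sup>+x. ennreal ((norm (g x - f n x))\<^sup>2) \<partial>?M) =
        (\<integral>\<^sup>+x. liminf (\<lambda>j. ennreal ((norm (f (r j) x - f n x))\<^sup>2)) \<partial>?M)"
    proof (rule nn_integral_cong_AE)
      show "AE x in ?M. ennreal ((norm (g x - f n x))\<^sup>2) = liminf (\<lambda>j. ennreal ((norm (f (r j) x - f n x))\<^sup>2))"
        using g_lim
      proof eventually_elim
        case (elim x)
        have "(\<lambda>j. ennreal ((norm (f (r j) x - f n x))\<^sup>2)) \<longlonglongrightarrow> ennreal ((norm (g x - f n x))\<^sup>2)"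
          by (intro tendsto_intros elim)
        then show ?case by (rule lim_imp_Liminf[OF trivial_limit_sequentially, symmetric])
      qed
    qed
    also have "\<dots> \<le> liminf (\<lambda>j. \<integral>\<^sup>+x. ennreal ((norm (f (r j) x - f n x))\<^sup>2) \<partial>?M)"
      by (rule nn_integral_liminf) measurable
    also have "\<dots> \<le> liminf (\<lambda>j::nat. ennreal (\<epsilon>\<^sup>2))"
    proof (rule Liminf_mono)
      show "\<forall>\<^sub>F j in sequentially. (\<integral>\<^sup>+x. ennreal ((norm (f (r j) x - f n x))\<^sup>2) \<partial>?M) \<le> ennreal (\<epsilon>\<^sup>2)"
        using eventually_ge_at_top[of N]
      proof eventually_elim
        case (elim j)
        have "L2_norm \<Omega> (\<lambda>x. f (r j) x - f n x) < \<epsilon>" using N[of "r j"] rk[of j] elim by simp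
        then have "(L2_norm \<Omega> (\<lambda>x. f (r j) x - f n x))\<^sup>2 \<le> \<epsilon>\<^sup>2"
          by (intro power_mono L2_norm_nonneg) auto
        then show ?case unfolding L2_nn_integral[OF L2_diff[OF f f]] by (rule ennreal_leI)
      qed
    qed
    also have "\<dots> = ennreal (\<epsilon>\<^sup>2)" by (simp add: Liminf_const)
    finally have le: "(\<integral>\<^sup>+x. ennreal ((norm (g x - f n x))\<^sup>2) \<partial>?M) \<le> ennreal (\<epsilon>\<^sup>2)" .
    have "integrable ?M (\<lambda>x. (norm (g x - f n x))\<^sup>2)"
      by (rule integrableI_bounded) (use le in \<open>auto intro: le_less_trans\<close>)
    then have L2: "(\<lambda>x. g x - f n x) \<in> L2 \<Omega>" by (simp add: L2_def)
    have "ennreal ((L2_norm \<Omega> (\<lambda>x. g x - f n x))\<^sup>2) \<le> ennreal (\<epsilon>\<^sup>2)"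
      using le unfolding L2_nn_integral[OF L2] .
    then have "(L2_norm \<Omega> (\<lambda>x. g x - f n x))\<^sup>2 \<le> \<epsilon>\<^sup>2" by simp
    then have "L2_norm \<Omega> (\<lambda>x. g x - f n x) \<le> \<epsilon>" using less_imp_le[OF e] by (rule power2_le_imp_le)
    then show ?thesis using L2 by blast
  qed
  obtain N where N: "\<And>m n. m \<ge> N \<Longrightarrow> n \<ge> N \<Longrightarrow> L2_norm \<Omega> (\<lambda>x. f m x - f n x) < 1"
    using Cauchy[of 1] by auto
  have "(\<lambda>x. g x - f N x) \<in> L2 \<Omega>" using bound[of 1 N N] N by simp
  from L2_add[OF this f[of N]] have gL2: "g \<in> L2 \<Omega>" by simp
  moreover have "(\<lambda>n. L2_norm \<Omega> (\<lambda>x. f n x - g x)) \<longlonglongrightarrow> 0"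
  proof (rule LIMSEQ_I)
    fix e :: real assume e: "e > 0"
    then obtain N where N: "\<And>m n. m \<ge> N \<Longrightarrow> n \<ge> N \<Longrightarrow> L2_norm \<Omega> (\<lambda>x. f m x - f n x) < e / 2"
      using Cauchy[of "e / 2"] by auto
    have "norm (L2_norm \<Omega> (\<lambda>x. f n x - g x) - 0) < e" if "n \<ge> N" for n
      using bound[of "e / 2" N n] N that e L2_norm_nonneg[of \<Omega> "\<lambda>x. f n x - g x"]
        L2_norm_minus_commute[of \<Omega> "f n" g] by auto
    then show "\<exists>no. \<forall>n\<ge>no. norm (L2_norm \<Omega> (\<lambda>x. f n x - g x) - 0) < e" by blast
  qed
  ultimately show ?thesis by blast
qed

section \<open>Gradients and integrability of test functions\<close>

lemma test_function_grad:
  assumes \<phi>: "\<phi> \<in> test_functions \<Omega>"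
  shows has_derivative_test_function: "(\<phi> has_derivative (\<lambda>h. grad \<phi> x \<bullet> h)) (at x)"
    and Ck_grad_test_function: "Ck k (\<lambda>x. grad \<phi> x $ i)"
proof -
  have *: "(\<forall>x. (\<phi> has_derivative (\<lambda>h. grad \<phi> x \<bullet> h)) (at x)) \<and> (\<forall>i. Ck k (\<lambda>x. grad \<phi> x $ i))" for k
  proof -
    have "Ck (Suc k) \<phi>" using \<phi> by (simp add: test_functions_def)
    from Ck_SucD[OF this] obtain g where g: "\<forall>x. (\<phi> has_derivative (\<lambda>h. g x \<bullet> h)) (at x)"
      "\<forall>i. Ck k (\<lambda>x. g x $ i)" by (elim exE conjE) (rule that)
    \<comment> \<open>The witness \<open>g\<close> is obtained separately for each \<open>k\<close>;
      uniqueness of the derivative identifies all of them with \<open>grad \<phi>\<close>.\<close>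
    have "grad \<phi> x = g x" for x
      using frechet_derivative_at[OF g(1)[rule_format, of x], symmetric]
      by (simp add: grad_def vec_eq_iff inner_axis)
    then have "grad \<phi> = g" by blast
    then show ?thesis using g by simp
  qed
  show "(\<phi> has_derivative (\<lambda>h. grad \<phi> x \<bullet> h)) (at x)" using * by blast
  show "Ck k (\<lambda>x. grad \<phi> x $ i)" using * by blast
qed

lemma grad_eqI:
  assumes "(f has_derivative (\<lambda>h. g \<bullet> h)) (at x)" shows "grad f x = g"
  using frechet_derivative_at[OF assms, symmetric] by (simp add: grad_def vec_eq_iff inner_axis)

lemma grad_test_function_add:
  assumes "\<phi> \<in> test_functions \<Omega>" "\<psi> \<in> test_functions \<Omega>'"
  shows "grad (\<lambda>x. \<phi> x + \<psi> x) x = grad \<phi> x + grad \<psi> x"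
  by (rule grad_eqI)
    (use has_derivative_add[OF has_derivative_test_function[OF assms(1)] has_derivative_test_function[OF assms(2)]]
      in \<open>simp add: inner_add_left\<close>)

lemma grad_test_function_cmult:
  assumes "\<phi> \<in> test_functions \<Omega>"
  shows "grad (\<lambda>x. c * \<phi> x) x = c *\<^sub>R grad \<phi> x"
  by (rule grad_eqI)
    (use has_derivative_mult_right[OF has_derivative_test_function[OF assms], of c] in simp)

lemma test_functions_add:
  assumes "\<phi> \<in> test_functions \<Omega>" "\<psi> \<in> test_functions \<Omega>"
  shows "(\<lambda>x. \<phi> x + \<psi> x) \<in> test_functions \<Omega>"
proof -
  have "closure {x. \<phi> x + \<psi> x \<noteq> 0} \<subseteq> closure ({x. \<phi> x \<noteq> 0} \<union> {x. \<psi> x \<noteq> 0})"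
    by (intro closure_mono) auto
  then have sub: "closure {x. \<phi> x + \<psi> x \<noteq> 0} \<subseteq> closure {x. \<phi> x \<noteq> 0} \<union> closure {x. \<psi> x \<noteq> 0}"
    by (simp add: closure_Un)
  have "compact (closure {x. \<phi> x \<noteq> 0} \<union> closure {x. \<psi> x \<noteq> 0})"
    using assms by (intro compact_Un) (auto simp: test_functions_def)
  from compact_Int_closed[OF this closed_closure, of "{x. \<phi> x + \<psi> x \<noteq> 0}"] sub
  have "compact (closure {x. \<phi> x + \<psi> x \<noteq> 0})" by (simp add: Int_absorb1)
  moreover have "closure {x. \<phi> x + \<psi> x \<noteq> 0} \<subseteq> \<Omega>" using assms sub unfolding test_functions_def by blast
  ultimately show ?thesis using assms by (simp add: test_functions_def Ck_add)
qed

lemma test_functions_cmult: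
  assumes "\<phi> \<in> test_functions \<Omega>" shows "(\<lambda>x. c * \<phi> x) \<in> test_functions \<Omega>"
proof (cases "c = 0")
  case True
  then show ?thesis by (simp add: test_functions_def Ck_const)
next
  case False
  then show ?thesis using assms by (simp add: test_functions_def Ck_cmult)
qed

lemma continuous_compact_support_L2:
  fixes f :: "real^'d \<Rightarrow> real"
  assumes f: "continuous_on UNIV f" and K: "compact K" "\<And>x. x \<notin> K \<Longrightarrow> f x = 0"
    and \<Omega>: "\<Omega> \<in> sets lebesgue"
  shows "f \<in> L2 \<Omega>"
proof -
  have m: "f \<in> borel_measurable borel" by (rule borel_measurable_continuous_onI[OF f])
  then have "f \<in> borel_measurable lborel" by simp
  then have "f \<in> borel_measurable lebesgue" by (rule measurable_completion)
  then have 1: "f \<in> borel_measurable (lebesgue_on \<Omega>)" by (rule measurable_restrict_space1)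
  have "continuous_on K (\<lambda>x. (norm (f x))\<^sup>2)"
    using continuous_on_subset[OF f] by (intro continuous_intros) auto
  from borel_integrable_compact[OF K(1) this]
  have "integrable lborel (\<lambda>x. indicator K x *\<^sub>R (norm (f x))\<^sup>2)" .
  also have "(\<lambda>x. indicator K x *\<^sub>R (norm (f x))\<^sup>2) = (\<lambda>x. (norm (f x))\<^sup>2)"
    using K(2) by (auto simp: fun_eq_iff indicator_def)
  finally have "integrable lebesgue (\<lambda>x. (norm (f x))\<^sup>2)"
    using m by (subst integrable_completion) auto
  then have "integrable (lebesgue_on \<Omega>) (\<lambda>x. (norm (f x))\<^sup>2)"
    using \<Omega> integrable_mult_indicator[OF \<Omega>, of "\<lambda>x. (norm (f x))\<^sup>2"]
    by (subst integrable_restrict_space) auto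
  then show ?thesis using 1 by (simp add: L2_def)
qed

lemma test_function_L2:
  assumes \<phi>: "\<phi> \<in> test_functions U" and \<Omega>: "\<Omega> \<in> sets lebesgue"
  shows "\<phi> \<in> L2 \<Omega>"
proof (rule continuous_compact_support_L2[OF _ _ _ \<Omega>])
  have "Ck 0 \<phi>" using \<phi> unfolding test_functions_def by blast
  then show "continuous_on UNIV \<phi>" by simp
  show "compact (closure {x. \<phi> x \<noteq> 0})" using \<phi> by (simp add: test_functions_def)
  show "\<phi> x = 0" if "x \<notin> closure {x. \<phi> x \<noteq> 0}" for x
    using that closure_subset[of "{x. \<phi> x \<noteq> 0}"] by auto
qed

lemma grad_test_function_component_L2:
  assumes \<phi>: "\<phi> \<in> test_functions U" and \<Omega>: "\<Omega> \<in> sets lebesgue"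
  shows "(\<lambda>x. grad \<phi> x $ i) \<in> L2 \<Omega>"
proof (rule continuous_compact_support_L2[OF _ _ _ \<Omega>])
  let ?K = "closure {x. \<phi> x \<noteq> 0}"
  show "continuous_on UNIV (\<lambda>x. grad \<phi> x $ i)" using Ck_grad_test_function[OF \<phi>, of 0 i] by simp
  show "compact ?K" using \<phi> by (simp add: test_functions_def)
  \<comment> \<open>The closure matters: the gradient may be nonzero where \<phi> merely vanishes,
    but not on the open complement of its support.\<close>
  show "grad \<phi> x $ i = 0" if x: "x \<notin> ?K" for x
  proof -
    have "((\<lambda>x. 0) has_derivative (\<lambda>h. 0)) (at x)" by simp
    then have "(\<phi> has_derivative (\<lambda>h. 0)) (at x)"
    proof (rule has_derivative_transform_within_open[of _ _ _ _ "- ?K"])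
      show "open (- ?K)" by (simp add: open_Compl)
      show "x \<in> - ?K" using x by simp
      show "0 = \<phi> y" if "y \<in> - ?K" for y using that closure_subset[of "{x. \<phi> x \<noteq> 0}"] by auto
    qed
    then have "grad \<phi> x = 0" using grad_eqI[of \<phi> 0 x] by simp
    then show ?thesis by simp
  qed
qed

lemma grad_test_function_L2:
  "\<phi> \<in> test_functions U \<Longrightarrow> \<Omega> \<in> sets lebesgue \<Longrightarrow> grad \<phi> \<in> L2 \<Omega>"
  by (intro L2_vec grad_test_function_component_L2)

section \<open>Uniqueness of weak derivatives\<close>

text \<open>Boxes are an intersection-stable generator of the Borel sets, so by Dynkin's argument
  the integral vanishes over every Borel set. Complements refer to the integral over the whole
  space, which is not a box and thus a separate hypothesis. The passage to the Borel function
  \<open>h'\<close> brings the argument from Lebesgue to Borel sets.\<close>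

lemma integral_box_eq_0_imp_AE_eq_0:
  fixes h :: "'a::euclidean_space \<Rightarrow> real"
  assumes h: "integrable lebesgue h"
    and zero: "\<And>c d. (\<integral>x. indicator (box c d) x * h x \<partial>lebesgue) = 0"
    and UNIV_zero: "(\<integral>x. h x \<partial>lebesgue) = 0"
  shows "AE x in lebesgue. h x = 0"
proof -
  obtain h' where h': "h' \<in> borel_measurable lborel" "AE x in lborel. h x = h' x"
    using completion_ex_borel_measurable_real[of h lborel] h by auto
  note [measurable] = h'(1)
  have ae: "AE x in lebesgue. h x = h' x" using h'(2) by (rule AE_completion)
  have hm: "h' \<in> borel_measurable lebesgue" by (rule measurable_completion[OF h'(1)])
  have "integrable lebesgue h'"
    using h hm ae by (subst integrable_cong_AE[of h' _ h]) (auto elim: eventually_mono)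
  then have int: "integrable lborel h'" by (simp add: integrable_completion)
  have eq: "set_lebesgue_integral lborel A h' = (\<integral>x. indicator A x * h x \<partial>lebesgue)"
    if "A \<in> sets borel" for A
  proof -
    have Am [measurable]: "A \<in> sets lborel" using that by simp
    have Al: "A \<in> sets lebesgue" using that by auto
    have "set_lebesgue_integral lborel A h' = (\<integral>x. indicator A x * h' x \<partial>lebesgue)"
      unfolding set_lebesgue_integral_def by (subst integral_completion) auto
    also have "\<dots> = (\<integral>x. indicator A x * h x \<partial>lebesgue)"
    proof (rule integral_cong_AE)
      show "(\<lambda>x. indicator A x * h' x) \<in> borel_measurable lebesgue"
        using hm Al by (intro borel_measurable_times borel_measurable_indicator) auto
      show "(\<lambda>x. indicator A x * h x) \<in> borel_measurable lebesgue"
        using h Al by (intro borel_measurable_times borel_measurable_indicator) auto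
      show "AE x in lebesgue. indicator A x * h' x = indicator A x * h x"
        using ae by eventually_elim simp
    qed
    finally show ?thesis .
  qed
  have "AE x in lborel. h' x = 0"
  proof (rule sigma_finite_measure.density_zero[OF sigma_finite_lborel int])
    fix A :: "'a set" assume "A \<in> sets lborel"
    then have A: "A \<in> sigma_sets UNIV (range (\<lambda>(a, b). box a b))" by (simp add: borel_eq_box)
    have ibox: "Int_stable (range (\<lambda>(a, b). box a b :: 'a set))"
      unfolding Int_stable_def by (auto simp: box_Int_box)
    have sub: "range (\<lambda>(a, b). box a b :: 'a set) \<subseteq> Pow UNIV" by simp
    from A show "set_lebesgue_integral lborel A h' = 0"
    proof (induction rule: sigma_sets_induct_disjoint[OF ibox sub, consumes 1, case_names basic empty compl union])
      case (basic A)
      then obtain c d where "A = box c d" by auto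
      then show ?case using eq[of A] zero[of c d] by simp
    next
      case empty show ?case by (simp add: set_lebesgue_integral_def)
    next
      case (compl A)
      have A: "A \<in> sets borel" using compl(1) by (simp add: borel_eq_box)
      have i: "set_integrable lborel A h'" "set_integrable lborel (-A) h'"
        unfolding set_integrable_def using A by (auto intro!: integrable_mult_indicator int simp del: real_scaleR_def)
      have "set_lebesgue_integral lborel UNIV h' = 0"
        using eq[of UNIV] UNIV_zero by simp
      moreover have "set_lebesgue_integral lborel (A \<union> - A) h' =
          set_lebesgue_integral lborel A h' + set_lebesgue_integral lborel (- A) h'"
        by (rule set_integral_Un[OF _ i]) simp
      ultimately show ?case using compl(2) by (simp add: Compl_eq_Diff_UNIV[symmetric])
    next
      case (union A)
      have A: "A i \<in> sets lborel" for i using union(2) by (auto simp: borel_eq_box)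
      have "set_integrable lborel (\<Union>i. A i) h'"
        unfolding set_integrable_def using A int by (intro integrable_mult_indicator) auto
      from lebesgue_integral_countable_add[OF A _ this] show ?case
        using union(1,3) by (simp add: disjoint_family_on_def)
    qed
  qed
  then have "AE x in lebesgue. h' x = 0" by (rule AE_completion)
  then show ?thesis using ae by eventually_elim simp
qed

text \<open>Dominated convergence of bump functions gives \<open>q\<close> zero integral over open
  boxes whose closed box lies in \<Omega>. Truncated to one of these, \<open>q\<close> is integrable
  on the whole space and has zero integral over every box, hence vanishes there almost everywhere.
  Countably many closed boxes exhaust \<Omega>.\<close>

lemma fundamental_lemma_calculus_of_variations:
  fixes q :: "real^'d \<Rightarrow> real"
  assumes \<Omega>: "open \<Omega>" and q: "q \<in> L2 \<Omega>"
    and zero: "\<And>\<phi>. \<phi> \<in> test_functions \<Omega> \<Longrightarrow> (\<integral>x. q x * \<phi> x \<partial>lebesgue_on \<Omega>) = 0"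
  shows "AE x in lebesgue_on \<Omega>. q x = 0"
proof -
  have \<Omega>s: "\<Omega> \<in> sets lebesgue" using \<Omega> by auto
  have box_in: "box a b \<in> sets (lebesgue_on \<Omega>)" if "cbox a b \<subseteq> \<Omega>" for a b
    using that box_subset_cbox[of a b] \<Omega>s by (subst sets_restrict_space_iff) auto
  \<comment> \<open>\<Omega> may have infinite measure, where square integrability does not imply
    integrability; on a box the indicator is itself in \<open>L2\<close>.\<close>
  have box_int: "integrable (lebesgue_on \<Omega>) (\<lambda>x. indicator (box a b) x * q x)"
    if ab: "cbox a b \<subseteq> \<Omega>" for a b
  proof -
    have "integrable (lebesgue_on \<Omega>) (indicator (box a b) :: _ \<Rightarrow> real)"
      using box_in[OF ab] \<Omega>s ab box_subset_cbox[of a b]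
      by (intro integrable_real_indicator) (auto simp: emeasure_restrict_space emeasure_lborel_box_eq)
    then have "(indicator (box a b) :: _ \<Rightarrow> real) \<in> L2 \<Omega>"
      using box_in[OF ab] by (simp add: L2_def power2_eq_square flip: indicator_inter_arith)
    from L2_integrable_inner[OF this q] show ?thesis by simp
  qed
  have box_zero: "(\<integral>x. indicator (box a b) x * q x \<partial>lebesgue_on \<Omega>) = 0"
    if ab: "cbox a b \<subseteq> \<Omega>" for a b
  proof -
    let ?\<phi> = "\<lambda>n. box_bump a b (1 / real (Suc n))"
    have test: "?\<phi> n \<in> test_functions \<Omega>" for n using box_bump_test_function[OF _ ab] by simp
    have "(\<lambda>n. \<integral>x. q x * ?\<phi> n x \<partial>lebesgue_on \<Omega>) \<longlonglongrightarrow> (\<integral>x. indicator (box a b) x * q x \<partial>lebesgue_on \<Omega>)"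
    proof (rule integral_dominated_convergence)
      show "(\<lambda>x. indicator (box a b) x * q x) \<in> borel_measurable (lebesgue_on \<Omega>)"
        using box_int[OF ab] by simp
      show "(\<lambda>x. q x * ?\<phi> n x) \<in> borel_measurable (lebesgue_on \<Omega>)" for n
        using L2D(1)[OF q] L2D(1)[OF test_function_L2[OF test \<Omega>s]] by (intro borel_measurable_times) auto
      show "integrable (lebesgue_on \<Omega>) (\<lambda>x. norm (indicator (box a b) x * q x))"
        using box_int[OF ab] by (rule integrable_norm)
      show "AE x in lebesgue_on \<Omega>. (\<lambda>n. q x * ?\<phi> n x) \<longlonglongrightarrow> indicator (box a b) x * q x"
      proof (rule AE_I2)
        fix x show "(\<lambda>n. q x * ?\<phi> n x) \<longlonglongrightarrow> indicator (box a b) x * q x"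
          using tendsto_mult[OF tendsto_const box_bump_tendsto_indicator, of "q x" a b x]
          by (simp add: mult.commute)
      qed
      show "AE x in lebesgue_on \<Omega>. norm (q x * ?\<phi> n x) \<le> norm (indicator (box a b) x * q x)" for n
      proof (rule AE_I2)
        fix x
        show "norm (q x * ?\<phi> n x) \<le> norm (indicator (box a b) x * q x)"
        proof (cases "x \<in> box a b")
          case True
          have "\<bar>q x\<bar> * \<bar>?\<phi> n x\<bar> \<le> \<bar>q x\<bar> * 1"
            using box_bump_bounds[of "1 / real (Suc n)" a b x] by (intro mult_left_mono) auto
          then show ?thesis using True by (simp add: abs_mult)
        next
          case False
          then have "?\<phi> n x = 0" using box_bump_nonzero_iff by blast
          then show ?thesis by simp
        qed
      qed
    qed
    then show ?thesis using zero[OF test] by (simp add: LIMSEQ_const_iff)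
  qed
  have ae_box: "AE x in lebesgue. x \<in> box a b \<longrightarrow> q x = 0" if ab: "cbox a b \<subseteq> \<Omega>" for a b
  proof -
    have to_UNIV: "(\<integral>x. indicator (box c d) x * q x \<partial>lebesgue_on \<Omega>) = (\<integral>x. indicator (box c d) x * q x \<partial>lebesgue)"
      if "box c d \<subseteq> \<Omega>" for c d
      using \<Omega>s that by (subst integral_restrict_space) (auto intro!: Bochner_Integration.integral_cong simp: indicator_def)
    have "integrable lebesgue (\<lambda>x. indicator \<Omega> x *\<^sub>R (indicator (box a b) x * q x))"
      using box_int[OF ab] \<Omega>s by (subst (asm) integrable_restrict_space) auto
    moreover have "(\<lambda>x. indicator \<Omega> x *\<^sub>R (indicator (box a b) x * q x)) = (\<lambda>x. indicator (box a b) x * q x)"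
      using ab box_subset_cbox[of a b] by (auto simp: fun_eq_iff indicator_def)
    ultimately have int: "integrable lebesgue (\<lambda>x. indicator (box a b) x * q x)" by simp
    have box_sub: "box a b \<subseteq> \<Omega>" using ab box_subset_cbox[of a b] by blast
    have "AE x in lebesgue. indicator (box a b) x * q x = 0"
    proof (rule integral_box_eq_0_imp_AE_eq_0[OF int])
      show "(\<integral>x. indicator (box a b) x * q x \<partial>lebesgue) = 0"
        using to_UNIV[OF box_sub] box_zero[OF ab] by simp
      fix c d :: "real^'d"
      obtain u v where uv: "box c d \<inter> box a b = box u v" using box_Int_box by blast
      have "(\<integral>x. indicator (box u v) x * q x \<partial>lebesgue) = 0"
      \<comment> \<open>The closed box is the closure of the open one only if the latter is
        nonempty; an empty box contributes nothing.\<close>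
      proof (cases "box u v = {}")
        case False
        have sub: "box u v \<subseteq> box a b" using uv by blast
        have "cbox u v = closure (box u v)" using False by (simp add: closure_box)
        also have "\<dots> \<subseteq> cbox a b"
          using sub box_subset_cbox[of a b] by (intro closure_minimal closed_cbox) auto
        finally have "cbox u v \<subseteq> \<Omega>" using ab by blast
        then show ?thesis using to_UNIV[of u v] sub box_sub box_zero by auto
      qed simp
      then show "(\<integral>x. indicator (box c d) x * (indicator (box a b) x * q x) \<partial>lebesgue) = 0"
        by (simp add: uv[symmetric] indicator_inter_arith mult.assoc)
    qed
    then show ?thesis by eventually_elim (auto simp: indicator_def)
  qed
  obtain \<D> where \<D>: "countable \<D>" "\<D> \<subseteq> Pow \<Omega>" "\<And>X. X \<in> \<D> \<Longrightarrow> \<exists>a b. X = cbox a b" "\<Union>\<D> = \<Omega>"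
    using open_countable_Union_open_cbox[OF \<Omega>] by metis
  have "AE x in lebesgue. \<forall>X\<in>\<D>. x \<in> X \<longrightarrow> q x = 0"
  proof (rule AE_ball_countable'[OF _ \<D>(1)])
    fix X assume X: "X \<in> \<D>"
    then obtain a b where ab: "X = cbox a b" using \<D>(3) by blast
    then have "AE x in lebesgue. x \<in> box a b \<longrightarrow> q x = 0" using ae_box X \<D>(2) by blast
    \<comment> \<open>The covering consists of closed boxes, the vanishing was shown on open ones;
      the faces are negligible.\<close>
    moreover have "AE x in lebesgue. x \<notin> cbox a b - box a b"
      using negligible_frontier_interval[of a b] by (intro AE_not_in) (simp add: negligible_iff_null_sets)
    ultimately show "AE x in lebesgue. x \<in> X \<longrightarrow> q x = 0"
      unfolding ab by eventually_elim auto
  qed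
  then have "AE x in lebesgue. x \<in> \<Omega> \<longrightarrow> q x = 0"
    by eventually_elim (use \<D>(4) in blast)
  then show ?thesis using \<Omega>s by (subst AE_restrict_space_iff) auto
qed

section \<open>Weak gradients and divergences up to null sets\<close>

lemma L2_component: "f \<in> L2 \<Omega> \<Longrightarrow> (\<lambda>x. f x $ i) \<in> L2 \<Omega>"
  by (rule L2_linear_image[OF bounded_linear_vec_nth])

lemma is_weak_gradD:
  assumes "is_weak_grad \<Omega> u g"
  shows "g \<in> L2 \<Omega>"
    "\<phi> \<in> test_functions \<Omega> \<Longrightarrow> (\<integral>x. u x * grad \<phi> x $ i \<partial>lebesgue_on \<Omega>) = - (\<integral>x. g x $ i * \<phi> x \<partial>lebesgue_on \<Omega>)"
  using assms by (auto simp: is_weak_grad_def)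

lemma is_weak_divD:
  assumes "is_weak_div \<Omega> D q"
  shows "q \<in> L2 \<Omega>"
    "\<phi> \<in> test_functions \<Omega> \<Longrightarrow> (\<integral>x. D x \<bullet> grad \<phi> x \<partial>lebesgue_on \<Omega>) = - (\<integral>x. q x * \<phi> x \<partial>lebesgue_on \<Omega>)"
  using assms by (auto simp: is_weak_div_def)

lemma L2_mult_test_function_integrable:
  assumes "q \<in> L2 \<Omega>" "\<phi> \<in> test_functions U" "open \<Omega>"
  shows "integrable (lebesgue_on \<Omega>) (\<lambda>x. q x * \<phi> x)"
  using L2_integrable_inner[OF assms(1) test_function_L2[OF assms(2)]] assms(3) by simp

lemma is_weak_grad_unique:
  assumes \<Omega>: "open \<Omega>" and g: "is_weak_grad \<Omega> u g" and h: "is_weak_grad \<Omega> u h"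
  shows "AE x in lebesgue_on \<Omega>. g x = h x"
proof -
  note gL = L2_component[OF is_weak_gradD(1)[OF g]] and hL = L2_component[OF is_weak_gradD(1)[OF h]]
  have "AE x in lebesgue_on \<Omega>. g x $ i - h x $ i = 0" for i
  proof (rule fundamental_lemma_calculus_of_variations[OF \<Omega> L2_diff[OF gL hL]])
    fix \<phi> assume \<phi>: "\<phi> \<in> test_functions \<Omega>"
    show "(\<integral>x. (g x $ i - h x $ i) * \<phi> x \<partial>lebesgue_on \<Omega>) = 0"
      using is_weak_gradD(2)[OF g \<phi>, of i] is_weak_gradD(2)[OF h \<phi>, of i]
        L2_mult_test_function_integrable[OF gL \<phi> \<Omega>, of i] L2_mult_test_function_integrable[OF hL \<phi> \<Omega>, of i]
      by (simp add: left_diff_distrib)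
  qed
  then have "AE x in lebesgue_on \<Omega>. \<forall>i\<in>UNIV. g x $ i - h x $ i = 0"
    by (intro AE_finite_allI) auto
  then show ?thesis by eventually_elim (simp add: vec_eq_iff)
qed

lemma is_weak_div_unique:
  assumes \<Omega>: "open \<Omega>" and g: "is_weak_div \<Omega> D p" and h: "is_weak_div \<Omega> D q"
  shows "AE x in lebesgue_on \<Omega>. p x = q x"
proof -
  note gL = is_weak_divD(1)[OF g] and hL = is_weak_divD(1)[OF h]
  have "AE x in lebesgue_on \<Omega>. p x - q x = 0"
  proof (rule fundamental_lemma_calculus_of_variations[OF \<Omega> L2_diff[OF gL hL]])
    fix \<phi> assume \<phi>: "\<phi> \<in> test_functions \<Omega>"
    show "(\<integral>x. (p x - q x) * \<phi> x \<partial>lebesgue_on \<Omega>) = 0"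
      using is_weak_divD(2)[OF g \<phi>] is_weak_divD(2)[OF h \<phi>]
        L2_mult_test_function_integrable[OF gL \<phi> \<Omega>] L2_mult_test_function_integrable[OF hL \<phi> \<Omega>]
      by (simp add: left_diff_distrib)
  qed
  then show ?thesis by eventually_elim simp
qed

lemma is_weak_grad_weak_grad: "u \<in> H1 \<Omega> \<Longrightarrow> is_weak_grad \<Omega> u (weak_grad \<Omega> u)"
  unfolding H1_def weak_grad_def using someI_ex[of "is_weak_grad \<Omega> u"] by blast

lemma is_weak_div_weak_div: "D \<in> Hdiv \<Omega> \<Longrightarrow> is_weak_div \<Omega> D (weak_div \<Omega> D)"
  unfolding Hdiv_def weak_div_def using someI_ex[of "is_weak_div \<Omega> D"] by blast

lemma H1_L2: "u \<in> H1 \<Omega> \<Longrightarrow> u \<in> L2 \<Omega>" and weak_grad_L2: "u \<in> H1 \<Omega> \<Longrightarrow> weak_grad \<Omega> u \<in> L2 \<Omega>"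
  using is_weak_gradD(1)[OF is_weak_grad_weak_grad] by (auto simp: H1_def)

lemma Hdiv_L2: "D \<in> Hdiv \<Omega> \<Longrightarrow> D \<in> L2 \<Omega>" and weak_div_L2: "D \<in> Hdiv \<Omega> \<Longrightarrow> weak_div \<Omega> D \<in> L2 \<Omega>"
  using is_weak_divD(1)[OF is_weak_div_weak_div] by (auto simp: Hdiv_def)

text \<open>This is how the choice made by \<open>SOME\<close> is controlled: exhibiting any weak
  gradient determines the chosen one almost everywhere.\<close>

lemma weak_grad_eqI:
  "open \<Omega> \<Longrightarrow> is_weak_grad \<Omega> u g \<Longrightarrow> AE x in lebesgue_on \<Omega>. weak_grad \<Omega> u x = g x"
  unfolding weak_grad_def by (rule is_weak_grad_unique[OF _ someI[of "is_weak_grad \<Omega> u"]])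

lemma weak_div_eqI:
  "open \<Omega> \<Longrightarrow> is_weak_div \<Omega> D q \<Longrightarrow> AE x in lebesgue_on \<Omega>. weak_div \<Omega> D x = q x"
  unfolding weak_div_def by (rule is_weak_div_unique[OF _ someI[of "is_weak_div \<Omega> D"]])

text \<open>The form \<open>u + c * v\<close> treats addition and scaling together; here and below,
  sums are the case \<open>c = 1\<close>, differences \<open>c = -1\<close>, and multiples the case
  of first summand \<open>0\<close>.\<close>

lemma is_weak_grad_add_scaleR:
  assumes \<Omega>: "open \<Omega>" and u: "u \<in> H1 \<Omega>" and v: "v \<in> H1 \<Omega>"
  shows "is_weak_grad \<Omega> (\<lambda>x. u x + c * v x) (\<lambda>x. weak_grad \<Omega> u x + c *\<^sub>R weak_grad \<Omega> v x)"
  unfolding is_weak_grad_def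
proof (intro conjI ballI allI)
  note gu = is_weak_grad_weak_grad[OF u] and gv = is_weak_grad_weak_grad[OF v]
  show "(\<lambda>x. weak_grad \<Omega> u x + c *\<^sub>R weak_grad \<Omega> v x) \<in> L2 \<Omega>"
    by (intro L2_add L2_scaleR weak_grad_L2 u v)
  fix \<phi> i assume \<phi>: "\<phi> \<in> test_functions \<Omega>"
  have \<Omega>s: "\<Omega> \<in> sets lebesgue" using \<Omega> by auto
  note I = L2_integrable_inner[OF _ grad_test_function_component_L2[OF \<phi> \<Omega>s, of i]]
  note J = L2_mult_test_function_integrable[OF L2_component[OF weak_grad_L2] \<phi> \<Omega>]
  have "(\<integral>x. (u x + c * v x) * grad \<phi> x $ i \<partial>lebesgue_on \<Omega>) =
      (\<integral>x. u x * grad \<phi> x $ i \<partial>lebesgue_on \<Omega>) + c * (\<integral>x. v x * grad \<phi> x $ i \<partial>lebesgue_on \<Omega>)"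
    using I[OF H1_L2[OF u]] I[OF H1_L2[OF v]] by (simp add: distrib_right mult.assoc)
  also have "\<dots> = - (\<integral>x. (weak_grad \<Omega> u x + c *\<^sub>R weak_grad \<Omega> v x) $ i * \<phi> x \<partial>lebesgue_on \<Omega>)"
    using J[OF u, of i] J[OF v, of i]
    by (simp add: is_weak_gradD(2)[OF gu \<phi>] is_weak_gradD(2)[OF gv \<phi>] distrib_right mult.assoc)
  finally show "(\<integral>x. (u x + c * v x) * grad \<phi> x $ i \<partial>lebesgue_on \<Omega>) =
      - (\<integral>x. (weak_grad \<Omega> u x + c *\<^sub>R weak_grad \<Omega> v x) $ i * \<phi> x \<partial>lebesgue_on \<Omega>)" .
qed

lemma is_weak_div_add_scaleR:
  assumes \<Omega>: "open \<Omega>" and D: "D \<in> Hdiv \<Omega>" and E: "E \<in> Hdiv \<Omega>"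
  shows "is_weak_div \<Omega> (\<lambda>x. D x + c *\<^sub>R E x) (\<lambda>x. weak_div \<Omega> D x + c * weak_div \<Omega> E x)"
  unfolding is_weak_div_def
proof (intro conjI ballI allI)
  note gD = is_weak_div_weak_div[OF D] and gE = is_weak_div_weak_div[OF E]
  show "(\<lambda>x. weak_div \<Omega> D x + c * weak_div \<Omega> E x) \<in> L2 \<Omega>"
    using L2_add[OF weak_div_L2[OF D] L2_scaleR[OF weak_div_L2[OF E], of c]] by simp
  fix \<phi> assume \<phi>: "\<phi> \<in> test_functions \<Omega>"
  have \<Omega>s: "\<Omega> \<in> sets lebesgue" using \<Omega> by auto
  note I = L2_integrable_inner[OF _ grad_test_function_L2[OF \<phi> \<Omega>s]]
  note J = L2_mult_test_function_integrable[OF weak_div_L2 \<phi> \<Omega>]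
  have "(\<integral>x. (D x + c *\<^sub>R E x) \<bullet> grad \<phi> x \<partial>lebesgue_on \<Omega>) =
      (\<integral>x. D x \<bullet> grad \<phi> x \<partial>lebesgue_on \<Omega>) + c * (\<integral>x. E x \<bullet> grad \<phi> x \<partial>lebesgue_on \<Omega>)"
    using I[OF Hdiv_L2[OF D]] I[OF Hdiv_L2[OF E]] by (simp add: inner_add_left)
  also have "\<dots> = - (\<integral>x. (weak_div \<Omega> D x + c * weak_div \<Omega> E x) * \<phi> x \<partial>lebesgue_on \<Omega>)"
    using J[OF D] J[OF E]
    by (simp add: is_weak_divD(2)[OF gD \<phi>] is_weak_divD(2)[OF gE \<phi>] distrib_right mult.assoc)
  finally show "(\<integral>x. (D x + c *\<^sub>R E x) \<bullet> grad \<phi> x \<partial>lebesgue_on \<Omega>) =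
      - (\<integral>x. (weak_div \<Omega> D x + c * weak_div \<Omega> E x) * \<phi> x \<partial>lebesgue_on \<Omega>)" .
qed

section \<open>Traces and limits\<close>

lemma sets_surface_measure [measurable_cong]: "sets surface_measure = sets borel"
  unfolding surface_measure_def by (subst sets_measure_of) (auto simp: sets.sigma_sets_eq[of borel, simplified])

lemma L2_tendsto_linear_image:
  assumes T: "bounded_linear T" and f: "\<And>n. f n \<in> L2 \<Omega>" "f' \<in> L2 \<Omega>"
    and lim: "(\<lambda>n. L2_norm \<Omega> (\<lambda>x. f n x - f' x)) \<longlonglongrightarrow> 0"
  shows "(\<lambda>n. L2_norm \<Omega> (\<lambda>x. T (f n x) - T (f' x))) \<longlonglongrightarrow> 0"
proof -
  obtain K where K: "K > 0" "\<And>y. norm (T y) \<le> norm y * K" using bounded_linear.pos_bounded[OF T] by blast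
  have eq: "T (f n x) - T (f' x) = T (f n x - f' x)" for n x
    by (simp add: linear_diff[OF bounded_linear.linear[OF T]])
  have "L2_norm \<Omega> (\<lambda>x. T (f n x - f' x)) \<le> K * L2_norm \<Omega> (\<lambda>x. f n x - f' x)" for n
  proof -
    have d: "(\<lambda>x. f n x - f' x) \<in> L2 \<Omega>" by (rule L2_diff[OF f])
    have "L2_norm \<Omega> (\<lambda>x. T (f n x - f' x)) \<le> L2_norm \<Omega> (\<lambda>x. K *\<^sub>R (f n x - f' x))"
      using K by (intro L2_mono(2)[OF L2D(1)[OF L2_linear_image[OF T d]] L2_scaleR[OF d]])
        (simp add: mult.commute)
    then show ?thesis using K(1) by (simp add: L2_norm_scaleR)
  qed
  then have "\<forall>n. norm (L2_norm \<Omega> (\<lambda>x. T (f n x) - T (f' x))) \<le> K * L2_norm \<Omega> (\<lambda>x. f n x - f' x)"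
    by (simp add: eq L2_norm_nonneg)
  from Lim_null_comparison[OF always_eventually[OF this] tendsto_mult_right_zero[OF lim]]
  show ?thesis .
qed

text \<open>The distance from a null function to the limit is the norm of the limit, so a constant
  sequence tends to zero. This carries the divergence constraint and the symmetry constraint over to
  limits.\<close>

lemma L2_limit_AE_zero:
  assumes f: "\<And>n. f n \<in> L2 \<Omega>" "f' \<in> L2 \<Omega>" and lim: "(\<lambda>n. L2_norm \<Omega> (\<lambda>x. f n x - f' x)) \<longlonglongrightarrow> 0"
    and zero: "\<And>n. AE x in lebesgue_on \<Omega>. f n x = 0"
  shows "AE x in lebesgue_on \<Omega>. f' x = 0"
proof -
  have "L2_norm \<Omega> (\<lambda>x. f n x - f' x) = L2_norm \<Omega> f'" for n
  proof -
    have "L2_norm \<Omega> (\<lambda>x. f n x - f' x) = L2_norm \<Omega> (\<lambda>x. -1 *\<^sub>R f' x)"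
    proof (rule L2_norm_cong_AE[OF L2D(1)[OF L2_diff[OF f]] L2D(1)[OF L2_scaleR[OF f(2)]]])
      show "AE x in lebesgue_on \<Omega>. f n x - f' x = -1 *\<^sub>R f' x"
        using zero[of n] by eventually_elim simp
    qed
    then show ?thesis using L2_norm_scaleR[of \<Omega> "-1" f'] by simp
  qed
  then have "L2_norm \<Omega> f' = 0" using lim by (simp add: LIMSEQ_const_iff)
  then show ?thesis using L2_norm_eq_0_iff[OF f(2)] by simp
qed

lemma L2_norm_triangle_diff:
  assumes "f \<in> L2 \<Omega>" "g \<in> L2 \<Omega>" "h \<in> L2 \<Omega>"
  shows "L2_norm \<Omega> (\<lambda>x. f x - h x) \<le> L2_norm \<Omega> (\<lambda>x. f x - g x) + L2_norm \<Omega> (\<lambda>x. g x - h x)"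
  using L2_norm_triangle[OF L2_diff[OF assms(1,2)] L2_diff[OF assms(2,3)]] by simp

text \<open>For a fixed test function both sides of the defining identity are continuous in
  \<open>L2\<close>: the weak gradient is a closed operator.\<close>

lemma is_weak_grad_limit:
  assumes \<Omega>: "open \<Omega>" and w: "\<And>n. is_weak_grad \<Omega> (u n) (g n)"
    and u: "\<And>n. u n \<in> L2 \<Omega>" "u' \<in> L2 \<Omega>" and g': "g' \<in> L2 \<Omega>"
    and ulim: "(\<lambda>n. L2_norm \<Omega> (\<lambda>x. u n x - u' x)) \<longlonglongrightarrow> 0"
    and glim: "(\<lambda>n. L2_norm \<Omega> (\<lambda>x. g n x - g' x)) \<longlonglongrightarrow> 0"
  shows "is_weak_grad \<Omega> u' g'"
  unfolding is_weak_grad_def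
proof (intro conjI ballI allI g')
  fix \<phi> i assume \<phi>: "\<phi> \<in> test_functions \<Omega>"
  have \<Omega>s: "\<Omega> \<in> sets lebesgue" using \<Omega> by auto
  note gL = is_weak_gradD(1)[OF w]
  have 1: "(\<lambda>n. \<integral>x. u n x * grad \<phi> x $ i \<partial>lebesgue_on \<Omega>) \<longlonglongrightarrow> (\<integral>x. u' x * grad \<phi> x $ i \<partial>lebesgue_on \<Omega>)"
    using L2_integral_inner_tendsto[OF u grad_test_function_component_L2[OF \<phi> \<Omega>s, of i] ulim] by simp
  have "(\<lambda>n. L2_norm \<Omega> (\<lambda>x. g n x $ i - g' x $ i)) \<longlonglongrightarrow> 0"
    by (rule L2_tendsto_linear_image[OF bounded_linear_vec_nth gL g' glim])
  from L2_integral_inner_tendsto[OF L2_component[OF gL] L2_component[OF g'] test_function_L2[OF \<phi> \<Omega>s] this]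
  have "(\<lambda>n. - (\<integral>x. g n x $ i * \<phi> x \<partial>lebesgue_on \<Omega>)) \<longlonglongrightarrow> - (\<integral>x. g' x $ i * \<phi> x \<partial>lebesgue_on \<Omega>)"
    by (simp add: tendsto_minus)
  then have "(\<lambda>n. \<integral>x. u n x * grad \<phi> x $ i \<partial>lebesgue_on \<Omega>) \<longlonglongrightarrow> - (\<integral>x. g' x $ i * \<phi> x \<partial>lebesgue_on \<Omega>)"
    by (simp add: is_weak_gradD(2)[OF w \<phi>])
  then show "(\<integral>x. u' x * grad \<phi> x $ i \<partial>lebesgue_on \<Omega>) = - (\<integral>x. g' x $ i * \<phi> x \<partial>lebesgue_on \<Omega>)"
    using 1 LIMSEQ_unique by blast
qed

lemma is_weak_div_limit:
  assumes \<Omega>: "open \<Omega>" and w: "\<And>n. is_weak_div \<Omega> (u n) (g n)"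
    and u: "\<And>n. u n \<in> L2 \<Omega>" "u' \<in> L2 \<Omega>" and g': "g' \<in> L2 \<Omega>"
    and ulim: "(\<lambda>n. L2_norm \<Omega> (\<lambda>x. u n x - u' x)) \<longlonglongrightarrow> 0"
    and glim: "(\<lambda>n. L2_norm \<Omega> (\<lambda>x. g n x - g' x)) \<longlonglongrightarrow> 0"
  shows "is_weak_div \<Omega> u' g'"
  unfolding is_weak_div_def
proof (intro conjI ballI allI g')
  fix \<phi> assume \<phi>: "\<phi> \<in> test_functions \<Omega>"
  have \<Omega>s: "\<Omega> \<in> sets lebesgue" using \<Omega> by auto
  note gL = is_weak_divD(1)[OF w]
  have 1: "(\<lambda>n. \<integral>x. u n x \<bullet> grad \<phi> x \<partial>lebesgue_on \<Omega>) \<longlonglongrightarrow> (\<integral>x. u' x \<bullet> grad \<phi> x \<partial>lebesgue_on \<Omega>)"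
    using L2_integral_inner_tendsto[OF u grad_test_function_L2[OF \<phi> \<Omega>s] ulim] by simp
  from L2_integral_inner_tendsto[OF gL g' test_function_L2[OF \<phi> \<Omega>s] glim]
  have "(\<lambda>n. - (\<integral>x. g n x * \<phi> x \<partial>lebesgue_on \<Omega>)) \<longlonglongrightarrow> - (\<integral>x. g' x * \<phi> x \<partial>lebesgue_on \<Omega>)"
    by (simp add: tendsto_minus)
  then have "(\<lambda>n. \<integral>x. u n x \<bullet> grad \<phi> x \<partial>lebesgue_on \<Omega>) \<longlonglongrightarrow> - (\<integral>x. g' x * \<phi> x \<partial>lebesgue_on \<Omega>)"
    by (simp add: is_weak_divD(2)[OF w \<phi>])
  then show "(\<integral>x. u' x \<bullet> grad \<phi> x \<partial>lebesgue_on \<Omega>) = - (\<integral>x. g' x * \<phi> x \<partial>lebesgue_on \<Omega>)"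
    using 1 LIMSEQ_unique by blast
qed

lemma H1_add_scaleR:
  assumes "open \<Omega>" "u \<in> H1 \<Omega>" "v \<in> H1 \<Omega>"
  shows "(\<lambda>x. u x + c * v x) \<in> H1 \<Omega>"
  using is_weak_grad_add_scaleR[OF assms, of c] L2_add[OF H1_L2[OF assms(2)] L2_scaleR[OF H1_L2[OF assms(3)], of c]]
  by (auto simp: H1_def)

lemma Hdiv_add_scaleR:
  assumes "open \<Omega>" "D \<in> Hdiv \<Omega>" "E \<in> Hdiv \<Omega>"
  shows "(\<lambda>x. D x + c *\<^sub>R E x) \<in> Hdiv \<Omega>"
  using is_weak_div_add_scaleR[OF assms, of c] L2_add[OF Hdiv_L2[OF assms(2)] L2_scaleR[OF Hdiv_L2[OF assms(3)], of c]]
  by (auto simp: Hdiv_def)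

lemma weak_grad_add_scaleR:
  assumes "open \<Omega>" "u \<in> H1 \<Omega>" "v \<in> H1 \<Omega>"
  shows "AE x in lebesgue_on \<Omega>. weak_grad \<Omega> (\<lambda>x. u x + c * v x) x = weak_grad \<Omega> u x + c *\<^sub>R weak_grad \<Omega> v x"
  by (rule weak_grad_eqI[OF assms(1) is_weak_grad_add_scaleR[OF assms]])

lemma weak_div_add_scaleR:
  assumes "open \<Omega>" "D \<in> Hdiv \<Omega>" "E \<in> Hdiv \<Omega>"
  shows "AE x in lebesgue_on \<Omega>. weak_div \<Omega> (\<lambda>x. D x + c *\<^sub>R E x) x = weak_div \<Omega> D x + c * weak_div \<Omega> E x"
  by (rule weak_div_eqI[OF assms(1) is_weak_div_add_scaleR[OF assms]])

lemma L2_norm_add_scaleR_le: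
  assumes "f \<in> L2 \<Omega>" "g \<in> L2 \<Omega>"
  shows "L2_norm \<Omega> (\<lambda>x. f x + c *\<^sub>R g x) \<le> L2_norm \<Omega> f + \<bar>c\<bar> * L2_norm \<Omega> g"
  using L2_norm_triangle[OF assms(1) L2_scaleR[OF assms(2), of c]] by (simp add: L2_norm_scaleR)

lemma zero_trace_on_add_scaleR:
  assumes \<Omega>: "open \<Omega>" and \<Gamma>: "\<Gamma> \<in> sets borel" and u: "u \<in> H1 \<Omega>" and v: "v \<in> H1 \<Omega>"
    and zu: "zero_trace_on \<Omega> \<Gamma> u" and zv: "zero_trace_on \<Omega> \<Gamma> v"
  shows "zero_trace_on \<Omega> \<Gamma> (\<lambda>x. u x + c * v x)"
proof -
  have \<Omega>s: "\<Omega> \<in> sets lebesgue" using \<Omega> by auto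
  obtain \<phi> where \<phi>: "\<And>k. \<phi> k \<in> test_functions UNIV"
    "(\<lambda>k. L2_norm \<Omega> (\<lambda>x. u x - \<phi> k x)) \<longlonglongrightarrow> 0"
    "(\<lambda>k. L2_norm \<Omega> (\<lambda>x. weak_grad \<Omega> u x - grad (\<phi> k) x)) \<longlonglongrightarrow> 0"
    "(\<lambda>k. \<integral>\<^sup>+x\<in>\<Gamma>. ennreal ((\<phi> k x)\<^sup>2) \<partial>surface_measure) \<longlonglongrightarrow> 0"
    using zu unfolding zero_trace_on_def by auto
  obtain \<psi> where \<psi>: "\<And>k. \<psi> k \<in> test_functions UNIV"
    "(\<lambda>k. L2_norm \<Omega> (\<lambda>x. v x - \<psi> k x)) \<longlonglongrightarrow> 0"
    "(\<lambda>k. L2_norm \<Omega> (\<lambda>x. weak_grad \<Omega> v x - grad (\<psi> k) x)) \<longlonglongrightarrow> 0"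
    "(\<lambda>k. \<integral>\<^sup>+x\<in>\<Gamma>. ennreal ((\<psi> k x)\<^sup>2) \<partial>surface_measure) \<longlonglongrightarrow> 0"
    using zv unfolding zero_trace_on_def by auto
  let ?\<chi> = "\<lambda>k x. \<phi> k x + c * \<psi> k x"
  have lim0: "(\<lambda>k. a k + \<bar>c\<bar> * b k) \<longlonglongrightarrow> 0" if "a \<longlonglongrightarrow> 0" "b \<longlonglongrightarrow> 0" for a b :: "nat \<Rightarrow> real"
    using tendsto_add[OF that(1) tendsto_mult_right_zero[OF that(2), of "\<bar>c\<bar>"]] by simp
  have 1: "(\<lambda>k. L2_norm \<Omega> (\<lambda>x. u x + c * v x - ?\<chi> k x)) \<longlonglongrightarrow> 0"
  proof (rule Lim_null_comparison[OF always_eventually[OF allI] lim0[OF \<phi>(2) \<psi>(2)]])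
    fix k
    have "L2_norm \<Omega> (\<lambda>x. (u x - \<phi> k x) + c *\<^sub>R (v x - \<psi> k x)) \<le>
        L2_norm \<Omega> (\<lambda>x. u x - \<phi> k x) + \<bar>c\<bar> * L2_norm \<Omega> (\<lambda>x. v x - \<psi> k x)"
      by (rule L2_norm_add_scaleR_le[OF L2_diff[OF H1_L2[OF u] test_function_L2[OF \<phi>(1) \<Omega>s]]
            L2_diff[OF H1_L2[OF v] test_function_L2[OF \<psi>(1) \<Omega>s]]])
    also have "(\<lambda>x. (u x - \<phi> k x) + c *\<^sub>R (v x - \<psi> k x)) = (\<lambda>x. u x + c * v x - ?\<chi> k x)"
      by (simp add: fun_eq_iff algebra_simps)
    finally show "norm (L2_norm \<Omega> (\<lambda>x. u x + c * v x - ?\<chi> k x)) \<le>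
        L2_norm \<Omega> (\<lambda>x. u x - \<phi> k x) + \<bar>c\<bar> * L2_norm \<Omega> (\<lambda>x. v x - \<psi> k x)"
      by (simp add: L2_norm_nonneg)
  qed
  have 2: "(\<lambda>k. L2_norm \<Omega> (\<lambda>x. weak_grad \<Omega> (\<lambda>x. u x + c * v x) x - grad (?\<chi> k) x)) \<longlonglongrightarrow> 0"
  proof (rule Lim_null_comparison[OF always_eventually[OF allI] lim0[OF \<phi>(3) \<psi>(3)]])
    fix k
    note du = L2_diff[OF weak_grad_L2[OF u] grad_test_function_L2[OF \<phi>(1) \<Omega>s, of k]]
    note dv = L2_diff[OF weak_grad_L2[OF v] grad_test_function_L2[OF \<psi>(1) \<Omega>s, of k]]
    have \<chi>: "?\<chi> k \<in> test_functions UNIV" by (intro test_functions_add test_functions_cmult \<phi> \<psi>)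
    have "L2_norm \<Omega> (\<lambda>x. weak_grad \<Omega> (\<lambda>x. u x + c * v x) x - grad (?\<chi> k) x) =
        L2_norm \<Omega> (\<lambda>x. (weak_grad \<Omega> u x - grad (\<phi> k) x) + c *\<^sub>R (weak_grad \<Omega> v x - grad (\<psi> k) x))"
    proof (rule L2_norm_cong_AE)
      show "AE x in lebesgue_on \<Omega>. weak_grad \<Omega> (\<lambda>x. u x + c * v x) x - grad (?\<chi> k) x =
          (weak_grad \<Omega> u x - grad (\<phi> k) x) + c *\<^sub>R (weak_grad \<Omega> v x - grad (\<psi> k) x)"
        using weak_grad_add_scaleR[OF \<Omega> u v, of c]
        by eventually_elim (simp add: grad_test_function_add[OF \<phi>(1) test_functions_cmult[OF \<psi>(1)]]
          grad_test_function_cmult[OF \<psi>(1)] algebra_simps)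
      show "(\<lambda>x. weak_grad \<Omega> (\<lambda>x. u x + c * v x) x - grad (?\<chi> k) x) \<in> borel_measurable (lebesgue_on \<Omega>)"
        by (intro L2D(1)[OF L2_diff] weak_grad_L2 H1_add_scaleR \<Omega> u v grad_test_function_L2[OF \<chi> \<Omega>s])
      show "(\<lambda>x. (weak_grad \<Omega> u x - grad (\<phi> k) x) + c *\<^sub>R (weak_grad \<Omega> v x - grad (\<psi> k) x)) \<in> borel_measurable (lebesgue_on \<Omega>)"
        by (intro L2D(1)[OF L2_add] L2_scaleR du dv)
    qed
    also have "\<dots> \<le> L2_norm \<Omega> (\<lambda>x. weak_grad \<Omega> u x - grad (\<phi> k) x) + \<bar>c\<bar> * L2_norm \<Omega> (\<lambda>x. weak_grad \<Omega> v x - grad (\<psi> k) x)"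
      by (rule L2_norm_add_scaleR_le[OF du dv])
    finally show "norm (L2_norm \<Omega> (\<lambda>x. weak_grad \<Omega> (\<lambda>x. u x + c * v x) x - grad (?\<chi> k) x)) \<le>
        L2_norm \<Omega> (\<lambda>x. weak_grad \<Omega> u x - grad (\<phi> k) x) + \<bar>c\<bar> * L2_norm \<Omega> (\<lambda>x. weak_grad \<Omega> v x - grad (\<psi> k) x)"
      by (simp add: L2_norm_nonneg)
  qed
  \<comment> \<open>The boundary integrals take values in \<open>ennreal\<close>; instead of a
    triangle inequality, \<open>(a + b)\<^sup>2 \<le> 2 * a\<^sup>2 + 2 * b\<^sup>2\<close> is used
    under the integral.\<close>
  have 3: "(\<lambda>k. \<integral>\<^sup>+x\<in>\<Gamma>. ennreal ((?\<chi> k x)\<^sup>2) \<partial>surface_measure) \<longlonglongrightarrow> 0"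
  proof (rule tendsto_sandwich[OF always_eventually[OF allI] always_eventually[OF allI] tendsto_const])
    let ?a = "\<lambda>k. \<integral>\<^sup>+x\<in>\<Gamma>. ennreal ((\<phi> k x)\<^sup>2) \<partial>surface_measure"
    let ?b = "\<lambda>k. \<integral>\<^sup>+x\<in>\<Gamma>. ennreal ((\<psi> k x)\<^sup>2) \<partial>surface_measure"
    show "(\<lambda>k. 2 * ?a k + ennreal (2 * c\<^sup>2) * ?b k) \<longlonglongrightarrow> 0"
      using tendsto_add[OF ennreal_tendsto_cmult[OF _ \<phi>(4), of 2] ennreal_tendsto_cmult[OF _ \<psi>(4), of "ennreal (2 * c\<^sup>2)"]]
      by simp
    fix k
    have m: "\<phi> k \<in> borel_measurable surface_measure" "\<psi> k \<in> borel_measurable surface_measure"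
    proof -
      have "Ck 0 (\<phi> k)" "Ck 0 (\<psi> k)" using \<phi>(1) \<psi>(1) unfolding test_functions_def by blast+
      then show "\<phi> k \<in> borel_measurable surface_measure" "\<psi> k \<in> borel_measurable surface_measure"
        by (auto simp: measurable_cong_sets[OF sets_surface_measure] intro: borel_measurable_continuous_onI)
    qed
    have \<Gamma>m: "\<Gamma> \<in> sets surface_measure" using \<Gamma> by (simp add: sets_surface_measure)
    note [measurable] = m \<Gamma>m
    have "(\<integral>\<^sup>+x\<in>\<Gamma>. ennreal ((?\<chi> k x)\<^sup>2) \<partial>surface_measure) \<le>
        (\<integral>\<^sup>+x. 2 * (ennreal ((\<phi> k x)\<^sup>2) * indicator \<Gamma> x) + ennreal (2 * c\<^sup>2) * (ennreal ((\<psi> k x)\<^sup>2) * indicator \<Gamma> x) \<partial>surface_measure)"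
    proof (rule nn_integral_mono)
      fix x
      have "(?\<chi> k x)\<^sup>2 \<le> 2 * (\<phi> k x)\<^sup>2 + 2 * c\<^sup>2 * (\<psi> k x)\<^sup>2"
        using sum_squares_bound[of "\<phi> k x" "c * \<psi> k x"] by (simp add: power2_sum power_mult_distrib)
      then have "ennreal ((?\<chi> k x)\<^sup>2) \<le> ennreal (2 * (\<phi> k x)\<^sup>2 + 2 * c\<^sup>2 * (\<psi> k x)\<^sup>2)"
        by (rule ennreal_leI)
      also have "\<dots> = 2 * ennreal ((\<phi> k x)\<^sup>2) + ennreal (2 * c\<^sup>2) * ennreal ((\<psi> k x)\<^sup>2)"
        by (simp add: ennreal_plus ennreal_mult)
      finally show "ennreal ((?\<chi> k x)\<^sup>2) * indicator \<Gamma> x \<le>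
          2 * (ennreal ((\<phi> k x)\<^sup>2) * indicator \<Gamma> x) + ennreal (2 * c\<^sup>2) * (ennreal ((\<psi> k x)\<^sup>2) * indicator \<Gamma> x)"
        by (simp add: indicator_def)
    qed
    also have "\<dots> = 2 * ?a k + ennreal (2 * c\<^sup>2) * ?b k"
      by (simp add: nn_integral_add nn_integral_cmult)
    finally show "(\<integral>\<^sup>+x\<in>\<Gamma>. ennreal ((?\<chi> k x)\<^sup>2) \<partial>surface_measure) \<le> 2 * ?a k + ennreal (2 * c\<^sup>2) * ?b k" .
  qed simp
  show ?thesis unfolding zero_trace_on_def
    using 1 2 3 \<phi>(1) \<psi>(1)
    by (intro exI[of _ ?\<chi>]) (simp add: test_functions_add test_functions_cmult)
qed

text \<open>A diagonal argument: for each \<open>n\<close> one smooth function is taken that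
  approximates \<open>u n\<close> and is small on the boundary part, all three quantities being
  below \<open>1 / Suc n\<close>. These functions then approximate the limit.\<close>

lemma zero_trace_on_limit:
  assumes \<Omega>: "open \<Omega>" and u: "\<And>n. u n \<in> H1 \<Omega>" "u' \<in> H1 \<Omega>"
    and ulim: "(\<lambda>n. L2_norm \<Omega> (\<lambda>x. u n x - u' x)) \<longlonglongrightarrow> 0"
    and glim: "(\<lambda>n. L2_norm \<Omega> (\<lambda>x. weak_grad \<Omega> (u n) x - weak_grad \<Omega> u' x)) \<longlonglongrightarrow> 0"
    and z: "\<And>n. zero_trace_on \<Omega> \<Gamma> (u n)"
  shows "zero_trace_on \<Omega> \<Gamma> u'"
proof -
  have \<Omega>s: "\<Omega> \<in> sets lebesgue" using \<Omega> by auto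
  have "\<exists>\<phi>. \<phi> \<in> test_functions UNIV \<and> L2_norm \<Omega> (\<lambda>x. u n x - \<phi> x) < 1 / real (Suc n) \<and>
      L2_norm \<Omega> (\<lambda>x. weak_grad \<Omega> (u n) x - grad \<phi> x) < 1 / real (Suc n) \<and>
      (\<integral>\<^sup>+x\<in>\<Gamma>. ennreal ((\<phi> x)\<^sup>2) \<partial>surface_measure) < ennreal (1 / real (Suc n))" for n
  proof -
    obtain \<phi> where \<phi>: "\<And>k. \<phi> k \<in> test_functions UNIV"
      "(\<lambda>k. L2_norm \<Omega> (\<lambda>x. u n x - \<phi> k x)) \<longlonglongrightarrow> 0"
      "(\<lambda>k. L2_norm \<Omega> (\<lambda>x. weak_grad \<Omega> (u n) x - grad (\<phi> k) x)) \<longlonglongrightarrow> 0"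
      "(\<lambda>k. \<integral>\<^sup>+x\<in>\<Gamma>. ennreal ((\<phi> k x)\<^sup>2) \<partial>surface_measure) \<longlonglongrightarrow> 0"
      using z[of n] unfolding zero_trace_on_def by auto
    have p: "0 < 1 / real (Suc n)" by simp
    have "\<forall>\<^sub>F k in sequentially. L2_norm \<Omega> (\<lambda>x. u n x - \<phi> k x) < 1 / real (Suc n) \<and>
        L2_norm \<Omega> (\<lambda>x. weak_grad \<Omega> (u n) x - grad (\<phi> k) x) < 1 / real (Suc n) \<and>
        (\<integral>\<^sup>+x\<in>\<Gamma>. ennreal ((\<phi> k x)\<^sup>2) \<partial>surface_measure) < ennreal (1 / real (Suc n))"
      using order_tendstoD(2)[OF \<phi>(2) p] order_tendstoD(2)[OF \<phi>(3) p]
        order_tendstoD(2)[OF \<phi>(4), of "ennreal (1 / real (Suc n))"]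
      by (intro eventually_conj) (auto simp: ennreal_zero_less_divide)
    then obtain k where "L2_norm \<Omega> (\<lambda>x. u n x - \<phi> k x) < 1 / real (Suc n) \<and>
        L2_norm \<Omega> (\<lambda>x. weak_grad \<Omega> (u n) x - grad (\<phi> k) x) < 1 / real (Suc n) \<and>
        (\<integral>\<^sup>+x\<in>\<Gamma>. ennreal ((\<phi> k x)\<^sup>2) \<partial>surface_measure) < ennreal (1 / real (Suc n))"
      using eventually_happens'[OF trivial_limit_sequentially] by blast
    then show ?thesis using \<phi>(1) by blast
  qed
  then have "\<forall>n. \<exists>\<phi>. \<phi> \<in> test_functions UNIV \<and> L2_norm \<Omega> (\<lambda>x. u n x - \<phi> x) < 1 / real (Suc n) \<and>
      L2_norm \<Omega> (\<lambda>x. weak_grad \<Omega> (u n) x - grad \<phi> x) < 1 / real (Suc n) \<and>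
      (\<integral>\<^sup>+x\<in>\<Gamma>. ennreal ((\<phi> x)\<^sup>2) \<partial>surface_measure) < ennreal (1 / real (Suc n))" ..
  from choice[OF this] obtain \<phi> where \<phi>0: "\<forall>n. \<phi> n \<in> test_functions UNIV \<and>
      L2_norm \<Omega> (\<lambda>x. u n x - \<phi> n x) < 1 / real (Suc n) \<and>
      L2_norm \<Omega> (\<lambda>x. weak_grad \<Omega> (u n) x - grad (\<phi> n) x) < 1 / real (Suc n) \<and>
      (\<integral>\<^sup>+x\<in>\<Gamma>. ennreal ((\<phi> n x)\<^sup>2) \<partial>surface_measure) < ennreal (1 / real (Suc n))" ..
  note \<phi> = \<phi>0[THEN spec, THEN conjunct1] \<phi>0[THEN spec, THEN conjunct2, THEN conjunct1]
    \<phi>0[THEN spec, THEN conjunct2, THEN conjunct2, THEN conjunct1]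
    \<phi>0[THEN spec, THEN conjunct2, THEN conjunct2, THEN conjunct2]
  have inv: "(\<lambda>n. 1 / real (Suc n)) \<longlonglongrightarrow> 0"
    using LIMSEQ_inverse_real_of_nat by (simp add: inverse_eq_divide)
  have lim0: "(\<lambda>n. a n + 1 / real (Suc n)) \<longlonglongrightarrow> 0" if "a \<longlonglongrightarrow> 0" for a :: "nat \<Rightarrow> real"
    using tendsto_add[OF that inv] by simp
  have 1: "(\<lambda>n. L2_norm \<Omega> (\<lambda>x. u' x - \<phi> n x)) \<longlonglongrightarrow> 0"
  proof (rule Lim_null_comparison[OF always_eventually[OF allI] lim0[OF ulim]])
    show "norm (L2_norm \<Omega> (\<lambda>x. u' x - \<phi> n x)) \<le> L2_norm \<Omega> (\<lambda>x. u n x - u' x) + 1 / real (Suc n)" for n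
      using L2_norm_triangle_diff[OF H1_L2[OF u(2)] H1_L2[OF u(1)] test_function_L2[OF \<phi>(1) \<Omega>s], of n n]
        \<phi>(2)[of n] L2_norm_minus_commute[of \<Omega> u' "u n"] L2_norm_nonneg[of \<Omega> "\<lambda>x. u' x - \<phi> n x"]
      by simp
  qed
  have 2: "(\<lambda>n. L2_norm \<Omega> (\<lambda>x. weak_grad \<Omega> u' x - grad (\<phi> n) x)) \<longlonglongrightarrow> 0"
  proof (rule Lim_null_comparison[OF always_eventually[OF allI] lim0[OF glim]])
    show "norm (L2_norm \<Omega> (\<lambda>x. weak_grad \<Omega> u' x - grad (\<phi> n) x)) \<le>
        L2_norm \<Omega> (\<lambda>x. weak_grad \<Omega> (u n) x - weak_grad \<Omega> u' x) + 1 / real (Suc n)" for n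
      using L2_norm_triangle_diff[OF weak_grad_L2[OF u(2)] weak_grad_L2[OF u(1)] grad_test_function_L2[OF \<phi>(1) \<Omega>s], of n n]
        \<phi>(3)[of n] L2_norm_minus_commute[of \<Omega> "weak_grad \<Omega> u'" "weak_grad \<Omega> (u n)"]
        L2_norm_nonneg[of \<Omega> "\<lambda>x. weak_grad \<Omega> u' x - grad (\<phi> n) x"]
      by simp
  qed
  have 3: "(\<lambda>n. \<integral>\<^sup>+x\<in>\<Gamma>. ennreal ((\<phi> n x)\<^sup>2) \<partial>surface_measure) \<longlonglongrightarrow> 0"
  proof (rule tendsto_sandwich[OF always_eventually[OF allI] always_eventually[OF allI] tendsto_const])
    show "(\<lambda>n. ennreal (1 / real (Suc n))) \<longlonglongrightarrow> 0" using tendsto_ennrealI[OF inv] by simp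
    show "(\<integral>\<^sup>+x\<in>\<Gamma>. ennreal ((\<phi> n x)\<^sup>2) \<partial>surface_measure) \<le> ennreal (1 / real (Suc n))" for n
      using \<phi>(4)[of n] by (rule less_imp_le)
  qed simp
  show ?thesis unfolding zero_trace_on_def using 1 2 3 \<phi>(1) by blast
qed

lemma zero_normal_trace_on_add_scaleR:
  assumes \<Omega>: "open \<Omega>" and D: "D \<in> Hdiv \<Omega>" and E: "E \<in> Hdiv \<Omega>"
    and zD: "zero_normal_trace_on \<Omega> \<Gamma> D" and zE: "zero_normal_trace_on \<Omega> \<Gamma> E"
  shows "zero_normal_trace_on \<Omega> \<Gamma> (\<lambda>x. D x + c *\<^sub>R E x)"
  unfolding zero_normal_trace_on_def
proof (intro ballI impI)
  fix v assume v: "v \<in> H1 \<Omega>" and tr: "zero_trace_on \<Omega> (frontier \<Omega> - \<Gamma>) v"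
  let ?M = "lebesgue_on \<Omega>" and ?F = "\<lambda>x. D x + c *\<^sub>R E x"
  note F = Hdiv_add_scaleR[OF \<Omega> D E, of c]
  have int: "integrable ?M (\<lambda>x. G x \<bullet> weak_grad \<Omega> v x + weak_div \<Omega> G x * v x)" if "G \<in> Hdiv \<Omega>" for G
    using L2_integrable_inner[OF Hdiv_L2[OF that] weak_grad_L2[OF v]]
      L2_integrable_inner[OF weak_div_L2[OF that] H1_L2[OF v]] by simp
  have "(\<integral>x. ?F x \<bullet> weak_grad \<Omega> v x + weak_div \<Omega> ?F x * v x \<partial>?M) =
      (\<integral>x. (D x \<bullet> weak_grad \<Omega> v x + weak_div \<Omega> D x * v x) + c * (E x \<bullet> weak_grad \<Omega> v x + weak_div \<Omega> E x * v x) \<partial>?M)"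
  proof (rule integral_cong_AE)
    show "AE x in ?M. ?F x \<bullet> weak_grad \<Omega> v x + weak_div \<Omega> ?F x * v x =
        (D x \<bullet> weak_grad \<Omega> v x + weak_div \<Omega> D x * v x) + c * (E x \<bullet> weak_grad \<Omega> v x + weak_div \<Omega> E x * v x)"
      using weak_div_add_scaleR[OF \<Omega> D E, of c] by eventually_elim (simp add: inner_add_left algebra_simps)
    show "(\<lambda>x. ?F x \<bullet> weak_grad \<Omega> v x + weak_div \<Omega> ?F x * v x) \<in> borel_measurable ?M"
      using int[OF F] by simp
    show "(\<lambda>x. (D x \<bullet> weak_grad \<Omega> v x + weak_div \<Omega> D x * v x) + c * (E x \<bullet> weak_grad \<Omega> v x + weak_div \<Omega> E x * v x)) \<in> borel_measurable ?M"
      by (rule borel_measurable_integrable[OF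
            Bochner_Integration.integrable_add[OF int[OF D] integrable_mult_right[OF int[OF E]]]])
  qed
  also have "\<dots> = (\<integral>x. D x \<bullet> weak_grad \<Omega> v x + weak_div \<Omega> D x * v x \<partial>?M) +
      c * (\<integral>x. E x \<bullet> weak_grad \<Omega> v x + weak_div \<Omega> E x * v x \<partial>?M)"
    by (subst Bochner_Integration.integral_add[OF int[OF D] integrable_mult_right[OF int[OF E]]]) simp
  also have "\<dots> = 0" using zD zE v tr by (simp add: zero_normal_trace_on_def)
  finally show "(\<integral>x. ?F x \<bullet> weak_grad \<Omega> v x + weak_div \<Omega> ?F x * v x \<partial>?M) = 0" .
qed

text \<open>The condition is a family of linear equations, one for each \<open>v\<close>, continuous
  in the field and its divergence, so it passes to the limit equation by equation.\<close>

lemma zero_normal_trace_on_limit: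
  assumes D: "\<And>n. D n \<in> Hdiv \<Omega>" "D' \<in> Hdiv \<Omega>"
    and Dlim: "(\<lambda>n. L2_norm \<Omega> (\<lambda>x. D n x - D' x)) \<longlonglongrightarrow> 0"
    and qlim: "(\<lambda>n. L2_norm \<Omega> (\<lambda>x. weak_div \<Omega> (D n) x - weak_div \<Omega> D' x)) \<longlonglongrightarrow> 0"
    and z: "\<And>n. zero_normal_trace_on \<Omega> \<Gamma> (D n)"
  shows "zero_normal_trace_on \<Omega> \<Gamma> D'"
  unfolding zero_normal_trace_on_def
proof (intro ballI impI)
  fix v assume v: "v \<in> H1 \<Omega>" and tr: "zero_trace_on \<Omega> (frontier \<Omega> - \<Gamma>) v"
  let ?M = "lebesgue_on \<Omega>"
  have split: "(\<integral>x. G x \<bullet> weak_grad \<Omega> v x + weak_div \<Omega> G x * v x \<partial>?M) =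
      (\<integral>x. G x \<bullet> weak_grad \<Omega> v x \<partial>?M) + (\<integral>x. weak_div \<Omega> G x * v x \<partial>?M)" if "G \<in> Hdiv \<Omega>" for G
    using L2_integrable_inner[OF Hdiv_L2[OF that] weak_grad_L2[OF v]]
      L2_integrable_inner[OF weak_div_L2[OF that] H1_L2[OF v]] by simp
  have "(\<lambda>n. (\<integral>x. D n x \<bullet> weak_grad \<Omega> v x \<partial>?M) + (\<integral>x. weak_div \<Omega> (D n) x * v x \<partial>?M)) \<longlonglongrightarrow>
      (\<integral>x. D' x \<bullet> weak_grad \<Omega> v x \<partial>?M) + (\<integral>x. weak_div \<Omega> D' x * v x \<partial>?M)"
    using tendsto_add[OF L2_integral_inner_tendsto[OF Hdiv_L2[OF D(1)] Hdiv_L2[OF D(2)] weak_grad_L2[OF v] Dlim]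
      L2_integral_inner_tendsto[OF weak_div_L2[OF D(1)] weak_div_L2[OF D(2)] H1_L2[OF v] qlim]] by simp
  moreover have "(\<integral>x. D n x \<bullet> weak_grad \<Omega> v x \<partial>?M) + (\<integral>x. weak_div \<Omega> (D n) x * v x \<partial>?M) = 0" for n
    using split[OF D(1)[of n]] z[of n] v tr by (simp add: zero_normal_trace_on_def)
  ultimately show "(\<integral>x. D' x \<bullet> weak_grad \<Omega> v x + weak_div \<Omega> D' x * v x \<partial>?M) = 0"
    using split[OF D(2)] by (simp add: LIMSEQ_const_iff)
qed

section \<open>The state space as a complete seminormed space\<close>

text \<open>A state together with its weak derivatives, as one square integrable function.  This turns
  \<open>H_norm\<close> into a single \<open>L2_norm\<close>.\<close>

definition lift :: "(real^'d) set \<Rightarrow> 'd state \<Rightarrow> real^'d \<Rightarrow>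
    ((real^'d) \<times> (real^'d^'d)) \<times> ((real^'d) \<times> real) \<times> (real^'d^'d) \<times> (real^'d)" where
  "lift \<Omega> = (\<lambda>(u, D, S, P) x.
     ((u x, \<chi> k. weak_grad \<Omega> (\<lambda>x. u x $ k) x), (D x, weak_div \<Omega> D x), S x, P x))"

context
  fixes \<Omega> \<Gamma>fix \<Gamma>ins :: "(real^'d) set"
  assumes \<Omega>: "open \<Omega>" and \<Gamma>fix: "\<Gamma>fix \<in> sets borel"
begin

lemma H_spaceD:
  assumes "(u, D, S, P) \<in> H_space \<Omega> \<Gamma>fix \<Gamma>ins"
  shows "(\<lambda>x. u x $ k) \<in> H1 \<Omega>" "zero_trace_on \<Omega> \<Gamma>fix (\<lambda>x. u x $ k)"
    "D \<in> Hdiv \<Omega>" "zero_normal_trace_on \<Omega> \<Gamma>ins D"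
    "S \<in> L2 \<Omega>" "AE x in lebesgue_on \<Omega>. transpose (S x) = S x" "P \<in> L2 \<Omega>"
  using assms by (auto simp: H_space_def U_space_def D_space_def S_space_def P_space_def)

lemma H0_space_eq:
  "H0_space \<Omega> \<Gamma>fix \<Gamma>ins =
    {(u, D, S, P). (u, D, S, P) \<in> H_space \<Omega> \<Gamma>fix \<Gamma>ins \<and> (AE x in lebesgue_on \<Omega>. weak_div \<Omega> D x = 0)}"
  by (auto simp: H_space_def H0_space_def D0_space_def)

lemma H_space_components_L2:
  assumes w: "(u, D, S, P) \<in> H_space \<Omega> \<Gamma>fix \<Gamma>ins"
  shows "u \<in> L2 \<Omega>" "(\<lambda>x. \<chi> k. weak_grad \<Omega> (\<lambda>x. u x $ k) x) \<in> L2 \<Omega>"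
    "D \<in> L2 \<Omega>" "weak_div \<Omega> D \<in> L2 \<Omega>" "S \<in> L2 \<Omega>" "P \<in> L2 \<Omega>"
proof -
  note d = H_spaceD[OF w]
  show "u \<in> L2 \<Omega>" by (rule L2_vec[OF H1_L2[OF d(1)]])
  show "(\<lambda>x. \<chi> k. weak_grad \<Omega> (\<lambda>x. u x $ k) x) \<in> L2 \<Omega>"
    by (rule L2_vec) (simp add: weak_grad_L2[OF d(1)])
  show "D \<in> L2 \<Omega>" "weak_div \<Omega> D \<in> L2 \<Omega>" by (rule Hdiv_L2[OF d(3)], rule weak_div_L2[OF d(3)])
  show "S \<in> L2 \<Omega>" "P \<in> L2 \<Omega>" using d(5,7) .
qed

lemma lift_L2:
  assumes w: "w \<in> H_space \<Omega> \<Gamma>fix \<Gamma>ins" shows "lift \<Omega> w \<in> L2 \<Omega>"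
proof -
  obtain u D S P where eq: "w = (u, D, S, P)" by (cases w)
  note c = H_space_components_L2[OF w[unfolded eq]]
  show ?thesis unfolding lift_def eq prod.case by (intro L2_Pair c)
qed

lemma H_norm_eq_L2_norm_lift:
  assumes w: "w \<in> H_space \<Omega> \<Gamma>fix \<Gamma>ins" shows "H_norm \<Omega> w = L2_norm \<Omega> (lift \<Omega> w)"
proof -
  obtain u D S P where eq: "w = (u, D, S, P)" by (cases w)
  note c = H_space_components_L2[OF w[unfolded eq]] and d = H_spaceD[OF w[unfolded eq]]
  have "(L2_norm \<Omega> (lift \<Omega> w))\<^sup>2 =
      (L2_norm \<Omega> u)\<^sup>2 + (L2_norm \<Omega> (\<lambda>x. \<chi> k. weak_grad \<Omega> (\<lambda>x. u x $ k) x))\<^sup>2 +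
      ((L2_norm \<Omega> D)\<^sup>2 + (L2_norm \<Omega> (weak_div \<Omega> D))\<^sup>2 + ((L2_norm \<Omega> S)\<^sup>2 + (L2_norm \<Omega> P)\<^sup>2))"
    unfolding lift_def eq prod.case by (simp add: L2_norm_Pair_power2 L2_Pair c)
  also have "(L2_norm \<Omega> u)\<^sup>2 = (\<Sum>k\<in>UNIV. (L2_norm \<Omega> (\<lambda>x. u x $ k))\<^sup>2)"
    by (rule L2_norm_vec_power2) (rule H1_L2[OF d(1)])
  also have "(L2_norm \<Omega> (\<lambda>x. \<chi> k. weak_grad \<Omega> (\<lambda>x. u x $ k) x))\<^sup>2 =
      (\<Sum>k\<in>UNIV. (L2_norm \<Omega> (weak_grad \<Omega> (\<lambda>x. u x $ k)))\<^sup>2)"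
    using L2_norm_vec_power2[of "\<lambda>x. \<chi> k. weak_grad \<Omega> (\<lambda>x. u x $ k) x" \<Omega>] weak_grad_L2[OF d(1)] by simp
  finally have "(L2_norm \<Omega> (lift \<Omega> w))\<^sup>2 = (H_norm \<Omega> w)\<^sup>2"
    unfolding H_norm_def eq prod.case
    by (subst real_sqrt_pow2) (auto intro!: add_nonneg_nonneg sum_nonneg simp: sum.distrib)
  moreover have "H_norm \<Omega> w \<ge> 0"
    unfolding H_norm_def eq prod.case by (intro real_sqrt_ge_zero add_nonneg_nonneg sum_nonneg) auto
  ultimately show ?thesis using L2_norm_nonneg[of \<Omega> "lift \<Omega> w"] by (simp add: power2_eq_iff_nonneg)
qed

lemma add_scaleR_state:
  "(u, D, S, P) + c *\<^sub>R (u', D', S', P') =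
    ((\<lambda>x. u x + c *\<^sub>R u' x), (\<lambda>x. D x + c *\<^sub>R D' x), (\<lambda>x. S x + c *\<^sub>R S' x), (\<lambda>x. P x + c *\<^sub>R P' x))"
  by (simp add: fun_eq_iff scaleR_fun_def)

lemma transpose_add_scaleR: "transpose (A + c *\<^sub>R B) = transpose A + c *\<^sub>R transpose (B :: real^'n^'m)"
  by (simp add: transpose_def vec_eq_iff)

lemma H_space_add_scaleR:
  assumes w: "w \<in> H_space \<Omega> \<Gamma>fix \<Gamma>ins" and w': "w' \<in> H_space \<Omega> \<Gamma>fix \<Gamma>ins"
  shows "w + c *\<^sub>R w' \<in> H_space \<Omega> \<Gamma>fix \<Gamma>ins"
proof -
  obtain u D S P where eq: "w = (u, D, S, P)" by (cases w)
  obtain u' D' S' P' where eq': "w' = (u', D', S', P')" by (cases w')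
  note d = H_spaceD[OF w[unfolded eq]] and d' = H_spaceD[OF w'[unfolded eq']]
  have "(\<lambda>x. u x + c *\<^sub>R u' x) \<in> U_space \<Omega> \<Gamma>fix"
    using H1_add_scaleR[OF \<Omega> d(1) d'(1), of _ c _] zero_trace_on_add_scaleR[OF \<Omega> \<Gamma>fix d(1) d'(1) d(2) d'(2)]
    by (simp add: U_space_def)
  moreover have "(\<lambda>x. D x + c *\<^sub>R D' x) \<in> D_space \<Omega> \<Gamma>ins"
    using Hdiv_add_scaleR[OF \<Omega> d(3) d'(3)] zero_normal_trace_on_add_scaleR[OF \<Omega> d(3) d'(3) d(4) d'(4)]
    by (simp add: D_space_def)
  moreover have "(\<lambda>x. S x + c *\<^sub>R S' x) \<in> S_space \<Omega>"
  proof -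
    have "AE x in lebesgue_on \<Omega>. transpose (S x + c *\<^sub>R S' x) = S x + c *\<^sub>R S' x"
      using d(6) d'(6) by eventually_elim (simp add: transpose_add_scaleR)
    then show ?thesis using L2_add[OF d(5) L2_scaleR[OF d'(5)]] by (simp add: S_space_def)
  qed
  moreover have "(\<lambda>x. P x + c *\<^sub>R P' x) \<in> P_space \<Omega>"
    using L2_add[OF d(7) L2_scaleR[OF d'(7)]] by (simp add: P_space_def)
  ultimately show ?thesis unfolding eq eq' add_scaleR_state H_space_def by blast
qed

lemma H0_space_add_scaleR:
  assumes w: "w \<in> H0_space \<Omega> \<Gamma>fix \<Gamma>ins" and w': "w' \<in> H0_space \<Omega> \<Gamma>fix \<Gamma>ins"
  shows "w + c *\<^sub>R w' \<in> H0_space \<Omega> \<Gamma>fix \<Gamma>ins"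
proof -
  obtain u D S P where eq: "w = (u, D, S, P)" by (cases w)
  obtain u' D' S' P' where eq': "w' = (u', D', S', P')" by (cases w')
  have H: "(u, D, S, P) \<in> H_space \<Omega> \<Gamma>fix \<Gamma>ins" "(u', D', S', P') \<in> H_space \<Omega> \<Gamma>fix \<Gamma>ins"
    and z: "AE x in lebesgue_on \<Omega>. weak_div \<Omega> D x = 0" "AE x in lebesgue_on \<Omega>. weak_div \<Omega> D' x = 0"
    using w w' unfolding H0_space_eq eq eq' by auto
  have "AE x in lebesgue_on \<Omega>. weak_div \<Omega> (\<lambda>x. D x + c *\<^sub>R D' x) x = 0"
    using weak_div_add_scaleR[OF \<Omega> H_spaceD(3)[OF H(1)] H_spaceD(3)[OF H(2)], of c] z
    by eventually_elim simp
  then show ?thesis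
    using H_space_add_scaleR[OF H, of c] unfolding eq eq' add_scaleR_state H0_space_eq by simp
qed

text \<open>Only almost everywhere, because the derivative chosen for a combination may be a
  different representative from the combination of the chosen derivatives.\<close>

lemma lift_add_scaleR:
  assumes w: "w \<in> H_space \<Omega> \<Gamma>fix \<Gamma>ins" and w': "w' \<in> H_space \<Omega> \<Gamma>fix \<Gamma>ins"
  shows "AE x in lebesgue_on \<Omega>. lift \<Omega> (w + c *\<^sub>R w') x = lift \<Omega> w x + c *\<^sub>R lift \<Omega> w' x"
proof -
  obtain u D S P where eq: "w = (u, D, S, P)" by (cases w)
  obtain u' D' S' P' where eq': "w' = (u', D', S', P')" by (cases w')
  note d = H_spaceD[OF w[unfolded eq]] and d' = H_spaceD[OF w'[unfolded eq']]
  have "AE x in lebesgue_on \<Omega>. \<forall>k\<in>UNIV. weak_grad \<Omega> (\<lambda>x. u x $ k + c * u' x $ k) x =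
      weak_grad \<Omega> (\<lambda>x. u x $ k) x + c *\<^sub>R weak_grad \<Omega> (\<lambda>x. u' x $ k) x"
    by (intro AE_finite_allI weak_grad_add_scaleR \<Omega> d(1) d'(1)) auto
  then show ?thesis
    using weak_div_add_scaleR[OF \<Omega> d(3) d'(3), of c]
    unfolding eq eq' add_scaleR_state lift_def prod.case
    by eventually_elim (simp add: vec_eq_iff)
qed

lemma H_norm_add_scaleR_eq:
  assumes w: "w \<in> H_space \<Omega> \<Gamma>fix \<Gamma>ins" and w': "w' \<in> H_space \<Omega> \<Gamma>fix \<Gamma>ins"
  shows "H_norm \<Omega> (w + c *\<^sub>R w') = L2_norm \<Omega> (\<lambda>x. lift \<Omega> w x + c *\<^sub>R lift \<Omega> w' x)"
  unfolding H_norm_eq_L2_norm_lift[OF H_space_add_scaleR[OF w w']]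
  by (rule L2_norm_cong_AE[OF L2D(1)[OF lift_L2[OF H_space_add_scaleR[OF w w']]]
        L2D(1)[OF L2_add[OF lift_L2[OF w] L2_scaleR[OF lift_L2[OF w']]]] lift_add_scaleR[OF w w']])

lemma H_norm_diff_eq:
  assumes w: "w \<in> H_space \<Omega> \<Gamma>fix \<Gamma>ins" and w': "w' \<in> H_space \<Omega> \<Gamma>fix \<Gamma>ins"
  shows "H_norm \<Omega> (w - w') = L2_norm \<Omega> (\<lambda>x. lift \<Omega> w x - lift \<Omega> w' x)"
  using H_norm_add_scaleR_eq[OF w w', of "-1"] by simp

text \<open>Membership of \<open>0\<close> remains a premise; it is obtained at the end from the
  initial state belonging to \<open>X0\<close>.\<close>

lemma subspace_H_space: "0 \<in> H_space \<Omega> \<Gamma>fix \<Gamma>ins \<Longrightarrow> subspace (H_space \<Omega> \<Gamma>fix \<Gamma>ins)"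
  using H_space_add_scaleR[of _ _ 1] H_space_add_scaleR[of 0] by (intro subspaceI) auto

lemma subspace_H0_space: "0 \<in> H0_space \<Omega> \<Gamma>fix \<Gamma>ins \<Longrightarrow> subspace (H0_space \<Omega> \<Gamma>fix \<Gamma>ins)"
  using H0_space_add_scaleR[of _ _ 1] H0_space_add_scaleR[of 0] by (intro subspaceI) auto

lemma H0_space_subset: "H0_space \<Omega> \<Gamma>fix \<Gamma>ins \<subseteq> H_space \<Omega> \<Gamma>fix \<Gamma>ins"
  unfolding H0_space_eq by auto

lemma seminormed_subspace_H_space:
  assumes "0 \<in> H_space \<Omega> \<Gamma>fix \<Gamma>ins" shows "seminormed_subspace (H_space \<Omega> \<Gamma>fix \<Gamma>ins) (H_norm \<Omega>)"
proof
  show "subspace (H_space \<Omega> \<Gamma>fix \<Gamma>ins)" using subspace_H_space[OF assms] .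
  show "0 \<le> H_norm \<Omega> x" if "x \<in> H_space \<Omega> \<Gamma>fix \<Gamma>ins" for x
    using H_norm_eq_L2_norm_lift[OF that] L2_norm_nonneg by simp
  show "H_norm \<Omega> (x + y) \<le> H_norm \<Omega> x + H_norm \<Omega> y" if "x \<in> H_space \<Omega> \<Gamma>fix \<Gamma>ins" "y \<in> H_space \<Omega> \<Gamma>fix \<Gamma>ins" for x y
    using H_norm_add_scaleR_eq[OF that, of 1] L2_norm_triangle[OF lift_L2[OF that(1)] lift_L2[OF that(2)]]
    by (simp add: H_norm_eq_L2_norm_lift that)
  show "H_norm \<Omega> (c *\<^sub>R x) = \<bar>c\<bar> * H_norm \<Omega> x" if x: "x \<in> H_space \<Omega> \<Gamma>fix \<Gamma>ins" for x c
  proof -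
    \<comment> \<open>Writing the multiple as a combination of \<open>x\<close> with itself makes
      \<open>H_norm_add_scaleR_eq\<close> applicable.\<close>
    have "x + (c - 1) *\<^sub>R x = c *\<^sub>R x" by (simp add: algebra_simps)
    moreover have "lift \<Omega> x y + (c - 1) *\<^sub>R lift \<Omega> x y = c *\<^sub>R lift \<Omega> x y" for y by (simp add: algebra_simps)
    ultimately show ?thesis
      using H_norm_add_scaleR_eq[OF x x, of "c - 1"] by (simp add: L2_norm_scaleR H_norm_eq_L2_norm_lift[OF x])
  qed
qed

text \<open>Fields and derivatives converge together, as the \<open>L2\<close> limit
  \<open>G\<close> of the lifts. What remains is that the derivative slots of \<open>G\<close> are
  derivatives of its function slots, so that \<open>G\<close> is almost everywhere a lift, and that
  the constraints persist.\<close>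

lemma H0_space_complete:
  assumes s: "\<And>n. s n \<in> H0_space \<Omega> \<Gamma>fix \<Gamma>ins"
    and Cauchy: "\<And>\<epsilon>. \<epsilon> > 0 \<Longrightarrow> \<exists>M. \<forall>k\<ge>M. \<forall>n\<ge>M. H_norm \<Omega> (s k - s n) < \<epsilon>"
  shows "\<exists>w\<in>H0_space \<Omega> \<Gamma>fix \<Gamma>ins. (\<lambda>n. H_norm \<Omega> (s n - w)) \<longlonglongrightarrow> 0"
proof -
  have sH: "s n \<in> H_space \<Omega> \<Gamma>fix \<Gamma>ins" for n using s H0_space_subset by auto
  have "\<exists>G\<in>L2 \<Omega>. (\<lambda>n. L2_norm \<Omega> (\<lambda>x. lift \<Omega> (s n) x - G x)) \<longlonglongrightarrow> 0"
    by (rule L2_complete[OF lift_L2[OF sH]]) (use Cauchy in \<open>simp add: H_norm_diff_eq[OF sH sH]\<close>)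
  then obtain G where G: "G \<in> L2 \<Omega>" and lim: "(\<lambda>n. L2_norm \<Omega> (\<lambda>x. lift \<Omega> (s n) x - G x)) \<longlonglongrightarrow> 0" by blast
  note lin = L2_tendsto_linear_image[OF _ lift_L2[OF sH] G lim]
  note img = L2_linear_image[OF _ G]
  define us where "us n = fst (s n)" for n
  define Ds where "Ds n = fst (snd (s n))" for n
  define Ss where "Ss n = fst (snd (snd (s n)))" for n
  define Ps where "Ps n = snd (snd (snd (s n)))" for n
  have s_eq: "s n = (us n, Ds n, Ss n, Ps n)" for n by (simp add: us_def Ds_def Ss_def Ps_def)
  note sd = H_spaceD[OF sH[unfolded s_eq]]
  define u where "u x = fst (fst (G x))" for x
  define g where "g x = snd (fst (G x))" for x
  define D where "D x = fst (fst (snd (G x)))" for x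
  define q where "q x = snd (fst (snd (G x)))" for x
  define S where "S x = fst (snd (snd (G x)))" for x
  define P where "P x = snd (snd (snd (G x)))" for x
  \<comment> \<open>Each slot of \<open>G\<close> is a bounded linear image of it, so
    \<open>img\<close> and \<open>lin\<close> hand down square integrability and
    convergence.\<close>
  have bl: "bounded_linear (\<lambda>y. fst (fst y) $ k)" "bounded_linear (\<lambda>y. snd (fst y) $ k)"
    "bounded_linear (\<lambda>y. fst (fst (snd y)))" "bounded_linear (\<lambda>y. snd (fst (snd y)))"
    "bounded_linear (\<lambda>y. fst (snd (snd y)))" "bounded_linear (\<lambda>y. snd (snd (snd y)))"
    for k
    by (intro bounded_linear_compose[OF bounded_linear_vec_nth] bounded_linear_fst_comp bounded_linear_snd_comp
        bounded_linear_ident)+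
  have u: "(\<lambda>x. u x $ k) \<in> H1 \<Omega>" "AE x in lebesgue_on \<Omega>. weak_grad \<Omega> (\<lambda>x. u x $ k) x = g x $ k"
    "zero_trace_on \<Omega> \<Gamma>fix (\<lambda>x. u x $ k)" for k
  proof -
    have uL: "(\<lambda>x. u x $ k) \<in> L2 \<Omega>" and gL: "(\<lambda>x. g x $ k) \<in> L2 \<Omega>"
      using img[OF bl(1)] img[OF bl(2)] by (simp_all add: u_def g_def)
    have ul: "(\<lambda>n. L2_norm \<Omega> (\<lambda>x. us n x $ k - u x $ k)) \<longlonglongrightarrow> 0"
      using lin[OF bl(1), of k] by (simp add: u_def s_eq lift_def)
    have gl: "(\<lambda>n. L2_norm \<Omega> (\<lambda>x. weak_grad \<Omega> (\<lambda>x. us n x $ k) x - g x $ k)) \<longlonglongrightarrow> 0"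
      using lin[OF bl(2), of k] by (simp add: g_def s_eq lift_def)
    have wg: "is_weak_grad \<Omega> (\<lambda>x. u x $ k) (\<lambda>x. g x $ k)"
      by (rule is_weak_grad_limit[OF \<Omega> is_weak_grad_weak_grad[OF sd(1)] H1_L2[OF sd(1)] uL gL ul gl])
    show H1: "(\<lambda>x. u x $ k) \<in> H1 \<Omega>" using wg uL by (auto simp: H1_def)
    show ae: "AE x in lebesgue_on \<Omega>. weak_grad \<Omega> (\<lambda>x. u x $ k) x = g x $ k"
      by (rule weak_grad_eqI[OF \<Omega> wg])
    \<comment> \<open>The trace condition refers to the chosen weak gradient of the limit, the lift
      only provides \<open>g\<close>; the norm does not distinguish them.\<close>
    have "L2_norm \<Omega> (\<lambda>x. weak_grad \<Omega> (\<lambda>x. us n x $ k) x - weak_grad \<Omega> (\<lambda>x. u x $ k) x) =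
        L2_norm \<Omega> (\<lambda>x. weak_grad \<Omega> (\<lambda>x. us n x $ k) x - g x $ k)" for n
      by (rule L2_norm_cong_AE[OF L2D(1)[OF L2_diff[OF weak_grad_L2[OF sd(1)] weak_grad_L2[OF H1]]]
            L2D(1)[OF L2_diff[OF weak_grad_L2[OF sd(1)] gL]]]) (use ae in eventually_elim, simp)
    then show "zero_trace_on \<Omega> \<Gamma>fix (\<lambda>x. u x $ k)"
      using zero_trace_on_limit[OF \<Omega> sd(1) H1 ul _ sd(2)] gl by simp
  qed
  have qL: "q \<in> L2 \<Omega>" and DL: "D \<in> L2 \<Omega>" and SL: "S \<in> L2 \<Omega>" and PL: "P \<in> L2 \<Omega>"
    using img[OF bl(3)] img[OF bl(4)] img[OF bl(5)] img[OF bl(6)]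
    by (simp_all add: q_def[abs_def] D_def[abs_def] S_def[abs_def] P_def[abs_def])
  have Dl: "(\<lambda>n. L2_norm \<Omega> (\<lambda>x. Ds n x - D x)) \<longlonglongrightarrow> 0"
    using lin[OF bl(3)] by (simp add: D_def s_eq lift_def)
  have ql: "(\<lambda>n. L2_norm \<Omega> (\<lambda>x. weak_div \<Omega> (Ds n) x - q x)) \<longlonglongrightarrow> 0"
    using lin[OF bl(4)] by (simp add: q_def s_eq lift_def)
  have Sl: "(\<lambda>n. L2_norm \<Omega> (\<lambda>x. Ss n x - S x)) \<longlonglongrightarrow> 0"
    using lin[OF bl(5)] by (simp add: S_def s_eq lift_def)
  have wd: "is_weak_div \<Omega> D q"
    by (rule is_weak_div_limit[OF \<Omega> is_weak_div_weak_div[OF sd(3)] Hdiv_L2[OF sd(3)] DL qL Dl ql])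
  have Hdiv: "D \<in> Hdiv \<Omega>" using wd DL by (auto simp: Hdiv_def)
  have div_ae: "AE x in lebesgue_on \<Omega>. weak_div \<Omega> D x = q x" by (rule weak_div_eqI[OF \<Omega> wd])
  have q0: "AE x in lebesgue_on \<Omega>. q x = 0"
    by (rule L2_limit_AE_zero[OF weak_div_L2[OF sd(3)] qL ql]) (use s in \<open>simp add: H0_space_eq s_eq\<close>)
  have normal: "zero_normal_trace_on \<Omega> \<Gamma>ins D"
  proof (rule zero_normal_trace_on_limit[OF sd(3) Hdiv Dl _ sd(4)])
    have "L2_norm \<Omega> (\<lambda>x. weak_div \<Omega> (Ds n) x - weak_div \<Omega> D x) = L2_norm \<Omega> (\<lambda>x. weak_div \<Omega> (Ds n) x - q x)" for n
      by (rule L2_norm_cong_AE[OF L2D(1)[OF L2_diff[OF weak_div_L2[OF sd(3)] weak_div_L2[OF Hdiv]]]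
            L2D(1)[OF L2_diff[OF weak_div_L2[OF sd(3)] qL]]]) (use div_ae in eventually_elim, simp)
    then show "(\<lambda>n. L2_norm \<Omega> (\<lambda>x. weak_div \<Omega> (Ds n) x - weak_div \<Omega> D x)) \<longlonglongrightarrow> 0" using ql by simp
  qed
  have sym: "AE x in lebesgue_on \<Omega>. transpose (S x) = S x"
  proof -
    \<comment> \<open>Symmetry is membership in the kernel of this map, which turns it into a
      condition of the form treated by \<open>L2_limit_AE_zero\<close>.\<close>
    have T: "bounded_linear (\<lambda>y :: real^'d^'d. transpose y - y)"
      by (intro linear_conv_bounded_linear[THEN iffD1] linearI)
        (simp_all add: transpose_def vec_eq_iff algebra_simps)
    have "AE x in lebesgue_on \<Omega>. transpose (S x) - S x = 0"
      by (rule L2_limit_AE_zero[OF L2_linear_image[OF T sd(5)] L2_linear_image[OF T SL]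
            L2_tendsto_linear_image[OF T sd(5) SL Sl]]) (use sd(6) in eventually_elim, simp)
    then show ?thesis by eventually_elim simp
  qed
  define w where "w = (u, D, S, P)"
  have wH: "w \<in> H_space \<Omega> \<Gamma>fix \<Gamma>ins"
    using u(1,3) Hdiv normal SL sym PL
    by (simp add: w_def H_space_def U_space_def D_space_def S_space_def P_space_def)
  have "AE x in lebesgue_on \<Omega>. weak_div \<Omega> D x = 0" using div_ae q0 by eventually_elim simp
  then have wH0: "w \<in> H0_space \<Omega> \<Gamma>fix \<Gamma>ins" using wH by (simp add: w_def H0_space_eq)
  have "AE x in lebesgue_on \<Omega>. \<forall>k\<in>UNIV. weak_grad \<Omega> (\<lambda>x. u x $ k) x = g x $ k"
    by (intro AE_finite_allI u(2)) auto
  then have lw: "AE x in lebesgue_on \<Omega>. lift \<Omega> w x = G x"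
    using div_ae
    by eventually_elim
      (simp add: w_def lift_def u_def D_def S_def P_def g_def q_def vec_eq_iff prod_eq_iff)
  have "H_norm \<Omega> (s n - w) = L2_norm \<Omega> (\<lambda>x. lift \<Omega> (s n) x - G x)" for n
    unfolding H_norm_diff_eq[OF sH wH]
    by (rule L2_norm_cong_AE[OF L2D(1)[OF L2_diff[OF lift_L2[OF sH] lift_L2[OF wH]]]
          L2D(1)[OF L2_diff[OF lift_L2[OF sH] G]]]) (use lw in eventually_elim, simp)
  then have "(\<lambda>n. H_norm \<Omega> (s n - w)) \<longlonglongrightarrow> 0" using lim by simp
  with wH0 show ?thesis by (rule bexI[rotated])
qed

lemma state_eq_if_H_norm_diff_eq_0:
  assumes w: "w \<in> H_space \<Omega> \<Gamma>fix \<Gamma>ins" and w': "w' \<in> H_space \<Omega> \<Gamma>fix \<Gamma>ins" and z: "H_norm \<Omega> (w - w') = 0"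
  shows "state_eq \<Omega> w w'"
proof -
  have "AE x in lebesgue_on \<Omega>. lift \<Omega> w x - lift \<Omega> w' x = 0"
    using z L2_norm_eq_0_iff[OF L2_diff[OF lift_L2[OF w] lift_L2[OF w']]] by (simp add: H_norm_diff_eq[OF w w'])
  then have "AE x in lebesgue_on \<Omega>. lift \<Omega> w x = lift \<Omega> w' x" by eventually_elim simp
  then show ?thesis
    by (cases w, cases w') (auto simp: state_eq_def lift_def elim: eventually_mono)
qed

section \<open>The augmented dissipation on and off the divergence-free states\<close>

lemma augmented_dissipation_finite:
  assumes w: "w \<in> H0_space \<Omega> \<Gamma>fix \<Gamma>ins" shows "augmented_dissipation \<Omega> \<Phi> w < \<infinity>"
proof -
  obtain u D S P where eq: "w = (u, D, S, P)" by (cases w)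
  have z: "AE x in lebesgue_on \<Omega>. weak_div \<Omega> D x = 0" using w by (simp add: eq H0_space_eq)
  have "(\<integral>x. weak_div \<Omega> D x * \<phi> x \<partial>lebesgue_on \<Omega>) = 0" for \<phi>
    by (rule integral_eq_zero_AE) (use z in eventually_elim, simp)
  \<comment> \<open>The supremum of the constant \<open>0\<close> is \<open>0\<close> only over a
    nonempty index set.\<close>
  moreover have "L2 \<Omega> \<noteq> ({} :: (real^'d \<Rightarrow> real) set)" using L2_zero by blast
  ultimately show ?thesis by (simp add: augmented_dissipation_def eq)
qed

lemma augmented_dissipation_infinite:
  assumes w: "w \<in> H_space \<Omega> \<Gamma>fix \<Gamma>ins - H0_space \<Omega> \<Gamma>fix \<Gamma>ins"
  shows "augmented_dissipation \<Omega> \<Phi> w = \<infinity>"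
proof -
  obtain u D S P where eq: "w = (u, D, S, P)" by (cases w)
  let ?q = "weak_div \<Omega> D" and ?M = "lebesgue_on \<Omega>"
  have H: "(u, D, S, P) \<in> H_space \<Omega> \<Gamma>fix \<Gamma>ins" and nz: "\<not> (AE x in ?M. ?q x = 0)"
    using w by (auto simp: eq H0_space_eq)
  have qL: "?q \<in> L2 \<Omega>" by (rule weak_div_L2[OF H_spaceD(3)[OF H]])
  define c where "c = (L2_norm \<Omega> ?q)\<^sup>2"
  have c: "c > 0" using nz L2_norm_eq_0_iff[OF qL] by (simp add: c_def)
  have int: "(\<integral>x. ?q x * (t * ?q x) \<partial>?M) = t * c" for t
    unfolding c_def L2_norm_power2 by (simp add: power2_eq_square mult.left_commute)
  have "(SUP \<phi>\<in>L2 \<Omega>. ereal (\<integral>x. ?q x * \<phi> x \<partial>?M)) = \<infinity>"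
  proof (rule SUP_PInfty)
    fix n :: nat
    \<comment> \<open>The divergence itself serves as the direction: with \<open>c\<close> its
      squared norm, the multiple by \<open>n / c\<close> gives the integral the value
      \<open>n\<close>.\<close>
    have "(\<lambda>x. (real n / c) * ?q x) \<in> L2 \<Omega>" using L2_scaleR[OF qL, of "real n / c"] by simp
    moreover have "ereal (real n) \<le> ereal (\<integral>x. ?q x * ((real n / c) * ?q x) \<partial>?M)"
      unfolding int using c by simp
    ultimately show "\<exists>\<phi>\<in>L2 \<Omega>. ereal (real n) \<le> ereal (\<integral>x. ?q x * \<phi> x \<partial>?M)"
      by (intro bexI[of _ "\<lambda>x. (real n / c) * ?q x"])
  qed
  then show ?thesis by (simp add: augmented_dissipation_def eq)
qed

end

section \<open>Transfer of the abstract result to the piezoelectric state space\<close>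

theorem theorem2:
  fixes \<Omega> \<Gamma>fix \<Gamma>ins :: "(real^'d) set"
    and H H0 X X0 :: "'d state set"
    and \<Psi> j :: "'d state \<Rightarrow> ereal"
    and \<Phi> :: "'d state \<Rightarrow> real"
    and A :: "'d state \<Rightarrow> 'd state \<Rightarrow> real"
    and l :: "nat \<Rightarrow> 'd state \<Rightarrow> real"
    and m :: real and N :: nat
  assumes dim: "CARD('d) = 2 \<or> CARD('d) = 3"
    and domain: "open \<Omega>" "connected \<Omega>" "\<Omega> \<noteq> {}"
    and boundary_parts: "\<Gamma>fix \<subseteq> frontier \<Omega>" "\<Gamma>ins \<subseteq> frontier \<Omega>"
      "\<Gamma>fix \<in> sets borel" "\<Gamma>ins \<in> sets borel"
    and H: "H = H_space \<Omega> \<Gamma>fix \<Gamma>ins"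
    and H0: "H0 = H0_space \<Omega> \<Gamma>fix \<Gamma>ins"
    and \<Psi>_values: "\<forall>z\<in>H. \<Psi> z \<noteq> -\<infinity>"
    and X: "X = {z\<in>H. \<Psi> z < \<infinity>}"
    and X0: "X0 = X \<inter> H0"
    and initial: "0 \<in> X0"
    and \<Psi>_convex: "convex_fun H \<Psi>"
    and \<Psi>_lsc: "lsc_fun H (H_norm \<Omega>) \<Psi>"
    and \<Psi>_deriv: "\<forall>w\<in>X. has_frechet_deriv H (H_norm \<Omega>) \<Psi> (A w) w"
    and j: "\<forall>z\<in>H. j z = augmented_dissipation \<Omega> \<Phi> z"
    and j_nonneg: "\<forall>z\<in>H. j z \<ge> 0"
    and j_proper: "\<exists>z\<in>H. j z < \<infinity>"
    and j_convex: "convex_fun H j"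
    and j_hom: "\<forall>\<alpha>>0. \<forall>z\<in>H. j (\<alpha> *\<^sub>R z) = ereal \<alpha> * j z"
    and j_lsc: "lsc_fun H (H_norm \<Omega>) j"
    and m: "m > 0"
    and A_strongly_monotone: "\<forall>w1\<in>X0. \<forall>w2\<in>X0.
      A w1 (w1 - w2) - A w2 (w1 - w2) \<ge> m * (H_norm \<Omega> (w1 - w2))\<^sup>2"
    and l_dual: "\<forall>n\<le>N. l n \<in> dual_space H (H_norm \<Omega>)"
    and l_0: "\<forall>z\<in>H. l 0 z = 0"
  shows
    "(\<exists>w. incremental_solution H H0 X0 A j l N w \<and>
        (\<forall>w'. incremental_solution H H0 X0 A j l N w' \<longrightarrow> (\<forall>n\<le>N. state_eq \<Omega> (w' n) (w n)))) \<and>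
     (\<forall>w. incremental_solution H H0 X0 A j l N w \<longleftrightarrow> incremental_solution H0 H0 X0 A j l N w) \<and>
     (\<forall>w. incremental_solution H H0 X0 A j l N w \<longrightarrow>
        (\<forall>n\<in>{1..N}. n \<ge> 2 \<or> (\<forall>z\<in>H. ereal (A 0 z) + j z \<ge> 0) \<longrightarrow>
           H_norm \<Omega> (w n - w (n - 1))
             \<le> 1 / m * dual_norm H (H_norm \<Omega>) (\<lambda>z. l n z - l (n - 1) z)))"
proof -
  have zH: "0 \<in> H_space \<Omega> \<Gamma>fix \<Gamma>ins" and zH0: "0 \<in> H0_space \<Omega> \<Gamma>fix \<Gamma>ins"
    using initial by (auto simp: X0 X H H0)
  interpret seminormed_subspace H "H_norm \<Omega>"
    unfolding H by (rule seminormed_subspace_H_space[OF domain(1) boundary_parts(3) zH])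
  interpret incremental_problem H "H_norm \<Omega>" H0 X X0 \<Psi> j A m
  proof
    show "subspace H0" unfolding H0 by (rule subspace_H0_space[OF domain(1) boundary_parts(3) zH0])
    show sub: "H0 \<subseteq> H" unfolding H H0 by (rule H0_space_subset[OF domain(1) boundary_parts(3)])
    show "\<exists>w\<in>H0. (\<lambda>n. H_norm \<Omega> (s n - w)) \<longlonglongrightarrow> 0"
      if "\<And>n. s n \<in> H0" "\<And>\<epsilon>. \<epsilon> > 0 \<Longrightarrow> \<exists>M. \<forall>k\<ge>M. \<forall>n\<ge>M. H_norm \<Omega> (s k - s n) < \<epsilon>" for s
      using H0_space_complete[OF domain(1) boundary_parts(3) that(1)[unfolded H0] that(2)] unfolding H0 .
    show "j z < \<infinity>" if "z \<in> H0" for z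
      using augmented_dissipation_finite[OF domain(1) boundary_parts(3) that[unfolded H0]] j sub that by auto
    show "j z = \<infinity>" if "z \<in> H - H0" for z
      using augmented_dissipation_infinite[OF domain(1) boundary_parts(3) that[unfolded H H0]] j that by auto
  qed (use \<Psi>_values X X0 initial \<Psi>_convex \<Psi>_lsc \<Psi>_deriv j_nonneg j_convex j_hom j_lsc m
      A_strongly_monotone in auto)
  have l: "\<And>n. n \<le> N \<Longrightarrow> l n \<in> dual_space H (H_norm \<Omega>)" and l0: "\<And>z. z \<in> H \<Longrightarrow> l 0 z = 0"
    using l_dual l_0 by auto
  show ?thesis
  proof (intro conjI allI impI ballI)
    obtain w where w: "incremental_solution H H0 X0 A j l N w" using ex_incremental_solution[of N l] l by blast
    have "state_eq \<Omega> (w' n) (w n)" if w': "incremental_solution H H0 X0 A j l N w'" and n: "n \<le> N" for w' n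
    proof (rule state_eq_if_H_norm_diff_eq_0[OF domain(1) boundary_parts(3)])
      show "w' n \<in> H_space \<Omega> \<Gamma>fix \<Gamma>ins" "w n \<in> H_space \<Omega> \<Gamma>fix \<Gamma>ins"
        using X0_in_H[OF incremental_solution_mem_X0[OF _ n]] w w' unfolding H by blast+
      show "H_norm \<Omega> (w' n - w n) = 0" using incremental_solution_unique[OF _ w' w n] l by blast
    qed
    then show "\<exists>w. incremental_solution H H0 X0 A j l N w \<and>
        (\<forall>w'. incremental_solution H H0 X0 A j l N w' \<longrightarrow> (\<forall>n\<le>N. state_eq \<Omega> (w' n) (w n)))"
      using w by blast
    show "incremental_solution H H0 X0 A j l N w \<longleftrightarrow> incremental_solution H0 H0 X0 A j l N w" for w
      by (simp add: incremental_solution_iff_vi)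
    fix w n
    assume "incremental_solution H H0 X0 A j l N w" "n \<in> {1..N}" "n \<ge> 2 \<or> (\<forall>z\<in>H. ereal (A 0 z) + j z \<ge> 0)"
    then show "H_norm \<Omega> (w n - w (n - 1)) \<le> 1 / m * dual_norm H (H_norm \<Omega>) (\<lambda>z. l n z - l (n - 1) z)"
      using incremental_solution_stability[of N l w n] l l0 by simp
  qed
qed

end
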